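(* Consider the IMEX Runge--Kutta time discretization of the scaled micro-macro BGK system whose internal stages, for $i=1,\dots,s$, are $$\rho^{(i)}=\rho^n-\frac{\Delta t}{\varepsilon}\sum_{j=1}^{i}a_{ij}\nabla_x\cdot u^{(j)},$$ $$u^{(i)}=u^n-\Delta t\sum_{j=1}^{i}\Big(a_{ij}\nabla_x\cdot\langle \mathcal A(v)g^{(j)}\rangle+\frac{a_{ij}}{\varepsilon}\nabla_x(T^{(j)}+\rho^{(j)})\Big),$$ $$T^{(i)}=T^n-\Delta t\sum_{j=1}^{i}\Big(\frac{a_{ij}}{d}\nabla_x\cdot\langle \mathcal B(v)g^{(j)}\rangle+\frac{2a_{ij}}{d\varepsilon}\nabla_x\cdot u^{(j)}\Big),$$ $$p^{(i)}=p^n-\Delta t\sum_{j=1}^{i}\Big(\frac{a_{ij}}{d}\nabla_x\cdot\langle \mathcal B(v)g^{(j)}\rangle+\frac{d+2}{d\varepsilon}a_{ij}\nabla_x\cdot u^{(j)}\Big),$$ $$g^{(i)}=g^n-\frac{\Delta t}{\varepsilon^2}\sum_{j=1}^{i-1}\tilde a_{ij}\Big(\nabla_x\cdot\big[\mathcal A(v)u^{(j)}+\tfrac{\mathcal B(v)}{2}T^{(j)}+\varepsilon(I-P)(vg^{(j)})\big]-Q(u^{(j)},\rho^{(j)},T^{(j)})\Big)-\frac{\Delta t}{\varepsilon^2\tau}\sum_{j=1}^{i}a_{ij}g^{(j)},$$ where $p=\rho+T$. If the IMEX method is of type CK and satisfies the GSA property, and the initial velocity field is divergence free, then in the fluid dynamic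 limit $\varepsilon\to0$ this scheme becomes a consistent time discretization of the incompressible Navier--Stokes equations $$\nabla_x\cdot u=0,\qquad \partial_t u+\nabla_x\cdot(u\otimes u)+\nabla_x\tilde p=\tau\Delta_x u .$$
   Context: Setting. $d\in\{1,2,3\}$, $x\in D\subset\mathbb R^d$, $v\in\mathbb R^d$, $\tau>0$ is the relaxation time, $\Delta t>0$ the time step, $\varepsilon>0$ the Knudsen number. Only time is discretized. The unknowns are $\rho(x,t),T(x,t)\in\mathbb R$, $u(x,t)\in\mathbb R^d$ and $g(x,v,t)\in\mathbb R$; a superscript $n$ denotes the approximation at time $t^n$, a superscript $(i)$ an internal stage. Notation. $M(v)=(2\pi)^{-d/2}e^{-|v|^2/2}$ and $\langle f\rangle=\int_{\mathbb R^d}f(v)M(v)\,dv$. $P$ is the projection $Pf=\langle f\rangle+v\cdot\langle vf\rangle+\frac{|v|^2-d}{2}\big\langle\frac{|v|^2-d}{d}f\big\rangle$, and $g$ satisfies $Pg=0$. $\mathcal A(v)=v\otimes v-\frac{|v|^2}{d}I$ and $\mathcal B(v)=v(|v|^2-(d+2))$. Here $\nabla_x\cdot[\mathcal A(v)u]=\mathcal A(v):\nabla_x u$ and $\nabla_x\cdot[\mathcal B(v)T]=\mathcal B(v)\cdot\nabla_x T$. Further $$Q(u,\rho,T)(v)=\frac{1}{\varepsilon^2\tau}\Big(\frac{M_F(v)}{M(v)}-1-\varepsilon\big(\rho+v\cdot u+\tfrac{|v|^2-d}{2}T\big)\Big),\qquad M_F(v)=\frac{\rho_F}{(2\pi T_F)^{d/2}}\exp\Big(-\frac{|v-u_F|^2}{2T_F}\Big),$$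 with $\rho_F=1+\varepsilon\rho$, $\rho_Fu_F=\varepsilon u$, $T_F=1+\varepsilon\frac{T}{1+\varepsilon\rho}-\varepsilon^2\frac{|u|^2}{d(1+\varepsilon\rho)^2}$. IMEX tableaux. An $s$-stage IMEX Runge--Kutta method is given by an explicit tableau $(\tilde A,\tilde w)$, with $\tilde A=(\tilde a_{ij})\in\mathbb R^{s\times s}$ lower triangular with zero diagonal, and an implicit tableau $(A,w)$, with $A=(a_{ij})\in\mathbb R^{s\times s}$ lower triangular (diagonally implicit). It is of type CK if $A=\begin{pmatrix}0&0\\ a&\hat A\end{pmatrix}$ with $a=(a_{21},\dots,a_{s1})^T\in\mathbb R^{s-1}$ and $\hat A\in\mathbb R^{(s-1)\times(s-1)}$ invertible. It is implicitly stiffly accurate if $a_{si}=w_i$ for $i=1,\dots,s$, and globally stiffly accurate (GSA) if additionally $\tilde a_{si}=\tilde w_i$ for $i=1,\dots,s-1$ (with $\tilde w_s=0$); for a GSA method the numerical solution at $t^{n+1}$ equals the last internal stage $(s)$. Meaning of the limit and of consistency. The limit $\varepsilon\to0$ is formal: $p=\rho+T$ is rescaled as $p=\varepsilon\tilde p$, and $\rho,u,T,\tilde p,g$ (values at $t^n$ and at all stages), together with the space derivatives and velocity moments occurring, are taken to have finite limits as $\varepsilon\to0$, with limits and derivatives/moments interchanged. The initial velocity field is the velocity from which the scheme is started (i.e. $u^n$ for the step considered as the first one). "Becomes a consistent discretization" means that the limits of the stages are the stages of the IMEX Runge--Kutta method with the same tableaux applied to the limit equations, with convection and diffusion treated by the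 explicit tableau and pressure gradient and incompressibility by the implicit one: for $i=1,\dots,s$, $\nabla_x\cdot u^{(i)}=0$ and $$u^{(i)}=u^n+\Delta t\sum_{j=1}^{i-1}\tilde a_{ij}\big(\tau\Delta_xu^{(j)}-(u^{(j)}\cdot\nabla_x)u^{(j)}\big)-\Delta t\sum_{j=1}^{i}a_{ij}\nabla_x\pi^{(j)}$$ for some stage pressures $\pi^{(j)}$ (obtained from $\tilde p^{(j)}$ by absorbing gradient terms of the form $\nabla_x\frac{|u^{(j)}|^2}{d}$), the values at $t^{n+1}$ being those of the stage $i=s$. *)

theory Defs
  imports "HOL-Analysis.Analysis" "Jordan_Normal_Form.Matrix"
begin

no_notation Matrix.vec_index (infixl "$" 100)
no_notation Matrix.scalar_prod (infix "\<bullet>" 70)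

section \<open>Differential operators in \<open>x\<close>\<close>

definition partial_deriv ::
    "'d::finite \<Rightarrow> (real^'d \<Rightarrow> 'b::real_normed_vector) \<Rightarrow> real^'d \<Rightarrow> 'b" where
  "partial_deriv k f x = frechet_derivative f (at x) (axis k 1)"

definition grad_x :: "(real^'d::finite \<Rightarrow> real) \<Rightarrow> real^'d \<Rightarrow> real^'d" where
  "grad_x f x = (\<chi> k. partial_deriv k f x)"

definition div_x :: "(real^'d::finite \<Rightarrow> real^'d) \<Rightarrow> real^'d \<Rightarrow> real" where
  "div_x f x = (\<Sum>k\<in>UNIV. partial_deriv k f x $ k)"

text \<open>Divergence of a matrix field, contracting the first index; it is only applied to
  symmetric fields.\<close>

definition div_tensor_x :: "(real^'d::finite \<Rightarrow> real^'d^'d) \<Rightarrow> real^'d \<Rightarrow> real^'d" where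
  "div_tensor_x S x = (\<chi> l. \<Sum>k\<in>UNIV. partial_deriv k S x $ k $ l)"

definition laplacian_x :: "(real^'d::finite \<Rightarrow> real^'d) \<Rightarrow> real^'d \<Rightarrow> real^'d" where
  "laplacian_x f x = (\<Sum>k\<in>UNIV. partial_deriv k (partial_deriv k f) x)"

definition convect_x ::
    "(real^'d::finite \<Rightarrow> real^'d) \<Rightarrow> (real^'d \<Rightarrow> real^'d) \<Rightarrow> real^'d \<Rightarrow> real^'d" where
  "convect_x u f x = (\<Sum>k\<in>UNIV. (u x $ k) *\<^sub>R partial_deriv k f x)"

definition C2_on :: "(real^'d::finite) set \<Rightarrow> (real^'d \<Rightarrow> 'b::real_normed_vector) \<Rightarrow> bool" where
  "C2_on D f \<longleftrightarrow>
     (\<forall>x\<in>D. f differentiable (at x)) \<and>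
     (\<forall>k. \<forall>x\<in>D. partial_deriv k f differentiable (at x)) \<and>
     (\<forall>k l. continuous_on D (partial_deriv l (partial_deriv k f)))"

section \<open>Velocity space\<close>

abbreviation dim_of :: "'d::finite itself \<Rightarrow> real" where
  "dim_of _ \<equiv> real CARD('d)"

definition maxwellian :: "real^'d::finite \<Rightarrow> real" where
  "maxwellian v = (2 * pi) powr (- dim_of TYPE('d) / 2) * exp (- (norm v)\<^sup>2 / 2)"

definition vbracket ::
    "(real^'d::finite \<Rightarrow> 'b::{banach, second_countable_topology}) \<Rightarrow> 'b" where
  "vbracket f = (LINT v|lborel. maxwellian v *\<^sub>R f v)"

definition proj_P :: "(real^'d::finite \<Rightarrow> real) \<Rightarrow> real^'d \<Rightarrow> real" where
  "proj_P f v =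
     vbracket f + v \<bullet> vbracket (\<lambda>w. f w *\<^sub>R w)
     + ((norm v)\<^sup>2 - dim_of TYPE('d)) / 2
       * vbracket (\<lambda>w. ((norm w)\<^sup>2 - dim_of TYPE('d)) / dim_of TYPE('d) * f w)"

definition otimes :: "real^'d::finite \<Rightarrow> real^'d \<Rightarrow> real^'d^'d" where
  "otimes v w = (\<chi> k l. v $ k * w $ l)"

definition calA :: "real^'d::finite \<Rightarrow> real^'d^'d" where
  "calA v = otimes v v - ((norm v)\<^sup>2 / dim_of TYPE('d)) *\<^sub>R Finite_Cartesian_Product.mat 1"

definition calB :: "real^'d::finite \<Rightarrow> real^'d" where
  "calB v = ((norm v)\<^sup>2 - (dim_of TYPE('d) + 2)) *\<^sub>R v"

text \<open>The local Maxwellian \<open>M\<^sub>F\<close> and the term \<open>Q\<close>, as functions of the values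
  \<open>u\<close>, \<open>r = \<rho>\<close>, \<open>\<theta> = T\<close> at one point. The bulk velocity is
  \<open>u\<^sub>F = \<epsilon> u / \<rho>\<^sub>F\<close>.\<close>

definition MF :: "real \<Rightarrow> real^'d::finite \<Rightarrow> real \<Rightarrow> real \<Rightarrow> real^'d \<Rightarrow> real" where
  "MF \<epsilon> u r \<theta> v =
     (let rF = 1 + \<epsilon> * r;
          uF = (\<epsilon> / rF) *\<^sub>R u;
          TF = 1 + \<epsilon> * (\<theta> / (1 + \<epsilon> * r))
                 - \<epsilon>\<^sup>2 * ((norm u)\<^sup>2 / (dim_of TYPE('d) * (1 + \<epsilon> * r)\<^sup>2))
      in rF / (2 * pi * TF) powr (dim_of TYPE('d) / 2) * exp (- (norm (v - uF))\<^sup>2 / (2 * TF)))"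

definition Qterm :: "real \<Rightarrow> real \<Rightarrow> real^'d::finite \<Rightarrow> real \<Rightarrow> real \<Rightarrow> real^'d \<Rightarrow> real" where
  "Qterm \<tau> \<epsilon> u r \<theta> v =
     1 / (\<epsilon>\<^sup>2 * \<tau>) *
       (MF \<epsilon> u r \<theta> v / maxwellian v - 1
        - \<epsilon> * (r + v \<bullet> u + ((norm v)\<^sup>2 - dim_of TYPE('d)) / 2 * \<theta>))"

section \<open>IMEX tableaux\<close>

text \<open>Tableau entries are indexed from 1 to \<open>s\<close>; values outside this range are irrelevant.\<close>

definition imex_tableaux ::
    "nat \<Rightarrow> (nat \<Rightarrow> nat \<Rightarrow> real) \<Rightarrow> (nat \<Rightarrow> nat \<Rightarrow> real) \<Rightarrow> bool" where
  "imex_tableaux s At A \<longleftrightarrow>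
     (\<forall>i\<in>{1..s}. \<forall>j\<in>{1..s}. (i \<le> j \<longrightarrow> At i j = 0) \<and> (i < j \<longrightarrow> A i j = 0))"

definition type_CK :: "nat \<Rightarrow> (nat \<Rightarrow> nat \<Rightarrow> real) \<Rightarrow> bool" where
  "type_CK s A \<longleftrightarrow>
     (\<forall>j\<in>{1..s}. A 1 j = 0) \<and>
     invertible_mat (Matrix.mat (s - 1) (s - 1) (\<lambda>(i, j). A (i + 2) (j + 2)))"

definition implicitly_stiffly_accurate ::
    "nat \<Rightarrow> (nat \<Rightarrow> nat \<Rightarrow> real) \<Rightarrow> (nat \<Rightarrow> real) \<Rightarrow> bool" where
  "implicitly_stiffly_accurate s A w \<longleftrightarrow> (\<forall>i\<in>{1..s}. A s i = w i)"

definition GSA ::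
    "nat \<Rightarrow> (nat \<Rightarrow> nat \<Rightarrow> real) \<Rightarrow> (nat \<Rightarrow> real) \<Rightarrow> (nat \<Rightarrow> nat \<Rightarrow> real) \<Rightarrow> (nat \<Rightarrow> real) \<Rightarrow> bool" where
  "GSA s At wt A w \<longleftrightarrow>
     implicitly_stiffly_accurate s A w \<and> (\<forall>i\<in>{1..s-1}. At s i = wt i) \<and> wt s = 0"

section \<open>The scheme for the micro-macro BGK system\<close>

record ('d::finite) fields =
  rho :: "real^'d \<Rightarrow> real"
  vel :: "real^'d \<Rightarrow> real^'d"
  temp :: "real^'d \<Rightarrow> real"
  micro :: "real^'d \<Rightarrow> real^'d \<Rightarrow> real"  \<comment> \<open>\<open>g\<close>, arguments \<open>x\<close> and \<open>v\<close>\<close>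

definition press :: "'d::finite fields \<Rightarrow> real^'d \<Rightarrow> real" where
  "press Y x = rho Y x + temp Y x"

text \<open>\<open>\<nabla>\<^sub>x \<cdot> [A(v) u + B(v)/2 T + \<epsilon> (I - P)(v g)] - Q(u, \<rho>, T)\<close>, with the projection
  acting on each component of \<open>v g\<close>.\<close>

definition micro_rhs :: "real \<Rightarrow> real \<Rightarrow> 'd::finite fields \<Rightarrow> real^'d \<Rightarrow> real^'d \<Rightarrow> real" where
  "micro_rhs \<tau> \<epsilon> Y x v =
     div_x (\<lambda>y. calA v *v vel Y y + temp Y y *\<^sub>R ((1/2) *\<^sub>R calB v)
              + \<epsilon> *\<^sub>R (\<chi> k. v $ k * micro Y y v - proj_P (\<lambda>w. w $ k * micro Y y w) v)) x
     - Qterm \<tau> \<epsilon> (vel Y x) (rho Y x) (temp Y x) v"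

text \<open>\<open>imex_update D \<tau> \<Delta>t \<epsilon> Je b~ Ji b Yn Y Z\<close>: the fields \<open>Z\<close> arise from \<open>Yn\<close> and the stages
  \<open>Y\<close> with explicit coefficients \<open>b~ j\<close>, \<open>j \<in> Je\<close>, and implicit coefficients
  \<open>b j\<close>, \<open>j \<in> Ji\<close>. It serves for the internal stages and for the final update.\<close>

definition imex_update ::
    "(real^'d::finite) set \<Rightarrow> real \<Rightarrow> real \<Rightarrow> real \<Rightarrow> nat set \<Rightarrow> (nat \<Rightarrow> real) \<Rightarrow> nat set \<Rightarrow> (nat \<Rightarrow> real)
      \<Rightarrow> 'd fields \<Rightarrow> (nat \<Rightarrow> 'd fields) \<Rightarrow> 'd fields \<Rightarrow> bool" where
  "imex_update D \<tau> dt \<epsilon> Je bt Ji b Yn Y Z \<longleftrightarrow> (\<forall>x\<in>D.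
     rho Z x = rho Yn x - dt / \<epsilon> * (\<Sum>j\<in>Ji. b j * div_x (vel (Y j)) x) \<and>
     vel Z x = vel Yn x - dt *\<^sub>R (\<Sum>j\<in>Ji.
         b j *\<^sub>R div_tensor_x (\<lambda>y. vbracket (\<lambda>v. micro (Y j) y v *\<^sub>R calA v)) x
         + (b j / \<epsilon>) *\<^sub>R grad_x (\<lambda>y. temp (Y j) y + rho (Y j) y) x) \<and>
     temp Z x = temp Yn x - dt * (\<Sum>j\<in>Ji.
         b j / dim_of TYPE('d) * div_x (\<lambda>y. vbracket (\<lambda>v. micro (Y j) y v *\<^sub>R calB v)) x
         + 2 * b j / (dim_of TYPE('d) * \<epsilon>) * div_x (vel (Y j)) x) \<and>
     press Z x = press Yn x - dt * (\<Sum>j\<in>Ji.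
         b j / dim_of TYPE('d) * div_x (\<lambda>y. vbracket (\<lambda>v. micro (Y j) y v *\<^sub>R calB v)) x
         + (dim_of TYPE('d) + 2) / (dim_of TYPE('d) * \<epsilon>) * b j * div_x (vel (Y j)) x) \<and>
     (\<forall>v. micro Z x v = micro Yn x v
         - dt / \<epsilon>\<^sup>2 * (\<Sum>j\<in>Je. bt j * micro_rhs \<tau> \<epsilon> (Y j) x v)
         - dt / (\<epsilon>\<^sup>2 * \<tau>) * (\<Sum>j\<in>Ji. b j * micro (Y j) x v)))"

definition micro_constraint :: "(real^'d::finite) set \<Rightarrow> 'd fields \<Rightarrow> bool" where
  "micro_constraint D Y \<longleftrightarrow> (\<forall>x\<in>D. \<forall>v. proj_P (micro Y x) v = 0)"

text \<open>One step of the scheme from \<open>Yn\<close> (time \<open>t\<^sup>n\<close>) to \<open>Yn1\<close> (time \<open>t\<^sup>n\<^sup>+\<^sup>1\<close>) with internal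
  stages \<open>Y 1, \<dots>, Y s\<close>.\<close>

definition bgk_imex_step ::
    "(real^'d::finite) set \<Rightarrow> real \<Rightarrow> real \<Rightarrow> nat
      \<Rightarrow> (nat \<Rightarrow> nat \<Rightarrow> real) \<Rightarrow> (nat \<Rightarrow> real) \<Rightarrow> (nat \<Rightarrow> nat \<Rightarrow> real) \<Rightarrow> (nat \<Rightarrow> real)
      \<Rightarrow> real \<Rightarrow> 'd fields \<Rightarrow> (nat \<Rightarrow> 'd fields) \<Rightarrow> 'd fields \<Rightarrow> bool" where
  "bgk_imex_step D \<tau> dt s At wt A w \<epsilon> Yn Y Yn1 \<longleftrightarrow>
     micro_constraint D Yn \<and> (\<forall>i\<in>{1..s}. micro_constraint D (Y i)) \<and>
     (\<forall>i\<in>{1..s}. imex_update D \<tau> dt \<epsilon> {1..<i} (At i) {1..i} (A i) Yn Y (Y i)) \<and>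
     imex_update D \<tau> dt \<epsilon> {1..s} wt {1..s} w Yn Y Yn1"

section \<open>The formal limit \<open>\<epsilon> \<rightarrow> 0\<close>\<close>

text \<open>Pointwise convergence of a field and of its first space derivatives, the limits of the
  derivatives being the derivatives of the limit.\<close>

definition formal_limit ::
    "(real^'d::finite) set \<Rightarrow> (real \<Rightarrow> real^'d \<Rightarrow> 'b::real_normed_vector) \<Rightarrow> (real^'d \<Rightarrow> 'b) \<Rightarrow> bool" where
  "formal_limit D f f0 \<longleftrightarrow>
     (\<forall>\<^sub>F \<epsilon> in at_right 0. \<forall>x\<in>D. f \<epsilon> differentiable (at x)) \<and>
     (\<forall>x\<in>D. f0 differentiable (at x)) \<and>
     (\<forall>x\<in>D. ((\<lambda>\<epsilon>. f \<epsilon> x) \<longlongrightarrow> f0 x) (at_right 0)) \<and>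
     (\<forall>x\<in>D. \<forall>k. ((\<lambda>\<epsilon>. partial_deriv k (f \<epsilon>) x) \<longlongrightarrow> partial_deriv k f0 x) (at_right 0))"

text \<open>The velocity moment with weight \<open>\<phi>\<close> exists and commutes with the limit.\<close>

definition moment_limit ::
    "(real^'d::finite) set \<Rightarrow> (real^'d \<Rightarrow> 'b::{banach, second_countable_topology})
      \<Rightarrow> (real \<Rightarrow> 'd fields) \<Rightarrow> 'd fields \<Rightarrow> bool" where
  "moment_limit D \<phi> Y Y0 \<longleftrightarrow>
     (\<forall>\<^sub>F \<epsilon> in at_right 0. \<forall>x\<in>D.
        integrable lborel (\<lambda>v. maxwellian v *\<^sub>R (micro (Y \<epsilon>) x v *\<^sub>R \<phi> v))) \<and>
     (\<forall>x\<in>D. integrable lborel (\<lambda>v. maxwellian v *\<^sub>R (micro Y0 x v *\<^sub>R \<phi> v))) \<and>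
     formal_limit D (\<lambda>\<epsilon> x. vbracket (\<lambda>v. micro (Y \<epsilon>) x v *\<^sub>R \<phi> v))
                    (\<lambda>x. vbracket (\<lambda>v. micro Y0 x v *\<^sub>R \<phi> v))"

text \<open>\<open>pt\<close> is the limit of the rescaled pressure \<open>p / \<epsilon>\<close>. The moments listed are those occurring
  in the scheme: with \<open>A\<close> and \<open>B\<close>, those in \<open>P g\<close>, and those in \<open>P (v g)\<close>. Second space
  derivatives are needed for the limit velocity only.\<close>

definition fields_limit ::
    "(real^'d::finite) set \<Rightarrow> (real \<Rightarrow> 'd fields) \<Rightarrow> 'd fields \<Rightarrow> (real^'d \<Rightarrow> real) \<Rightarrow> bool" where
  "fields_limit D Y Y0 pt \<longleftrightarrow>
     formal_limit D (\<lambda>\<epsilon>. rho (Y \<epsilon>)) (rho Y0) \<and>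
     formal_limit D (\<lambda>\<epsilon>. vel (Y \<epsilon>)) (vel Y0) \<and> C2_on D (vel Y0) \<and>
     formal_limit D (\<lambda>\<epsilon>. temp (Y \<epsilon>)) (temp Y0) \<and>
     formal_limit D (\<lambda>\<epsilon> x. press (Y \<epsilon>) x / \<epsilon>) pt \<and>
     (\<forall>v. formal_limit D (\<lambda>\<epsilon> x. micro (Y \<epsilon>) x v) (\<lambda>x. micro Y0 x v)) \<and>
     moment_limit D calA Y Y0 \<and>
     moment_limit D calB Y Y0 \<and>
     moment_limit D (\<lambda>v. 1::real) Y Y0 \<and>
     moment_limit D (\<lambda>v. v) Y Y0 \<and>
     moment_limit D (\<lambda>v. ((norm v)\<^sup>2 - dim_of TYPE('d)) / dim_of TYPE('d)) Y Y0 \<and>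
     moment_limit D (\<lambda>v. otimes v v) Y Y0 \<and>
     moment_limit D (\<lambda>v. (((norm v)\<^sup>2 - dim_of TYPE('d)) / dim_of TYPE('d)) *\<^sub>R v) Y Y0"

section \<open>The IMEX discretization of the incompressible Navier--Stokes equations\<close>

definition ns_imex_stages ::
    "(real^'d::finite) set \<Rightarrow> real \<Rightarrow> real \<Rightarrow> nat \<Rightarrow> (nat \<Rightarrow> nat \<Rightarrow> real) \<Rightarrow> (nat \<Rightarrow> nat \<Rightarrow> real)
      \<Rightarrow> (real^'d \<Rightarrow> real^'d) \<Rightarrow> (nat \<Rightarrow> real^'d \<Rightarrow> real^'d) \<Rightarrow> (nat \<Rightarrow> real^'d \<Rightarrow> real) \<Rightarrow> bool" where
  "ns_imex_stages D \<tau> dt s At A un u q \<longleftrightarrow>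
     (\<forall>i\<in>{1..s}. \<forall>x\<in>D.
        q i differentiable (at x) \<and>
        div_x (u i) x = 0 \<and>
        u i x = un x
          + dt *\<^sub>R (\<Sum>j\<in>{1..<i}. At i j *\<^sub>R (\<tau> *\<^sub>R laplacian_x (u j) x - convect_x (u j) (u j) x))
          - dt *\<^sub>R (\<Sum>j\<in>{1..i}. A i j *\<^sub>R grad_x (q j) x))"

end

theory Submission
  imports Defs "HOL-Probability.Probability" "HOL-Real_Asymp.Real_Asymp"
begin

text \<open>Multiply each stage equation by the leading power of \<open>\<epsilon>\<close> and let \<open>\<epsilon>\<close> tend to 0. The density
  equation says that the implicit tableau annihilates the vector of the stage divergences; the first stage
  is the divergence-free initial state, so invertibility of the CK block makes all stages divergence free.
  The equation for \<open>g\<close> expresses the implicit combinations of the \<open>g\<close> as explicit combinations of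
  functions which, because \<open>\<rho> + T = 0\<close> in the limit, are quadratic in \<open>v\<close> up to a multiple of
  \<open>B(v)\<close> and a radial polynomial. Only the quadratic part survives the moment against \<open>A(v)\<close>, and the
  divergence of that moment gives viscosity, convection and the gradient of \<open>|u|\<^sup>2 / d\<close>. This gradient
  carries explicit weights; solving a linear system with the CK block absorbs it into the pressure, which
  carries implicit weights. Stiff accuracy identifies the new value with the last stage.\<close>

section \<open>Gaussian moments\<close>

text \<open>A method of type CK copies the initial state into its first stage, where
  \<open>g\<close> need not be close to its limit relation, and the first column of the implicit
  tableau feeds this \<open>g\<close> into all later stages. Hence the limits of the single stage
  functions \<open>g\<close> are never computed. The limit does fix their combinations with the
  implicit weights, and the momentum equation contains \<open>g\<close> in exactly these
  combinations. The same column is why the initial velocity must be divergence free: the first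
  divergence has to be known before the block can be inverted. The relation \<rho> + T = 0 holds
  because p is \<epsilon> times a convergent quantity. It turns the first-order coefficient of the
  local Maxwellian into v . u + (|v|^2 - (d + 2)) T / 2, whose factor |v|^2 - (d + 2) is that of
  B(v). The gradient of |u|^2 / d has its origin in A(v) being traceless: the moment of the
  quadratic form of G against A(v) is G + G^T - (2/d) (tr G) I, and tr G = - |u|^2 / 2 once u is
  divergence free. The system that absorbs it is A c = - At, where \<open>At\<close> is the explicit
  tableau; it is solvable because both tableaux have a zero first row.\<close>

lemma Basis_vec_real: "(Basis :: (real^'d::finite) set) = range (\<lambda>k. axis k 1)"
  by (auto simp: Basis_vec_def)

lemma prod_Basis_vec: "(\<Prod>b\<in>(Basis::(real^'d::finite) set). f b) = (\<Prod>k\<in>UNIV. f (axis k 1))"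
  unfolding Basis_vec_real by (subst prod.reindex) (auto simp: inj_on_def axis_eq_axis)

lemma sum_Basis_vec_nth:
  "(\<Sum>b\<in>(Basis::(real^'d::finite) set). x b *\<^sub>R b) $ k = x (axis k 1)"
  by (simp flip: vector_cart)

text \<open>\<open>lborel_eq\<close> presents Lebesgue measure as the image of a product measure
  indexed by \<open>Basis\<close>, so Fubini for finite products applies; \<open>axis_index\<close>
  translates between basis vectors and coordinates.\<close>

lemma has_bochner_integral_lborel_vec_prod:
  fixes f :: "'d::finite \<Rightarrow> real \<Rightarrow> real"
  assumes f: "\<And>k. integrable lborel (f k)"
  shows "has_bochner_integral lborel (\<lambda>v::real^'d. \<Prod>k\<in>UNIV. f k (v $ k))
           (\<Prod>k\<in>UNIV. integral\<^sup>L lborel (f k))"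
proof -
  let ?B = "Basis :: (real^'d) set"
  define g where "g b = f (axis_index b)" for b :: "real^'d"
  have g_axis: "g (axis k 1) = f k" for k
    by (simp add: g_def)
  interpret product_sigma_finite "\<lambda>_::real^'d. lborel :: real measure" ..
  have meas [measurable]: "f k \<in> borel_measurable borel" for k
    using borel_measurable_integrable[OF f[of k]] by simp
  have F: "(\<lambda>v::real^'d. \<Prod>k\<in>UNIV. f k (v $ k)) \<in> borel_measurable borel"
    by measurable
  define T where "T = (\<lambda>x :: real^'d \<Rightarrow> real. \<Sum>b\<in>?B. x b *\<^sub>R b)"
  have T: "T \<in> measurable (\<Pi>\<^sub>M b\<in>?B. lborel) borel"
    unfolding T_def by measurable
  have lb: "(lborel :: (real^'d) measure) = distr (\<Pi>\<^sub>M b\<in>?B. lborel) borel T"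
    unfolding T_def by (rule lborel_eq)
  have eq: "(\<Prod>k\<in>UNIV. f k (T x $ k)) = (\<Prod>b\<in>?B. g b (x b))" for x
    unfolding T_def by (simp only: prod_Basis_vec g_axis sum_Basis_vec_nth)
  have int: "integrable (\<Pi>\<^sub>M b\<in>?B. lborel) (\<lambda>x. \<Prod>b\<in>?B. g b (x b))"
    by (rule product_integrable_prod) (auto simp: g_def f)
  have val: "(\<integral>x. (\<Prod>b\<in>?B. g b (x b)) \<partial>(\<Pi>\<^sub>M b\<in>?B. lborel)) = (\<Prod>b\<in>?B. integral\<^sup>L lborel (g b))"
    by (rule product_integral_prod) (auto simp: g_def f)
  have "integrable lborel (\<lambda>v::real^'d. \<Prod>k\<in>UNIV. f k (v $ k))"
    unfolding lb integrable_distr_eq[OF T F] eq by (rule int)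
  moreover have "(\<integral>v. (\<Prod>k\<in>UNIV. f k (v $ k)) \<partial>(lborel :: (real^'d) measure)) = (\<Prod>k\<in>UNIV. integral\<^sup>L lborel (f k))"
    unfolding lb integral_distr[OF T F] eq val by (simp only: prod_Basis_vec g_axis)
  ultimately show ?thesis
    by (simp only: has_bochner_integral_iff)
qed

lemma norm_vec_power2: "(norm (v :: real^'d::finite))\<^sup>2 = (\<Sum>k\<in>UNIV. (v $ k)\<^sup>2)"
  by (simp add: norm_vec_def L2_set_def sum_nonneg)

text \<open>Under this weight the coordinates of \<open>v\<close> are independent standard normal
  variables, which reduces every moment to one-dimensional ones.\<close>

lemma maxwellian_eq_prod:
  "maxwellian (v :: real^'d::finite) = (\<Prod>k\<in>UNIV. std_normal_density (v $ k))"
proof -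
  have "(2 * pi) powr (- real CARD('d) / 2) = (1 / sqrt (2 * pi)) ^ CARD('d)"
  proof -
    have "1 / sqrt (2 * pi) = (2 * pi) powr (- (1 / 2))"
      by (subst powr_minus_divide, subst powr_half_sqrt) auto
    then have "(1 / sqrt (2 * pi)) ^ CARD('d) = ((2 * pi) powr (- (1 / 2))) powr real CARD('d)"
      by (subst powr_realpow) simp_all
    then show ?thesis
      by (simp only: powr_powr) simp
  qed
  moreover have "exp (- (norm v)\<^sup>2 / 2) = (\<Prod>k\<in>UNIV. exp (- (v $ k)\<^sup>2 / 2))"
    by (simp add: norm_vec_power2 sum_negf sum_divide_distrib flip: exp_sum)
  ultimately have "maxwellian v = (\<Prod>k\<in>(UNIV :: 'd set). 1 / sqrt (2 * pi)) * (\<Prod>k\<in>UNIV. exp (- (v $ k)\<^sup>2 / 2))"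
    by (simp only: maxwellian_def prod_constant)
  then show ?thesis
    by (simp only: std_normal_density_def prod.distrib)
qed

lemma maxwellian_measurable [measurable]: "maxwellian \<in> borel_measurable borel"
  unfolding maxwellian_def[abs_def] by measurable

lemma maxwellian_pos: "maxwellian v > 0"
  by (simp add: maxwellian_def)

lemma maxwellian_cong: "norm v = norm w \<Longrightarrow> maxwellian v = maxwellian (w :: real^'d::finite)" for v :: "real^'d"
  by (simp add: maxwellian_def)

text \<open>The moments of the standard normal law: for even \<open>n\<close> the double factorial
  (n-1)!!, in the factorial form of \<open>std_normal_moment_even\<close>.\<close>

definition gauss_moment :: "nat \<Rightarrow> real" where
  "gauss_moment n = (if even n then fact n / (2 ^ (n div 2) * fact (n div 2)) else 0)"

lemma gauss_moment_0 [simp]: "gauss_moment 0 = 1"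
  by (simp add: gauss_moment_def)

lemma has_bochner_integral_gauss_moment:
  "has_bochner_integral lborel (\<lambda>x. std_normal_density x * x ^ n) (gauss_moment n)"
proof (cases "even n")
  case True
  then obtain k where "n = 2 * k" by blast
  then show ?thesis using std_normal_moment_even[of k] by (simp add: gauss_moment_def)
next
  case False
  then obtain k where "n = 2 * k + 1" by (rule oddE)
  then show ?thesis using std_normal_moment_odd[of k] by (simp add: gauss_moment_def)
qed

lemma has_bochner_integral_maxwellian_monomial:
  "has_bochner_integral lborel (\<lambda>v::real^'d::finite. maxwellian v * (\<Prod>k\<in>UNIV. (v $ k) ^ n k))
     (\<Prod>k\<in>UNIV. gauss_moment (n k))"
  using has_bochner_integral_lborel_vec_prod[of "\<lambda>k x. std_normal_density x * x ^ n k"]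
    has_bochner_integral_gauss_moment
  by (simp add: has_bochner_integral_iff maxwellian_eq_prod prod.distrib)

section \<open>Integrability of polynomials against the Maxwellian\<close>

lemma integrable_exp_norm_sq: "integrable lborel (\<lambda>v::real^'d::finite. exp (- (norm v)\<^sup>2 / 4))"
proof -
  have "integrable lborel (\<lambda>x::real. exp (- x\<^sup>2 / 4))"
  proof -
    \<comment> \<open>\<open>exp (- x\<^sup>2 / 4)\<close> is the normal density of variance 2
      without its normalizing factor.\<close>
    have "integrable lborel (\<lambda>x. sqrt (2 * pi * (sqrt 2)\<^sup>2) * normal_density 0 (sqrt 2) x)"
      by (intro integrable_mult_right integrable_normal_density) simp
    then show ?thesis by (simp add: normal_density_def)
  qed
  from has_bochner_integral_lborel_vec_prod[OF this, where ?'d = 'd]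
  show ?thesis
    by (simp add: has_bochner_integral_iff norm_vec_power2 sum_divide_distrib sum_negf flip: exp_sum)
qed

lemma real_polynomial_function_bound:
  assumes "real_polynomial_function p"
  shows "\<exists>C n. C \<ge> 0 \<and> (\<forall>v. \<bar>p v\<bar> \<le> C * (1 + norm v) ^ n)"
  using assms
proof (induction p rule: real_polynomial_function.induct)
  case (linear f)
  then obtain K where K: "\<And>x. norm (f x) \<le> norm x * K" "K \<ge> 0"
    using bounded_linear.nonneg_bounded by blast
  have "\<bar>f v\<bar> \<le> K * (1 + norm v) ^ 1" for v
    using K(1)[of v] K(2) by (simp add: algebra_simps)
  then show ?case using K(2) by blast
next
  case (const c)
  have "\<bar>c\<bar> \<le> \<bar>c\<bar> * (1 + norm v) ^ 0" for v :: 'a by simp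
  then show ?case by (meson abs_ge_zero)
next
  case (add f g)
  then obtain C n C' n' where 1: "C \<ge> 0" "\<And>v. \<bar>f v\<bar> \<le> C * (1 + norm v) ^ n"
    and 2: "C' \<ge> 0" "\<And>v. \<bar>g v\<bar> \<le> C' * (1 + norm v) ^ n'" by blast
  have "\<bar>f v + g v\<bar> \<le> (C + C') * (1 + norm v) ^ (n + n')" for v
  proof -
    have "C * (1 + norm v) ^ n \<le> C * (1 + norm v) ^ (n + n')"
      "C' * (1 + norm v) ^ n' \<le> C' * (1 + norm v) ^ (n + n')"
      by (intro mult_left_mono power_increasing 1 2; simp)+
    then show ?thesis using 1(2)[of v] 2(2)[of v] by (simp add: algebra_simps)
  qed
  then show ?case using 1 2 by (meson add_nonneg_nonneg)
next
  case (mult f g)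
  then obtain C n C' n' where 1: "C \<ge> 0" "\<And>v. \<bar>f v\<bar> \<le> C * (1 + norm v) ^ n"
    and 2: "C' \<ge> 0" "\<And>v. \<bar>g v\<bar> \<le> C' * (1 + norm v) ^ n'" by blast
  have "\<bar>f v * g v\<bar> \<le> (C * C') * (1 + norm v) ^ (n + n')" for v
    using mult_mono[OF 1(2)[of v] 2(2)[of v]] 1 by (simp add: abs_mult power_add mult_ac)
  then show ?case using 1 2 by (meson mult_nonneg_nonneg)
qed

text \<open>Half of the exponent \<open>(norm v)\<^sup>2 / 2\<close> absorbs the polynomial growth;
  the other half remains as an integrable majorant.\<close>

lemma integrable_maxwellian_real_polynomial:
  fixes p :: "real^'d::finite \<Rightarrow> real"
  assumes p: "real_polynomial_function p"
  shows "integrable lborel (\<lambda>v. maxwellian v * p v)"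
proof -
  obtain C n where C: "C \<ge> 0" "\<And>v. \<bar>p v\<bar> \<le> C * (1 + norm v) ^ n"
    using real_polynomial_function_bound[OF p] by blast
  define c where "c = (2 * pi) powr (- real CARD('d) / 2)"
  have c: "c \<ge> 0" by (simp add: c_def)
  define K where "K = c * (C * (fact n * exp 2))"
  have bound: "norm (maxwellian v * p v) \<le> norm (K * exp (- (norm v)\<^sup>2 / 4))" for v :: "real^'d"
  proof -
    \<comment> \<open>A single term of the exponential series is at most the whole series; this is
      the source of \<open>fact n\<close> in \<open>K\<close>.\<close>
    have "(\<Sum>k\<in>{n}. (1 + norm v) ^ k /\<^sub>R fact k) \<le> exp (1 + norm v)"
      unfolding exp_def by (intro sum_le_suminf summable_exp_generic) auto
    then have "(1 + norm v) ^ n / fact n \<le> exp (1 + norm v)"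
      by (simp only: sum.insert sum.empty finite.emptyI empty_iff not_False_eq_True add_0_right
          real_scaleR_def divide_inverse mult.commute)
    then have "(1 + norm v) ^ n \<le> fact n * exp (1 + norm v)"
      by (simp add: divide_le_eq mult_ac)
    also have "\<dots> \<le> fact n * exp (2 + (norm v)\<^sup>2 / 4)"
    proof -
      \<comment> \<open>The square trades the linear exponent for a quarter of the quadratic one.
        Its constant 1 and the 1 of \<open>1 + norm v\<close> make up the \<open>exp 2\<close> in
        \<open>K\<close>.\<close>
      have "0 \<le> (norm v / 2 - 1)\<^sup>2" by simp
      then have "norm v \<le> 1 + (norm v)\<^sup>2 / 4" by (simp add: power2_eq_square algebra_simps)
      then show ?thesis by (intro mult_left_mono) auto
    qed
    finally have "\<bar>p v\<bar> \<le> C * (fact n * exp (2 + (norm v)\<^sup>2 / 4))"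
      using C by (meson mult_left_mono order_trans)
    then have "maxwellian v * \<bar>p v\<bar> \<le> maxwellian v * (C * (fact n * exp (2 + (norm v)\<^sup>2 / 4)))"
      by (intro mult_left_mono) (simp_all add: maxwellian_def)
    also have "\<dots> = K * (exp (- (norm v)\<^sup>2 / 2) * exp ((norm v)\<^sup>2 / 4))"
      by (simp add: maxwellian_def K_def c_def exp_add mult_ac)
    also have "\<dots> = K * exp (- (norm v)\<^sup>2 / 4)"
      by (simp flip: exp_add)
    finally show ?thesis
      using c C maxwellian_pos[of v] by (simp add: abs_mult K_def)
  qed
  have "p \<in> borel_measurable borel"
    by (intro borel_measurable_continuous_onI continuous_on_polymonial_function)
      (use p in \<open>simp add: real_polynomial_function_eq\<close>)
  then have "(\<lambda>v. maxwellian v * p v) \<in> borel_measurable lborel"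
    by measurable
  then show ?thesis
    by (rule Bochner_Integration.integrable_bound[OF integrable_mult_right[OF integrable_exp_norm_sq, of K]])
      (use bound in simp)
qed

lemma integrable_maxwellian_polynomial:
  fixes p :: "real^'d::finite \<Rightarrow> 'b::euclidean_space"
  assumes p: "polynomial_function p"
  shows "integrable lborel (\<lambda>v. maxwellian v *\<^sub>R p v)"
proof -
  have "integrable lborel (\<lambda>v. \<Sum>b\<in>Basis. (maxwellian v * (p v \<bullet> b)) *\<^sub>R b)"
    using p by (intro Bochner_Integration.integrable_sum integrable_scaleR_left
        integrable_maxwellian_real_polynomial) (simp add: polynomial_function_iff_Basis_inner)
  moreover have "(\<Sum>b\<in>Basis. (maxwellian v * (p v \<bullet> b)) *\<^sub>R b) = maxwellian v *\<^sub>R p v" for v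
    by (simp flip: scaleR_scaleR scaleR_sum_right add: euclidean_representation)
  ultimately show ?thesis by simp
qed

section \<open>Moments against the tensor \<open>A(v)\<close>\<close>

lemma lborel_distr_uminus_vec: "distr lborel borel uminus = (lborel :: (real^'d::finite) measure)"
  using lborel_affine[of "-1" "0 :: real^'d"] by (simp add: density_1 flip: one_ennreal_def)

text \<open>A reflection is a diagonal affine map whose Jacobian has absolute value 1.\<close>

lemma lborel_distr_flip:
  "distr lborel borel (\<lambda>v. \<chi> i. if i = k then - v $ i else v $ i) = (lborel :: (real^'d::finite) measure)"
proof -
  define c where "c b = (if b = axis k 1 then -1 else 1 :: real)" for b :: "real^'d"
  have "(\<Sum>b\<in>Basis. (c b * (v \<bullet> b)) *\<^sub>R b) = (\<chi> i. if i = k then - v $ i else v $ i)" for v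
    unfolding Finite_Cartesian_Product.vec_eq_iff sum_Basis_vec_nth by (simp add: c_def inner_axis axis_eq_axis)
  moreover have "(\<Prod>b\<in>Basis. \<bar>c b\<bar>) = 1"
    by (rule prod.neutral) (simp add: c_def)
  moreover have "\<And>b. c b \<noteq> 0"
    by (simp add: c_def)
  ultimately show ?thesis
    using lborel_affine_euclidean[of c 0] by (simp add: density_1 flip: one_ennreal_def)
qed

text \<open>Lebesgue measure is determined by the volumes of boxes, and permuting coordinates only
  reorders the factors of such a volume. For an involution the preimage of a box is found with the
  same map.\<close>

lemma lborel_distr_involution:
  assumes inv: "\<And>i. \<pi> (\<pi> i) = i"
  shows "distr lborel borel (\<lambda>v. \<chi> i. v $ \<pi> i) = (lborel :: (real^'d::finite) measure)"
proof (rule lborel_eqI[symmetric])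
  let ?T = "\<lambda>v :: real^'d. \<chi> i. v $ \<pi> i"
  have T: "?T \<in> borel_measurable borel"
    by (intro borel_measurable_continuous_onI continuous_intros)
  have bij: "bij \<pi>"
    by (rule involuntory_imp_bij) (simp add: inv)
  fix l u :: "real^'d" assume le: "\<And>b. b \<in> Basis \<Longrightarrow> l \<bullet> b \<le> u \<bullet> b"
  have le': "l $ i \<le> u $ i" for i
    using le[of "axis i 1"] by (simp add: inner_axis)
  have "?T -` box l u = box (?T l) (?T u)"
    unfolding set_eq_iff by (simp add: mem_box_cart) (metis inv)
  then have "emeasure (distr lborel borel ?T) (box l u) = emeasure lborel (box (?T l) (?T u))"
    using T by (simp add: emeasure_distr)
  also have "\<dots> = (\<Prod>b\<in>Basis. (?T u - ?T l) \<bullet> b)"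
    by (rule emeasure_lborel_box) (use le' in \<open>auto simp: Basis_vec_real inner_axis\<close>)
  also have "(\<Prod>b\<in>Basis. (?T u - ?T l) \<bullet> b) = (\<Prod>i\<in>UNIV. (u - l) $ \<pi> i)"
    by (simp add: prod_Basis_vec inner_axis)
  also have "\<dots> = (\<Prod>i\<in>UNIV. (u - l) $ i)"
    using prod.reindex_bij_betw[OF bij, of "\<lambda>i. (u - l) $ i"] by simp
  also have "\<dots> = (\<Prod>b\<in>Basis. (u - l) \<bullet> b)"
    by (simp add: prod_Basis_vec inner_axis)
  finally show "emeasure (distr lborel borel ?T) (box l u) = (\<Prod>b\<in>Basis. (u - l) \<bullet> b)" .
qed simp

text \<open>The weight depends on \<open>norm v\<close> only, so a map preserving norm and Lebesgue
  measure preserves brackets. All symmetry arguments below, by reflection, transposition or change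
  of sign, are instances.\<close>

lemma vbracket_isometry:
  fixes f :: "real^'d::finite \<Rightarrow> 'b::{banach, second_countable_topology}" and T :: "real^'d \<Rightarrow> real^'d"
  assumes T: "distr lborel borel T = (lborel :: (real^'d) measure)" "T \<in> borel_measurable borel"
    and norm: "\<And>v. norm (T v) = norm v"
    and f: "f \<in> borel_measurable borel"
  shows "vbracket (\<lambda>v. f (T v)) = vbracket f"
proof -
  have [measurable]: "f \<in> borel_measurable borel" by (rule f)
  have "vbracket f = (LINT v|distr lborel borel T. maxwellian v *\<^sub>R f v)"
    by (simp add: vbracket_def T)
  also have "\<dots> = (LINT v|lborel. maxwellian (T v) *\<^sub>R f (T v))"
    by (rule integral_distr) (use T in simp_all)
  also have "\<dots> = vbracket (\<lambda>v. f (T v))"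
    unfolding vbracket_def by (simp add: maxwellian_cong[OF norm])
  finally show ?thesis ..
qed

lemma vbracket_minus: "vbracket (\<lambda>v. - f v) = - vbracket f"
  by (simp add: vbracket_def)

lemma vbracket_add:
  assumes "integrable lborel (\<lambda>v. maxwellian v *\<^sub>R f v)" "integrable lborel (\<lambda>v. maxwellian v *\<^sub>R g v)"
  shows "vbracket (\<lambda>v. f v + g v) = vbracket f + vbracket g"
  using assms by (simp add: vbracket_def scaleR_right_distrib)

lemma vbracket_bounded_linear:
  assumes "bounded_linear h" "integrable lborel (\<lambda>v. maxwellian v *\<^sub>R f v)"
  shows "vbracket (\<lambda>v. h (f v)) = h (vbracket f)"
  unfolding vbracket_def
  using integral_bounded_linear[OF assms] bounded_linear.linear[OF assms(1)]
  by (simp add: linear_scale)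

lemma vbracket_nth_nth:
  fixes f :: "real^'d::finite \<Rightarrow> real^'n::finite^'m::finite"
  assumes "integrable lborel (\<lambda>v. maxwellian v *\<^sub>R f v)"
  shows "vbracket f $ k $ l = vbracket (\<lambda>v. f v $ k $ l)"
  using vbracket_bounded_linear[OF bounded_linear_compose[OF bounded_linear_vec_nth[of l]
        bounded_linear_vec_nth[of k]] assms] by simp

text \<open>The Bochner integral has the value 0 outside the integrable functions, so the symmetry
  argument covers every measurable odd function.\<close>

lemma vbracket_odd:
  fixes f :: "real^'d::finite \<Rightarrow> 'b::{banach, second_countable_topology}"
  assumes "\<And>v. f (- v) = - f v" "f \<in> borel_measurable borel"
  shows "vbracket f = 0"
proof -
  have "vbracket f = vbracket (\<lambda>v. f (- v))"
    by (rule vbracket_isometry[symmetric]) (simp_all add: assms lborel_distr_uminus_vec)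
  also have "\<dots> = - vbracket f"
    by (simp only: assms vbracket_minus)
  finally have "vbracket f + vbracket f = 0"
    by (simp only: eq_neg_iff_add_eq_0)
  then show ?thesis
    by (simp flip: scaleR_2)
qed

lemma borel_measurable_vec_nth:
  fixes f :: "'a \<Rightarrow> 'b::real_normed_vector^'n::finite"
  shows "f \<in> borel_measurable M \<Longrightarrow> (\<lambda>x. f x $ k) \<in> borel_measurable M"
  by (rule measurable_compose[OF _ borel_measurable_continuous_onI]) (auto intro: continuous_intros)

lemma calA_nth: "calA v $ k $ l = v $ k * v $ l - (if k = l then (norm v)\<^sup>2 / real CARD('d) else 0)"
  for v :: "real^'d::finite"
  by (simp add: calA_def otimes_def Finite_Cartesian_Product.mat_def)

lemma calA_uminus: "calA (- v) = calA v"
  by (simp add: calA_def otimes_def)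

lemma calB_uminus: "calB (- v) = - calB v"
  by (simp add: calB_def)

lemma real_polynomial_function_nth: "real_polynomial_function (\<lambda>v :: real^'d::finite. v $ k)"
  by (rule real_polynomial_function.intros(1)) (rule bounded_linear_vec_nth)

lemma real_polynomial_function_norm_sq:
  "real_polynomial_function (\<lambda>v :: real^'d::finite. (norm v)\<^sup>2)"
  unfolding norm_vec_power2 by (intro real_polynomial_function_sum real_polynomial_function_power real_polynomial_function_nth finite)

lemma polynomial_function_matrixI:
  fixes f :: "'a::real_normed_vector \<Rightarrow> real^'n::finite^'m::finite"
  assumes "\<And>k l. real_polynomial_function (\<lambda>v. f v $ k $ l)"
  shows "polynomial_function f"
  using assms by (clarsimp simp: polynomial_function_iff_Basis_inner Basis_vec_def inner_axis)

lemma polynomial_function_calA: "polynomial_function calA"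
proof (rule polynomial_function_matrixI)
  show "real_polynomial_function (\<lambda>v :: real^'a::finite. calA v $ k $ l)" for k l
  proof -
    have "real_polynomial_function (\<lambda>v :: real^'a. if k = l then (norm v)\<^sup>2 / real CARD('a) else 0)"
      by (cases "k = l") (simp_all add: real_polynomial_function_divide real_polynomial_function_norm_sq
          real_polynomial_function.intros(2))
    then show ?thesis
      unfolding calA_nth
      by (intro real_polynomial_function_diff real_polynomial_function.intros(4) real_polynomial_function_nth)
  qed
qed

lemma polynomial_function_scaleR_calA:
  "real_polynomial_function p \<Longrightarrow> polynomial_function (\<lambda>v :: real^'d::finite. p v *\<^sub>R calA v)"
  by (intro polynomial_function_mult polynomial_function_calA) (simp only: real_polynomial_function_eq)

lemma calA_measurable [measurable]: "calA \<in> borel_measurable borel"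
  by (rule borel_measurable_continuous_onI[OF continuous_on_polymonial_function[OF polynomial_function_calA]])

text \<open>Reflecting one coordinate kills the off-diagonal entries, transposing two coordinates makes the
  diagonal entries equal, and the trace of \<open>A(v)\<close> vanishes.\<close>

lemma vbracket_radial_calA:
  fixes F :: "real \<Rightarrow> real"
  assumes F: "F \<in> borel_measurable borel"
    and int: "integrable lborel (\<lambda>v :: real^'d::finite. maxwellian v *\<^sub>R (F (norm v) *\<^sub>R calA v))"
  shows "vbracket (\<lambda>v :: real^'d. F (norm v) *\<^sub>R calA v) = 0"
proof -
  define f where "f v = F (norm v) *\<^sub>R calA v" for v :: "real^'d"
  define S where "S = vbracket f"
  have [measurable]: "f \<in> borel_measurable borel"
    using F unfolding f_def by measurable
  have int': "integrable lborel (\<lambda>v. maxwellian v *\<^sub>R f v)"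
    using int by (simp add: f_def)
  have nth: "S $ k $ l = vbracket (\<lambda>v. f v $ k $ l)" for k l
    unfolding S_def by (rule vbracket_nth_nth[OF int'])
  have off: "S $ k $ l = 0" if "k \<noteq> l" for k l
  proof -
    let ?T = "\<lambda>v :: real^'d. \<chi> i. if i = k then - v $ i else v $ i"
    have norm: "norm (?T v) = norm v" for v
      by (simp add: norm_vec_def) (rule L2_set_cong, auto)
    have T: "?T \<in> borel_measurable borel"
    proof (intro borel_measurable_continuous_onI continuous_on_vec_lambda)
      show "continuous_on UNIV (\<lambda>v :: real^'d. if i = k then - v $ i else v $ i)" for i
        by (cases "i = k") (auto intro!: continuous_intros)
    qed
    have "S $ k $ l = vbracket (\<lambda>v. f (?T v) $ k $ l)"
      unfolding nth by (rule vbracket_isometry[symmetric, OF lborel_distr_flip T norm])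
        (intro borel_measurable_vec_nth, measurable)
    also have "\<dots> = vbracket (\<lambda>v. - (f v $ k $ l))"
      using that unfolding f_def norm by (simp add: calA_nth norm)
    finally show ?thesis by (simp add: vbracket_minus nth)
  qed
  have diag: "S $ k $ k = S $ l $ l" for k l
  proof -
    define \<pi> where "\<pi> = Transposition.transpose k l"
    let ?T = "\<lambda>v :: real^'d. \<chi> i. v $ \<pi> i"
    have inv: "\<pi> (\<pi> i) = i" and \<pi>_k: "\<pi> k = l" for i by (simp_all add: \<pi>_def)
    have norm: "norm (?T v) = norm v" for v
      using sum.reindex_bij_betw[OF involuntory_imp_bij[OF inv], of "\<lambda>i. (v $ i)\<^sup>2"]
      by (simp add: norm_vec_def L2_set_def)
    have T: "?T \<in> borel_measurable borel"
      by (intro borel_measurable_continuous_onI continuous_intros)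
    have "S $ k $ k = vbracket (\<lambda>v. f (?T v) $ k $ k)"
      unfolding nth by (rule vbracket_isometry[symmetric, OF lborel_distr_involution T norm])
        (rule inv, intro borel_measurable_vec_nth, measurable)
    also have "\<dots> = vbracket (\<lambda>v. f v $ l $ l)"
      unfolding f_def norm by (simp add: calA_nth norm \<pi>_k)
    finally show ?thesis by (simp add: nth)
  qed
  have "(\<Sum>k\<in>UNIV. S $ k $ k) = 0"
  proof -
    have "(\<Sum>k\<in>UNIV. f v $ k $ k) = 0" for v
      by (simp add: f_def calA_nth sum_subtractf norm_vec_power2 flip: sum_distrib_left power2_eq_square)
    moreover have "(\<Sum>k\<in>UNIV. S $ k $ k) = vbracket (\<lambda>v. \<Sum>k\<in>UNIV. f v $ k $ k)"
      unfolding S_def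
      by (rule vbracket_bounded_linear[OF _ int', symmetric])
        (intro bounded_linear_sum bounded_linear_compose[OF bounded_linear_vec_nth bounded_linear_vec_nth])
    ultimately show ?thesis by (simp add: vbracket_def)
  qed
  then have "S $ k $ k = 0" for k
  proof -
    have "(\<Sum>i\<in>UNIV. S $ i $ i) = (\<Sum>i\<in>(UNIV :: 'd set). S $ k $ k)"
      by (intro sum.cong refl diag)
    with \<open>(\<Sum>k\<in>UNIV. S $ k $ k) = 0\<close> show ?thesis by simp
  qed
  then have "S = 0"
    using off by (auto simp: Finite_Cartesian_Product.vec_eq_iff) metis
  moreover have "f = (\<lambda>v. F (norm v) *\<^sub>R calA v)"
    by (simp add: f_def fun_eq_iff)
  ultimately show ?thesis by (simp add: S_def)
qed

text \<open>Isserlis' formula: the moment counts the pairings of the four indices in which partners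
  coincide. \<open>e\<close> records multiplicities; one index of multiplicity 4 admits all three
  pairings, two of multiplicity 2 admit one.\<close>

lemma fourth_moment_value: fixes k l m n :: "'d::finite" and e :: "'d \<Rightarrow> nat"
  assumes e: "\<And>i. e i = of_bool (i = k) + of_bool (i = l) + of_bool (i = m) + (of_bool (i = n) :: nat)"
  shows "(\<Prod>i\<in>{k, l, m, n}. gauss_moment (e i)) = of_bool (k = l \<and> m = n) + of_bool (k = m \<and> l = n) + of_bool (k = n \<and> l = m)"
proof -
  have gm: "gauss_moment (Suc 0) = 0" "gauss_moment (Suc (Suc 0)) = 1" "gauss_moment (Suc (Suc (Suc 0))) = 0"
    "gauss_moment (Suc (Suc (Suc (Suc 0)))) = 3"
    by (simp_all add: gauss_moment_def fact_numeral)
  \<comment> \<open>A pattern without a full pairing leaves an index of multiplicity 1 or 3, whose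
    Gaussian moment vanishes.\<close>
  consider "k = l" "m = n" "k = m" | "k = l" "m = n" "k \<noteq> m" | "k = l" "m \<noteq> n" | "k \<noteq> l" "k = m" "l = n"
   | "k \<noteq> l" "k = n" "l = m" | "k \<noteq> l" "k = m" "l \<noteq> n" | "k \<noteq> l" "k = n" "l \<noteq> m" | "k \<noteq> l" "k \<noteq> m" "k \<noteq> n"
    by blast
  then show ?thesis
    by cases (auto simp: prod.insert_if e gm numeral_2_eq_2)
qed
lemma has_bochner_integral_fourth_moment:
  fixes k l m n :: "'d::finite"
  shows "has_bochner_integral lborel (\<lambda>v :: real^'d. maxwellian v * (v $ k * v $ l * v $ m * v $ n))
    (of_bool (k = l \<and> m = n) + of_bool (k = m \<and> l = n) + of_bool (k = n \<and> l = m))"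
proof -
  define e where "e i = of_bool (i = k) + of_bool (i = l) + of_bool (i = m) + (of_bool (i = n) :: nat)" for i
  have one: "(\<Prod>i\<in>UNIV. (v $ i) ^ of_bool (i = j)) = v $ j" for v :: "real^'d" and j
    by (subst prod.remove[of _ j]) auto
  have eq: "(\<Prod>i\<in>UNIV. (v $ i) ^ e i) = v $ k * v $ l * v $ m * v $ n" for v :: "real^'d"
    by (simp add: e_def power_add prod.distrib one)
  \<comment> \<open>Indices outside the list have exponent 0, and
    \<open>gauss_moment 0 = 1\<close>.\<close>
  have "(\<Prod>i\<in>UNIV. gauss_moment (e i)) = (\<Prod>i\<in>{k, l, m, n}. gauss_moment (e i))"
    by (rule prod.mono_neutral_right) (auto simp: e_def)
  also have "\<dots> = of_bool (k = l \<and> m = n) + of_bool (k = m \<and> l = n) + of_bool (k = n \<and> l = m)"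
    by (rule fourth_moment_value) (simp add: e_def)
  finally show ?thesis
    using has_bochner_integral_maxwellian_monomial[of e] unfolding eq by simp
qed

lemma has_bochner_integral_quadratic_calA:
  fixes k l m n :: "'d::finite"
  shows "has_bochner_integral lborel (\<lambda>v :: real^'d. maxwellian v * (v $ m * v $ n * calA v $ k $ l))
    (of_bool (k = m \<and> l = n) + of_bool (k = n \<and> l = m) - of_bool (k = l \<and> m = n) * (2 / real CARD('d)))"
proof -
  let ?d = "real CARD('d)"
  have H: "has_bochner_integral lborel
     (\<lambda>v :: real^'d. maxwellian v * (v $ k * v $ l * v $ m * v $ n)
        - (of_bool (k = l) / ?d) * (\<Sum>j\<in>UNIV. maxwellian v * (v $ j * v $ j * v $ m * v $ n)))
     ((of_bool (k = l \<and> m = n) + of_bool (k = m \<and> l = n) + of_bool (k = n \<and> l = m))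
       - (of_bool (k = l) / ?d) * (\<Sum>j\<in>UNIV. of_bool (j = j \<and> m = n) + of_bool (j = m \<and> j = n) + of_bool (j = n \<and> j = m)))"
    by (intro has_bochner_integral_diff has_bochner_integral_mult_right has_bochner_integral_sum
        has_bochner_integral_fourth_moment)
  \<comment> \<open>The first pairing does not involve \<open>j\<close> and contributes
    \<open>?d\<close>; each of the other two determines \<open>j\<close> and contributes 1. From
    \<open>1 - (?d + 2) / ?d\<close> comes the coefficient \<open>- 2 / ?d\<close>.\<close>
  have S: "(\<Sum>j\<in>UNIV. of_bool (j = j \<and> m = n) + of_bool (j = m \<and> j = n) + of_bool (j = n \<and> j = m))
      = of_bool (m = n) * (?d + 2)"
    by (cases "m = n") (simp_all add: sum.distrib of_bool_def flip: sum_distrib_left cong: conj_cong)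
  have E: "maxwellian v * (v $ k * v $ l * v $ m * v $ n)
        - (of_bool (k = l) / ?d) * (\<Sum>j\<in>UNIV. maxwellian v * (v $ j * v $ j * v $ m * v $ n))
      = maxwellian v * (v $ m * v $ n * calA v $ k $ l)" for v :: "real^'d"
  proof -
    have "(\<Sum>j\<in>UNIV. maxwellian v * (v $ j * v $ j * v $ m * v $ n))
        = maxwellian v * (norm v)\<^sup>2 * (v $ m * v $ n)"
      unfolding norm_vec_power2 sum_distrib_left sum_distrib_right
      by (simp add: power2_eq_square mult_ac)
    then show ?thesis
      by (cases "k = l") (simp_all add: calA_nth algebra_simps)
  qed
  have V: "(of_bool (k = l \<and> m = n) + of_bool (k = m \<and> l = n) + of_bool (k = n \<and> l = m))
       - (of_bool (k = l) / ?d) * (of_bool (m = n) * (?d + 2))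
     = of_bool (k = m \<and> l = n) + of_bool (k = n \<and> l = m) - of_bool (k = l \<and> m = n) * (2 / ?d)"
    by (simp add: field_simps of_bool_def)
  show ?thesis using H by (simp only: S E V)
qed

lemma inner_matrix_vector:
  "v \<bullet> (G *v v) = (\<Sum>m\<in>UNIV. \<Sum>n\<in>UNIV. G $ m $ n * (v $ m * v $ n))" for v :: "real^'d::finite"
  by (simp add: inner_vec_def matrix_vector_mult_def sum_distrib_left mult_ac)

text \<open>A moment against \<open>calA\<close> retains twice the symmetric traceless part of
  \<open>G\<close>. For a velocity gradient the symmetrization yields the viscous stress.\<close>

lemma vbracket_quadratic_calA:
  fixes G :: "real^'d::finite^'d"
  shows "vbracket (\<lambda>v. (v \<bullet> (G *v v)) *\<^sub>R calA v)
    = G + Finite_Cartesian_Product.transpose G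
      - (2 / real CARD('d) * (\<Sum>i\<in>UNIV. G $ i $ i)) *\<^sub>R Finite_Cartesian_Product.mat 1"
proof -
  have poly: "real_polynomial_function (\<lambda>v. v \<bullet> (G *v v))"
    unfolding inner_matrix_vector by (intro real_polynomial_function_sum real_polynomial_function.intros(2,4) real_polynomial_function_nth finite)
  have int: "integrable lborel (\<lambda>v. maxwellian v *\<^sub>R ((v \<bullet> (G *v v)) *\<^sub>R calA v))"
    by (intro integrable_maxwellian_polynomial polynomial_function_scaleR_calA poly)
  show ?thesis
    unfolding Finite_Cartesian_Product.vec_eq_iff
  proof (intro allI)
    fix k l
    have H: "has_bochner_integral lborel
       (\<lambda>v. \<Sum>m\<in>UNIV. \<Sum>n\<in>UNIV. G $ m $ n * (maxwellian v * (v $ m * v $ n * calA v $ k $ l)))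
       (\<Sum>m\<in>UNIV. \<Sum>n\<in>UNIV. G $ m $ n *
          (of_bool (k = m \<and> l = n) + of_bool (k = n \<and> l = m) - of_bool (k = l \<and> m = n) * (2 / real CARD('d))))"
      by (intro has_bochner_integral_sum has_bochner_integral_mult_right has_bochner_integral_quadratic_calA)
    have E: "(\<Sum>m\<in>UNIV. \<Sum>n\<in>UNIV. G $ m $ n * (maxwellian v * (v $ m * v $ n * calA v $ k $ l)))
        = maxwellian v * ((v \<bullet> (G *v v)) *\<^sub>R calA v) $ k $ l" for v
      by (simp add: inner_matrix_vector sum_distrib_left sum_distrib_right mult_ac)
    have V: "(\<Sum>m\<in>UNIV. \<Sum>n\<in>UNIV. G $ m $ n *
          (of_bool (k = m \<and> l = n) + of_bool (k = n \<and> l = m) - of_bool (k = l \<and> m = n) * (2 / real CARD('d))))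
        = G $ k $ l + G $ l $ k - of_bool (k = l) * (2 / real CARD('d) * (\<Sum>i\<in>UNIV. G $ i $ i))"
    proof -
      have 1: "(\<Sum>m\<in>UNIV. \<Sum>n\<in>UNIV. G $ m $ n * of_bool (k = m \<and> l = n)) = G $ k $ l" for k l
        by (simp add: of_bool_conj sum_distrib_left[symmetric] mult.left_commute[of "G $ _ $ _"])
      have 2: "(\<Sum>m\<in>UNIV. \<Sum>n\<in>UNIV. G $ m $ n * (of_bool (k = l \<and> m = n) * (2 / real CARD('d))))
          = of_bool (k = l) * (2 / real CARD('d) * (\<Sum>i\<in>UNIV. G $ i $ i))"
      proof -
        have "G $ m $ n * (of_bool (k = l \<and> m = n) * (2 / real CARD('d)))
            = (if m = n then of_bool (k = l) * (2 / real CARD('d)) * G $ m $ n else 0)" for m n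
          by simp
        then show ?thesis
          by (simp add: sum_distrib_left mult.assoc)
      qed
      have 3: "(\<Sum>m\<in>UNIV. \<Sum>n\<in>UNIV. G $ m $ n * of_bool (k = n \<and> l = m)) = G $ l $ k"
        using 1[of l k] by (simp only: conj_commute)
      show ?thesis
        by (simp only: 3 distrib_left right_diff_distrib sum.distrib sum_subtractf 1 2)
    qed
    have "has_bochner_integral lborel (\<lambda>v. maxwellian v * ((v \<bullet> (G *v v)) *\<^sub>R calA v) $ k $ l)
        (G $ k $ l + G $ l $ k - of_bool (k = l) * (2 / real CARD('d) * (\<Sum>i\<in>UNIV. G $ i $ i)))"
      using H by (simp only: E V)
    then show "vbracket (\<lambda>v. (v \<bullet> (G *v v)) *\<^sub>R calA v) $ k $ l
      = (G + Finite_Cartesian_Product.transpose G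
        - (2 / real CARD('d) * (\<Sum>i\<in>UNIV. G $ i $ i)) *\<^sub>R Finite_Cartesian_Product.mat 1) $ k $ l"
      unfolding vbracket_nth_nth[OF int]
      by (simp add: vbracket_def has_bochner_integral_iff Finite_Cartesian_Product.transpose_def
          Finite_Cartesian_Product.mat_def)
  qed
qed

lemma real_polynomial_function_inner_calB: "real_polynomial_function (\<lambda>v :: real^'d::finite. b \<bullet> calB v)"
proof -
  have eq: "b \<bullet> calB v = ((norm v)\<^sup>2 - (real CARD('d) + 2)) * (b \<bullet> v)" for v
    by (simp add: calB_def)
  show ?thesis
    unfolding eq
    by (intro real_polynomial_function.intros(4) real_polynomial_function_diff
        real_polynomial_function_norm_sq real_polynomial_function.intros(2)
        real_polynomial_function.intros(1) bounded_linear_inner_right)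
qed

text \<open>The three summands have the shape of \<open>\<tau> * micro_rhs_limit\<close>. The middle
  one vanishes by parity, \<open>calB\<close> being odd and \<open>calA\<close> even; the last one
  is radial.\<close>

lemma vbracket_calA_split:
  fixes G :: "real^'d::finite^'d"
  shows "vbracket (\<lambda>v. (v \<bullet> (G *v v) + b \<bullet> calB v + (r0 + r1 * (norm v)\<^sup>2 + r2 * ((norm v)\<^sup>2)\<^sup>2)) *\<^sub>R calA v)
    = G + Finite_Cartesian_Product.transpose G
      - (2 / real CARD('d) * (\<Sum>i\<in>UNIV. G $ i $ i)) *\<^sub>R Finite_Cartesian_Product.mat 1"
proof -
  have polyG: "real_polynomial_function (\<lambda>v. v \<bullet> (G *v v))"
    unfolding inner_matrix_vector
    by (intro real_polynomial_function_sum real_polynomial_function.intros(2,4) real_polynomial_function_nth finite)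
  have polyB: "real_polynomial_function (\<lambda>v. b \<bullet> calB v)"
    by (rule real_polynomial_function_inner_calB)
  have polyR: "real_polynomial_function (\<lambda>v :: real^'d. r0 + r1 * (norm v)\<^sup>2 + r2 * ((norm v)\<^sup>2)\<^sup>2)"
    by (intro real_polynomial_function.intros(2-4) real_polynomial_function_norm_sq real_polynomial_function_power)
  have int: "integrable lborel (\<lambda>v. maxwellian v *\<^sub>R (p v *\<^sub>R calA v))"
    if "real_polynomial_function p" for p :: "real^'d \<Rightarrow> real"
    by (intro integrable_maxwellian_polynomial polynomial_function_scaleR_calA that)
  have "vbracket (\<lambda>v. (b \<bullet> calB v) *\<^sub>R calA v) = 0"
    by (rule vbracket_odd)
      (simp_all add: calA_uminus calB_uminus borel_measurable_continuous_onI continuous_on_polymonial_function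
        polynomial_function_scaleR_calA polyB)
  moreover have "vbracket (\<lambda>v :: real^'d. (r0 + r1 * (norm v)\<^sup>2 + r2 * ((norm v)\<^sup>2)\<^sup>2) *\<^sub>R calA v) = 0"
    by (rule vbracket_radial_calA[of "\<lambda>t. r0 + r1 * t\<^sup>2 + r2 * (t\<^sup>2)\<^sup>2"]) (measurable, rule int, rule polyR)
  moreover have split: "vbracket (\<lambda>v. (p v + q v) *\<^sub>R calA v) = vbracket (\<lambda>v. p v *\<^sub>R calA v) + vbracket (\<lambda>v. q v *\<^sub>R calA v)"
    if "real_polynomial_function p" "real_polynomial_function q" for p q :: "real^'d \<Rightarrow> real"
    unfolding scaleR_left_distrib by (rule vbracket_add; rule int; fact)
  ultimately show ?thesis
    by (simp only: split[OF real_polynomial_function.intros(3)[OF polyG polyB] polyR] split[OF polyG polyB]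
        vbracket_quadratic_calA add_0_right)
qed

section \<open>Derivatives and formal limits in \<open>x\<close>\<close>

lemma partial_deriv_eqI: "(f has_derivative f') (at x) \<Longrightarrow> partial_deriv k f x = f' (axis k 1)"
  unfolding partial_deriv_def by (simp flip: frechet_derivative_at)

lemma has_derivative_cong_open:
  assumes "open D" "x \<in> D" "\<And>y. y \<in> D \<Longrightarrow> f y = g y"
  shows "(f has_derivative f') (at x) \<longleftrightarrow> (g has_derivative f') (at x)"
  by (auto intro: has_derivative_transform_within_open[OF _ assms(1,2)] simp: assms(3))

lemma differentiable_cong_open:
  assumes "open D" "x \<in> D" "\<And>y. y \<in> D \<Longrightarrow> f y = g y"
  shows "f differentiable (at x) \<longleftrightarrow> g differentiable (at x)"
  unfolding differentiable_def using has_derivative_cong_open[OF assms] by simp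

text \<open>\<open>frechet_derivative\<close> is a choice among the derivatives at \<open>x\<close>.
  Functions that agree near \<open>x\<close> have the same derivatives there, hence the same chosen
  value, even where neither is differentiable.\<close>

lemma partial_deriv_cong_open:
  assumes "open D" "x \<in> D" "\<And>y. y \<in> D \<Longrightarrow> f y = g y"
  shows "partial_deriv k f x = partial_deriv k g x"
  unfolding partial_deriv_def frechet_derivative_def using has_derivative_cong_open[OF assms] by simp

lemma partial_deriv_add:
  assumes "f differentiable (at x)" "g differentiable (at x)"
  shows "partial_deriv k (\<lambda>y. f y + g y) x = partial_deriv k f x + partial_deriv k g x"
  unfolding partial_deriv_def[of k f] partial_deriv_def[of k g]
  by (rule partial_deriv_eqI) (intro has_derivative_add iffD1[OF frechet_derivative_works] assms)

lemma partial_deriv_const: "partial_deriv k (\<lambda>y. c) x = 0"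
  by (rule partial_deriv_eqI) (rule has_derivative_const)

lemma partial_deriv_bounded_linear:
  assumes "bounded_linear h" "f differentiable (at x)"
  shows "partial_deriv k (\<lambda>y. h (f y)) x = h (partial_deriv k f x)"
  unfolding partial_deriv_def[of k f]
  by (rule partial_deriv_eqI)
    (rule bounded_linear.has_derivative[OF assms(1) iffD1[OF frechet_derivative_works assms(2)]])

lemma differentiable_bounded_linear:
  assumes "bounded_linear h" "f differentiable (at x)"
  shows "(\<lambda>y. h (f y)) differentiable (at x)"
  using assms bounded_linear.has_derivative unfolding differentiable_def by blast

lemma partial_deriv_scaleR_right:
  "f differentiable (at x) \<Longrightarrow> partial_deriv k (\<lambda>y. c *\<^sub>R f y) x = c *\<^sub>R partial_deriv k f x"
  by (rule partial_deriv_bounded_linear) (rule bounded_linear_scaleR_right)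

lemma partial_deriv_nth:
  "f differentiable (at x) \<Longrightarrow> partial_deriv k (\<lambda>y. f y $ i) x = partial_deriv k f x $ i"
  by (rule partial_deriv_bounded_linear) (rule bounded_linear_vec_nth)

lemma differentiable_nth: "f differentiable (at x) \<Longrightarrow> (\<lambda>y. f y $ i) differentiable (at x)"
  by (rule differentiable_bounded_linear) (rule bounded_linear_vec_nth)

lemma partial_deriv_sum:
  assumes "\<And>j. j \<in> J \<Longrightarrow> f j differentiable (at x)"
  shows "partial_deriv k (\<lambda>y. \<Sum>j\<in>J. f j y) x = (\<Sum>j\<in>J. partial_deriv k (f j) x)"
  using assms
proof (induction J rule: infinite_finite_induct)
  case (insert j J)
  then show ?case
    by (simp add: partial_deriv_add differentiable_sum)
qed (simp_all add: partial_deriv_const)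

lemma partial_deriv_mult:
  fixes f g :: "real^'d::finite \<Rightarrow> real"
  assumes "f differentiable (at x)" "g differentiable (at x)"
  shows "partial_deriv k (\<lambda>y. f y * g y) x = f x * partial_deriv k g x + partial_deriv k f x * g x"
  unfolding partial_deriv_def[of k f] partial_deriv_def[of k g]
  by (rule partial_deriv_eqI) (intro has_derivative_mult iffD1[OF frechet_derivative_works] assms)

lemma differentiable_vec_lambda:
  fixes f :: "'n::finite \<Rightarrow> 'a::real_normed_vector \<Rightarrow> 'b::real_normed_vector"
  assumes "\<And>i. f i differentiable (at x)"
  shows "(\<lambda>y. \<chi> i. f i y) differentiable (at x)"
proof -
  obtain f' where f': "\<And>i. (f i has_derivative f' i) (at x)"
    using assms unfolding differentiable_def by metis
  \<comment> \<open>A vector is the sum of its components carried along the axes; with each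
    embedding \<open>axis i\<close> bounded linear, the rules for sums and linear maps
    apply.\<close>
  have "bounded_linear (axis i :: 'b \<Rightarrow> 'b^'n)" for i
  proof (rule bounded_linear_intro[of _ 1])
    fix x :: 'b
    have "(\<Sum>j\<in>UNIV. (norm (axis i x $ j))\<^sup>2) = (\<Sum>j\<in>UNIV. if j = i then (norm x)\<^sup>2 else 0)"
      by (rule sum.cong) (auto simp: axis_def)
    then show "norm (axis i x :: 'b^'n) \<le> norm x * 1"
      by (simp add: norm_vec_def L2_set_def)
  qed (auto simp: axis_def Finite_Cartesian_Product.vec_eq_iff)
  then have "((\<lambda>y. \<Sum>i\<in>UNIV. axis i (f i y)) has_derivative (\<lambda>h. \<Sum>i\<in>UNIV. axis i (f' i h))) (at x)"
    by (intro has_derivative_sum bounded_linear.has_derivative[OF _ f'])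
  moreover have "(\<Sum>i\<in>UNIV. axis i (f i y)) = (\<chi> i. f i y)" for y
    by (simp add: Finite_Cartesian_Product.vec_eq_iff axis_def)
  ultimately show ?thesis
    unfolding differentiable_def by auto
qed

section \<open>Calculus of formal limits\<close>

lemma formal_limitD:
  assumes "formal_limit D f f0"
  shows "\<forall>\<^sub>F \<epsilon> in at_right 0. \<forall>x\<in>D. f \<epsilon> differentiable (at x)"
    and "x \<in> D \<Longrightarrow> f0 differentiable (at x)"
    and "x \<in> D \<Longrightarrow> ((\<lambda>\<epsilon>. f \<epsilon> x) \<longlongrightarrow> f0 x) (at_right 0)"
    and "x \<in> D \<Longrightarrow> ((\<lambda>\<epsilon>. partial_deriv k (f \<epsilon>) x) \<longlongrightarrow> partial_deriv k f0 x) (at_right 0)"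
  using assms by (auto simp: formal_limit_def)

text \<open>On an open set equality of functions is equality near each point and therefore passes to
  the derivatives. A single threshold for \<epsilon> serves all points of \<open>D\<close>, as in
  the differentiability clause of \<open>formal_limit\<close>.\<close>

lemma formal_limit_cong:
  assumes "open D" and f: "formal_limit D f f0"
    and fg: "\<forall>\<^sub>F \<epsilon> in at_right 0. \<forall>x\<in>D. f \<epsilon> x = g \<epsilon> x" and fg0: "\<And>x. x \<in> D \<Longrightarrow> f0 x = g0 x"
  shows "formal_limit D g g0"
  unfolding formal_limit_def
proof (intro conjI ballI allI)
  show "\<forall>\<^sub>F \<epsilon> in at_right 0. \<forall>x\<in>D. g \<epsilon> differentiable (at x)"
    using formal_limitD(1)[OF f] fg by eventually_elim (use \<open>open D\<close> differentiable_cong_open in blast)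
  fix x assume x: "x \<in> D"
  show "g0 differentiable (at x)"
    using differentiable_cong_open[OF \<open>open D\<close> x fg0] formal_limitD(2)[OF f x] by simp
  have "\<forall>\<^sub>F \<epsilon> in at_right 0. f \<epsilon> x = g \<epsilon> x"
    using fg by eventually_elim (use x in blast)
  then show "((\<lambda>\<epsilon>. g \<epsilon> x) \<longlongrightarrow> g0 x) (at_right 0)"
    using Lim_transform_eventually[OF formal_limitD(3)[OF f x]] fg0[OF x] by simp
  fix k
  have "\<forall>\<^sub>F \<epsilon> in at_right 0. partial_deriv k (f \<epsilon>) x = partial_deriv k (g \<epsilon>) x"
    using fg by eventually_elim (rule partial_deriv_cong_open[OF \<open>open D\<close> x], blast)
  then show "((\<lambda>\<epsilon>. partial_deriv k (g \<epsilon>) x) \<longlongrightarrow> partial_deriv k g0 x) (at_right 0)"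
    using Lim_transform_eventually[OF formal_limitD(4)[OF f x, where k = k]]
      partial_deriv_cong_open[OF \<open>open D\<close> x fg0, where k = k] by simp
qed

lemma formal_limit_add:
  assumes f: "formal_limit D f f0" and g: "formal_limit D g g0"
  shows "formal_limit D (\<lambda>\<epsilon> x. f \<epsilon> x + g \<epsilon> x) (\<lambda>x. f0 x + g0 x)"
  unfolding formal_limit_def
proof (intro conjI ballI allI)
  show "\<forall>\<^sub>F \<epsilon> in at_right 0. \<forall>x\<in>D. (\<lambda>x. f \<epsilon> x + g \<epsilon> x) differentiable (at x)"
    using formal_limitD(1)[OF f] formal_limitD(1)[OF g] by eventually_elim (blast intro: differentiable_add)
  fix x assume x: "x \<in> D"
  show "(\<lambda>x. f0 x + g0 x) differentiable (at x)"
    using formal_limitD(2)[OF f x] formal_limitD(2)[OF g x] by (rule differentiable_add)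
  show "((\<lambda>\<epsilon>. f \<epsilon> x + g \<epsilon> x) \<longlongrightarrow> f0 x + g0 x) (at_right 0)"
    by (intro tendsto_add formal_limitD(3)[OF f x] formal_limitD(3)[OF g x])
  fix k
  have "((\<lambda>\<epsilon>. partial_deriv k (f \<epsilon>) x + partial_deriv k (g \<epsilon>) x) \<longlongrightarrow>
      partial_deriv k f0 x + partial_deriv k g0 x) (at_right 0)"
    by (intro tendsto_add formal_limitD(4)[OF f x] formal_limitD(4)[OF g x])
  moreover have "\<forall>\<^sub>F \<epsilon> in at_right 0. partial_deriv k (f \<epsilon>) x + partial_deriv k (g \<epsilon>) x
      = partial_deriv k (\<lambda>x. f \<epsilon> x + g \<epsilon> x) x"
    using formal_limitD(1)[OF f] formal_limitD(1)[OF g]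
    by eventually_elim (simp add: partial_deriv_add x)
  ultimately show "((\<lambda>\<epsilon>. partial_deriv k (\<lambda>x. f \<epsilon> x + g \<epsilon> x) x) \<longlongrightarrow>
      partial_deriv k (\<lambda>x. f0 x + g0 x) x) (at_right 0)"
    unfolding partial_deriv_add[OF formal_limitD(2)[OF f x] formal_limitD(2)[OF g x]]
    by (rule Lim_transform_eventually)
qed

lemma formal_limit_bounded_linear:
  assumes h: "bounded_linear h" and f: "formal_limit D f f0"
  shows "formal_limit D (\<lambda>\<epsilon> x. h (f \<epsilon> x)) (\<lambda>x. h (f0 x))"
  unfolding formal_limit_def
proof (intro conjI ballI allI)
  show "\<forall>\<^sub>F \<epsilon> in at_right 0. \<forall>x\<in>D. (\<lambda>x. h (f \<epsilon> x)) differentiable (at x)"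
    using formal_limitD(1)[OF f] by eventually_elim (blast intro: differentiable_bounded_linear[OF h])
  fix x assume x: "x \<in> D"
  show "(\<lambda>x. h (f0 x)) differentiable (at x)"
    using formal_limitD(2)[OF f x] by (rule differentiable_bounded_linear[OF h])
  show "((\<lambda>\<epsilon>. h (f \<epsilon> x)) \<longlongrightarrow> h (f0 x)) (at_right 0)"
    by (intro bounded_linear.tendsto[OF h] formal_limitD(3)[OF f x])
  fix k
  have "((\<lambda>\<epsilon>. h (partial_deriv k (f \<epsilon>) x)) \<longlongrightarrow> h (partial_deriv k f0 x)) (at_right 0)"
    by (intro bounded_linear.tendsto[OF h] formal_limitD(4)[OF f x])
  moreover have "\<forall>\<^sub>F \<epsilon> in at_right 0. h (partial_deriv k (f \<epsilon>) x) = partial_deriv k (\<lambda>x. h (f \<epsilon> x)) x"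
    using formal_limitD(1)[OF f] by eventually_elim (simp add: partial_deriv_bounded_linear[OF h] x)
  ultimately show "((\<lambda>\<epsilon>. partial_deriv k (\<lambda>x. h (f \<epsilon> x)) x) \<longlongrightarrow> partial_deriv k (\<lambda>x. h (f0 x)) x) (at_right 0)"
    unfolding partial_deriv_bounded_linear[OF h formal_limitD(2)[OF f x]]
    by (rule Lim_transform_eventually)
qed

text \<open>This disposes of the term \<open>\<epsilon> (I - P)(v g)\<close> together with its
  divergence.\<close>

lemma formal_limit_eps_scaleR:
  assumes f: "formal_limit D f f0"
  shows "formal_limit D (\<lambda>\<epsilon> x. \<epsilon> *\<^sub>R f \<epsilon> x) (\<lambda>x. 0)"
  unfolding formal_limit_def
proof (intro conjI ballI allI)
  show "\<forall>\<^sub>F \<epsilon> in at_right 0. \<forall>x\<in>D. (\<lambda>x. \<epsilon> *\<^sub>R f \<epsilon> x) differentiable (at x)"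
    using formal_limitD(1)[OF f]
    by eventually_elim (blast intro: differentiable_bounded_linear bounded_linear_scaleR_right)
  have eps: "((\<lambda>\<epsilon>. \<epsilon>) \<longlongrightarrow> (0 :: real)) (at_right 0)"
    by (rule tendsto_ident_at)
  fix x assume x: "x \<in> D"
  show "(\<lambda>x. 0) differentiable (at x)" by simp
  show "((\<lambda>\<epsilon>. \<epsilon> *\<^sub>R f \<epsilon> x) \<longlongrightarrow> 0) (at_right 0)"
    using tendsto_scaleR[OF eps formal_limitD(3)[OF f x]] by simp
  fix k
  have "((\<lambda>\<epsilon>. \<epsilon> *\<^sub>R partial_deriv k (f \<epsilon>) x) \<longlongrightarrow> 0) (at_right 0)"
    using tendsto_scaleR[OF eps formal_limitD(4)[OF f x]] by simp
  moreover have "\<forall>\<^sub>F \<epsilon> in at_right 0. \<epsilon> *\<^sub>R partial_deriv k (f \<epsilon>) x = partial_deriv k (\<lambda>x. \<epsilon> *\<^sub>R f \<epsilon> x) x"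
    using formal_limitD(1)[OF f] by eventually_elim (simp add: partial_deriv_scaleR_right x)
  ultimately show "((\<lambda>\<epsilon>. partial_deriv k (\<lambda>x. \<epsilon> *\<^sub>R f \<epsilon> x) x) \<longlongrightarrow> partial_deriv k (\<lambda>x. 0 :: 'b) x) (at_right 0)"
    unfolding partial_deriv_const by (rule Lim_transform_eventually)
qed

lemma formal_limit_vec_lambda:
  fixes f :: "'n::finite \<Rightarrow> real \<Rightarrow> real^'d::finite \<Rightarrow> 'b::real_normed_vector"
  assumes f: "\<And>i. formal_limit D (f i) (f0 i)"
  shows "formal_limit D (\<lambda>\<epsilon> x. \<chi> i. f i \<epsilon> x) (\<lambda>x. \<chi> i. f0 i x)"
proof -
  have pd: "partial_deriv k (\<lambda>x. \<chi> i. g i x) x = (\<chi> i. partial_deriv k (g i) x)"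
    if "\<And>i. g i differentiable (at x)" for k x and g :: "'n \<Rightarrow> real^'d \<Rightarrow> 'b"
    using partial_deriv_nth[OF differentiable_vec_lambda[of g, OF that], of k]
    by (simp add: Finite_Cartesian_Product.vec_eq_iff)
  have ev: "\<forall>\<^sub>F \<epsilon> in at_right 0. \<forall>i. \<forall>x\<in>D. f i \<epsilon> differentiable (at x)"
    using formal_limitD(1)[OF f] by (simp add: eventually_all_finite)
  show ?thesis
    unfolding formal_limit_def
  proof (intro conjI ballI allI)
    show "\<forall>\<^sub>F \<epsilon> in at_right 0. \<forall>x\<in>D. (\<lambda>x. \<chi> i. f i \<epsilon> x) differentiable (at x)"
      using ev by eventually_elim (simp add: differentiable_vec_lambda)
    fix x assume x: "x \<in> D"
    show "(\<lambda>x. \<chi> i. f0 i x) differentiable (at x)"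
      by (intro differentiable_vec_lambda formal_limitD(2)[OF f x])
    show "((\<lambda>\<epsilon>. \<chi> i. f i \<epsilon> x) \<longlongrightarrow> (\<chi> i. f0 i x)) (at_right 0)"
      by (intro tendsto_vec_lambda formal_limitD(3)[OF f x])
    fix k
    have "((\<lambda>\<epsilon>. \<chi> i. partial_deriv k (f i \<epsilon>) x) \<longlongrightarrow> (\<chi> i. partial_deriv k (f0 i) x)) (at_right 0)"
      by (intro tendsto_vec_lambda formal_limitD(4)[OF f x])
    moreover have "\<forall>\<^sub>F \<epsilon> in at_right 0. (\<chi> i. partial_deriv k (f i \<epsilon>) x) = partial_deriv k (\<lambda>x. \<chi> i. f i \<epsilon> x) x"
      using ev by eventually_elim (simp add: pd x)
    ultimately show "((\<lambda>\<epsilon>. partial_deriv k (\<lambda>x. \<chi> i. f i \<epsilon> x) x) \<longlongrightarrow> partial_deriv k (\<lambda>x. \<chi> i. f0 i x) x) (at_right 0)"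
      unfolding pd[OF formal_limitD(2)[OF f x]] by (rule Lim_transform_eventually)
  qed
qed

lemma formal_limit_div_x:
  "formal_limit D f f0 \<Longrightarrow> x \<in> D \<Longrightarrow> ((\<lambda>\<epsilon>. div_x (f \<epsilon>) x) \<longlongrightarrow> div_x f0 x) (at_right 0)"
  unfolding div_x_def by (intro tendsto_sum tendsto_vec_nth formal_limitD(4))

lemma formal_limit_grad_x:
  "formal_limit D f f0 \<Longrightarrow> x \<in> D \<Longrightarrow> ((\<lambda>\<epsilon>. grad_x (f \<epsilon>) x) \<longlongrightarrow> grad_x f0 x) (at_right 0)"
  unfolding grad_x_def by (intro tendsto_vec_lambda formal_limitD(4))

lemma formal_limit_div_tensor_x:
  "formal_limit D f f0 \<Longrightarrow> x \<in> D \<Longrightarrow> ((\<lambda>\<epsilon>. div_tensor_x (f \<epsilon>) x) \<longlongrightarrow> div_tensor_x f0 x) (at_right 0)"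
  unfolding div_tensor_x_def by (intro tendsto_vec_lambda tendsto_sum tendsto_vec_nth formal_limitD(4))

section \<open>Symmetry of second derivatives\<close>

lemma has_real_derivative_line:
  fixes g :: "real^'d::finite \<Rightarrow> real"
  assumes "g differentiable (at (y + s *\<^sub>R axis k 1))"
  shows "((\<lambda>s. g (y + s *\<^sub>R axis k 1)) has_real_derivative partial_deriv k g (y + s *\<^sub>R axis k 1)) (at s)"
proof -
  let ?z = "y + s *\<^sub>R axis k 1"
  have g: "(g has_derivative frechet_derivative g (at ?z)) (at ?z)"
    using assms by (simp add: frechet_derivative_works)
  have "((\<lambda>s. y + s *\<^sub>R axis k 1) has_derivative (\<lambda>t. t *\<^sub>R axis k 1)) (at s)"
    by (auto intro!: derivative_eq_intros)
  from diff_chain_at[OF this g]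
  have "((\<lambda>s. g (y + s *\<^sub>R axis k 1)) has_derivative (\<lambda>t. frechet_derivative g (at ?z) (t *\<^sub>R axis k 1))) (at s)"
    by (simp add: o_def)
  moreover have "frechet_derivative g (at ?z) (t *\<^sub>R axis k 1) = partial_deriv k g ?z * t" for t
    using linear_scale[OF has_derivative_linear[OF g]] by (simp add: partial_deriv_def)
  ultimately show ?thesis
    by (simp add: has_field_derivative_def)
qed

text \<open>The mean value theorem is applied in direction \<open>k\<close> to the increment of
  \<open>f\<close> along \<open>l\<close>, then in direction \<open>l\<close> to
  \<open>partial_deriv k f\<close>. The second difference is symmetric in \<open>k\<close> and
  \<open>l\<close>, the order of differentiation on the right is not.\<close>

lemma second_difference_mvt:
  fixes f :: "real^'d::finite \<Rightarrow> real"
  assumes f: "\<And>y. y \<in> D \<Longrightarrow> f differentiable (at y)"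
    and f': "\<And>y. y \<in> D \<Longrightarrow> partial_deriv k f differentiable (at y)"
    and h: "h > 0"
    and sq: "\<And>s t. 0 \<le> s \<Longrightarrow> s \<le> h \<Longrightarrow> 0 \<le> t \<Longrightarrow> t \<le> h \<Longrightarrow> x + t *\<^sub>R axis l 1 + s *\<^sub>R axis k 1 \<in> D"
  shows "\<exists>s t. 0 < s \<and> s < h \<and> 0 < t \<and> t < h \<and>
    f (x + h *\<^sub>R axis l 1 + h *\<^sub>R axis k 1) - f (x + h *\<^sub>R axis k 1) - f (x + h *\<^sub>R axis l 1) + f x
      = h * h * partial_deriv l (partial_deriv k f) (x + t *\<^sub>R axis l 1 + s *\<^sub>R axis k 1)"
proof -
  let ?a = "axis k 1 :: real^'d" and ?b = "axis l 1 :: real^'d"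
  let ?\<phi> = "\<lambda>s. f (x + h *\<^sub>R ?b + s *\<^sub>R ?a) - f (x + s *\<^sub>R ?a)"
  have "\<exists>s. 0 < s \<and> s < h \<and> ?\<phi> h - ?\<phi> 0
      = (h - 0) * (partial_deriv k f (x + h *\<^sub>R ?b + s *\<^sub>R ?a) - partial_deriv k f (x + s *\<^sub>R ?a))"
    using sq[of _ 0] sq[of _ h] h
    by (intro MVT2 DERIV_diff has_real_derivative_line f) auto
  then obtain s where s: "0 < s" "s < h" and eq1: "?\<phi> h - ?\<phi> 0
      = h * (partial_deriv k f (x + h *\<^sub>R ?b + s *\<^sub>R ?a) - partial_deriv k f (x + s *\<^sub>R ?a))"
    by auto
  let ?\<psi> = "\<lambda>t. partial_deriv k f (x + s *\<^sub>R ?a + t *\<^sub>R ?b)"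
  have "\<exists>t. 0 < t \<and> t < h \<and> ?\<psi> h - ?\<psi> 0
      = (h - 0) * partial_deriv l (partial_deriv k f) (x + s *\<^sub>R ?a + t *\<^sub>R ?b)"
    using sq[of s] s h
    by (intro MVT2 has_real_derivative_line f') (auto simp: add_ac)
  then obtain t where t: "0 < t" "t < h" and eq2: "?\<psi> h - ?\<psi> 0
      = h * partial_deriv l (partial_deriv k f) (x + s *\<^sub>R ?a + t *\<^sub>R ?b)"
    by auto
  have "?\<phi> h - ?\<phi> 0 = h * (h * partial_deriv l (partial_deriv k f) (x + s *\<^sub>R ?a + t *\<^sub>R ?b))"
    unfolding eq1 eq2[symmetric] by (simp add: add_ac)
  then show ?thesis
    using s t by (intro exI[of _ s] exI[of _ t]) (simp add: add_ac mult.assoc)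
qed

text \<open>Schwarz's theorem: the symmetric second difference is evaluated in both orders, and on a
  small square continuity brings the two intermediate values close to the two mixed derivatives at
  \<open>x\<close>.\<close>

lemma partial_deriv_commute_real:
  fixes f :: "real^'d::finite \<Rightarrow> real"
  assumes "open D" "x \<in> D" and C2: "C2_on D f"
  shows "partial_deriv l (partial_deriv k f) x = partial_deriv k (partial_deriv l f) x"
proof (rule ccontr)
  let ?F = "\<lambda>l k. partial_deriv l (partial_deriv k f)"
  assume ne: "?F l k x \<noteq> ?F k l x"
  define e where "e = \<bar>?F l k x - ?F k l x\<bar> / 2"
  have e: "e > 0" using ne by (simp add: e_def)
  have cont: "isCont (?F l k) x" for k l
    using C2 continuous_on_interior[of D "?F l k" x] assms(1,2) by (simp add: C2_on_def interior_open)
  have near: "\<exists>d>0. \<forall>y. dist y x < d \<longrightarrow> \<bar>?F l k y - ?F l k x\<bar> < e" for k l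
    using cont[of l k] e unfolding continuous_at_eps_delta dist_real_def by blast
  obtain d1 where d1: "d1 > 0" "\<And>y. dist y x < d1 \<Longrightarrow> \<bar>?F l k y - ?F l k x\<bar> < e"
    using near by blast
  obtain d2 where d2: "d2 > 0" "\<And>y. dist y x < d2 \<Longrightarrow> \<bar>?F k l y - ?F k l x\<bar> < e"
    using near by blast
  obtain r where r: "r > 0" "ball x r \<subseteq> D"
    using assms(1,2) open_contains_ball by blast
  \<comment> \<open>Both displacements are at most \<open>h\<close>, so all points of the square
    have distance at most \<open>2 * h\<close> from \<open>x\<close>, strictly below each of the
    three radii.\<close>
  define h where "h = min r (min d1 d2) / 3"
  have h: "h > 0" "3 * h \<le> r" "3 * h \<le> d1" "3 * h \<le> d2"
    using r d1 d2 by (auto simp: h_def)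
  have close: "dist (x + t *\<^sub>R axis j 1 + s *\<^sub>R axis i 1) x < 3 * h"
    if "0 \<le> s" "s \<le> h" "0 \<le> t" "t \<le> h" for s t and i j :: 'd
  proof -
    have "norm (t *\<^sub>R axis j 1 + s *\<^sub>R axis i (1::real)) \<le> t + s"
      using norm_triangle_ineq[of "t *\<^sub>R axis j (1::real)" "s *\<^sub>R axis i 1"] that by simp
    then show ?thesis
      using that h(1) by (simp add: dist_norm add.assoc)
  qed
  have sq: "x + t *\<^sub>R axis j 1 + s *\<^sub>R axis i 1 \<in> D"
    if "0 \<le> s" "s \<le> h" "0 \<le> t" "t \<le> h" for s t and i j :: 'd
    using close[OF that, of j i] r(2) h(2) by (auto simp: dist_commute)
  have f: "\<And>y. y \<in> D \<Longrightarrow> f differentiable (at y)" "\<And>y k. y \<in> D \<Longrightarrow> partial_deriv k f differentiable (at y)"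
    using C2 by (auto simp: C2_on_def)
  have mvt: "\<exists>s t. 0 < s \<and> s < h \<and> 0 < t \<and> t < h \<and>
    f (x + h *\<^sub>R axis l 1 + h *\<^sub>R axis k 1) - f (x + h *\<^sub>R axis k 1) - f (x + h *\<^sub>R axis l 1) + f x
      = h * h * ?F l k (x + t *\<^sub>R axis l 1 + s *\<^sub>R axis k 1)" for k l
    by (rule second_difference_mvt[OF f h(1) sq])
  obtain s t where st: "0 < s" "s < h" "0 < t" "t < h"
    and 1: "f (x + h *\<^sub>R axis l 1 + h *\<^sub>R axis k 1) - f (x + h *\<^sub>R axis k 1) - f (x + h *\<^sub>R axis l 1) + f x
      = h * h * ?F l k (x + t *\<^sub>R axis l 1 + s *\<^sub>R axis k 1)"
    using mvt[of l k] by (elim exE conjE)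
  obtain s' t' where st': "0 < s'" "s' < h" "0 < t'" "t' < h"
    and 2: "f (x + h *\<^sub>R axis k 1 + h *\<^sub>R axis l 1) - f (x + h *\<^sub>R axis l 1) - f (x + h *\<^sub>R axis k 1) + f x
      = h * h * ?F k l (x + t' *\<^sub>R axis k 1 + s' *\<^sub>R axis l 1)"
    using mvt[of k l] by (elim exE conjE)
  let ?p = "x + t *\<^sub>R axis l 1 + s *\<^sub>R axis k 1" and ?q = "x + t' *\<^sub>R axis k 1 + s' *\<^sub>R axis l 1"
  have comm: "x + h *\<^sub>R axis k 1 + h *\<^sub>R axis l 1 = x + h *\<^sub>R axis l 1 + h *\<^sub>R axis k 1"
    by (simp add: add_ac)
  have "h * h * ?F l k ?p = h * h * ?F k l ?q"
    using 1 2[unfolded comm] by linarith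
  then have "?F l k ?p = ?F k l ?q"
    using h(1) by simp
  moreover have "\<bar>?F l k ?p - ?F l k x\<bar> < e"
    using close[of s t l k] st h by (intro d1) auto
  moreover have "\<bar>?F k l ?q - ?F k l x\<bar> < e"
    using close[of s' t' k l] st' h by (intro d2) auto
  \<comment> \<open>One number cannot be closer than half the gap to both ends of the gap.\<close>
  moreover have False if "P = Q" "\<bar>P - a\<bar> < \<bar>a - b\<bar> / 2" "\<bar>Q - b\<bar> < \<bar>a - b\<bar> / 2" for P Q a b :: real
    using that by (auto simp: abs_if split: if_splits)
  ultimately show False
    unfolding e_def by blast
qed

lemma partial_deriv_partial_deriv_nth:
  assumes "open D" "x \<in> D" and C2: "C2_on D f"
  shows "partial_deriv l (partial_deriv k (\<lambda>y. f y $ j)) x = partial_deriv l (partial_deriv k f) x $ j"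
proof -
  have "partial_deriv l (partial_deriv k (\<lambda>y. f y $ j)) x = partial_deriv l (\<lambda>y. partial_deriv k f y $ j) x"
    using C2 by (intro partial_deriv_cong_open[OF assms(1,2)] partial_deriv_nth) (simp add: C2_on_def)
  also have "\<dots> = partial_deriv l (partial_deriv k f) x $ j"
    using C2 assms(2) by (intro partial_deriv_nth) (simp add: C2_on_def)
  finally show ?thesis .
qed

lemma C2_on_nth:
  assumes "open D" and C2: "C2_on D f"
  shows "C2_on D (\<lambda>y. f y $ j)"
  unfolding C2_on_def
proof (intro conjI ballI allI)
  have f: "\<And>y. y \<in> D \<Longrightarrow> f differentiable (at y)" "\<And>y k. y \<in> D \<Longrightarrow> partial_deriv k f differentiable (at y)"
    "\<And>k l. continuous_on D (partial_deriv l (partial_deriv k f))"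
    using C2 by (auto simp: C2_on_def)
  show "(\<lambda>y. f y $ j) differentiable (at x)" if "x \<in> D" for x
    using f(1)[OF that] by (rule differentiable_nth)
  show "partial_deriv k (\<lambda>y. f y $ j) differentiable (at x)" if x: "x \<in> D" for k x
  proof -
    have "(\<lambda>y. partial_deriv k f y $ j) differentiable (at x)"
      using f(2)[OF x] by (rule differentiable_nth)
    then show ?thesis
      using differentiable_cong_open[OF \<open>open D\<close> x partial_deriv_nth[OF f(1)]] by simp
  qed
  show "continuous_on D (partial_deriv l (partial_deriv k (\<lambda>y. f y $ j)))" for k l
  proof -
    have "continuous_on D (\<lambda>x. partial_deriv l (partial_deriv k f) x $ j)"
      by (rule bounded_linear.continuous_on[OF bounded_linear_vec_nth f(3)])
    then show ?thesis
      using partial_deriv_partial_deriv_nth[OF \<open>open D\<close> _ C2] by (simp cong: continuous_on_cong)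
  qed
qed

lemma partial_deriv_commute:
  fixes f :: "real^'d::finite \<Rightarrow> real^'n::finite"
  assumes "open D" "x \<in> D" "C2_on D f"
  shows "partial_deriv l (partial_deriv k f) x = partial_deriv k (partial_deriv l f) x"
  using partial_deriv_commute_real[OF assms(1,2) C2_on_nth[OF assms(1,3)]]
  by (simp add: Finite_Cartesian_Product.vec_eq_iff partial_deriv_partial_deriv_nth[OF assms])

section \<open>Divergence of tensor fields\<close>

lemma div_tensor_x_nth:
  assumes "S differentiable (at x)"
  shows "div_tensor_x S x $ l = (\<Sum>k\<in>UNIV. partial_deriv k (\<lambda>y. S y $ k $ l) x)"
  using assms by (simp add: div_tensor_x_def partial_deriv_nth differentiable_nth)

lemma div_tensor_x_cong_open:
  assumes "open D" "x \<in> D" "\<And>y. y \<in> D \<Longrightarrow> S y = S' y"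
  shows "div_tensor_x S x = div_tensor_x S' x"
  unfolding div_tensor_x_def using partial_deriv_cong_open[OF assms] by simp

lemma div_tensor_x_add:
  assumes "S differentiable (at x)" "S' differentiable (at x)"
  shows "div_tensor_x (\<lambda>y. S y + S' y) x = div_tensor_x S x + div_tensor_x S' x"
  using assms by (simp add: div_tensor_x_def Finite_Cartesian_Product.vec_eq_iff partial_deriv_add sum.distrib)

lemma div_tensor_x_scaleR:
  assumes "S differentiable (at x)"
  shows "div_tensor_x (\<lambda>y. c *\<^sub>R S y) x = c *\<^sub>R div_tensor_x S x"
  using assms by (simp add: div_tensor_x_def Finite_Cartesian_Product.vec_eq_iff partial_deriv_scaleR_right sum_distrib_left)

lemma div_tensor_x_sum:
  assumes "\<And>j. j \<in> J \<Longrightarrow> S j differentiable (at x)"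
  shows "div_tensor_x (\<lambda>y. \<Sum>j\<in>J. S j y) x = (\<Sum>j\<in>J. div_tensor_x (S j) x)"
  using assms
proof (induction J rule: infinite_finite_induct)
  case (insert j J)
  then show ?case
    by (simp add: div_tensor_x_add differentiable_sum)
qed (simp_all add: div_tensor_x_def partial_deriv_const Finite_Cartesian_Product.vec_eq_iff)

lemma grad_x_add:
  assumes "f differentiable (at x)" "g differentiable (at x)"
  shows "grad_x (\<lambda>y. f y + g y) x = grad_x f x + grad_x g x"
  using assms by (simp add: grad_x_def Finite_Cartesian_Product.vec_eq_iff partial_deriv_add)

lemma grad_x_scale:
  assumes "f differentiable (at x)"
  shows "grad_x (\<lambda>y. c * f y) x = c *\<^sub>R grad_x f x"
  using partial_deriv_scaleR_right[OF assms, where c = c]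
  by (simp add: grad_x_def Finite_Cartesian_Product.vec_eq_iff)

lemma grad_x_sum:
  assumes "\<And>j. j \<in> J \<Longrightarrow> f j differentiable (at x)"
  shows "grad_x (\<lambda>y. \<Sum>j\<in>J. f j y) x = (\<Sum>j\<in>J. grad_x (f j) x)"
  using assms by (simp add: grad_x_def Finite_Cartesian_Product.vec_eq_iff partial_deriv_sum)

lemma differentiable_strain:
  assumes "\<And>k. partial_deriv k u differentiable (at x)"
  shows "(\<lambda>y. \<chi> k l. partial_deriv k u y $ l + partial_deriv l u y $ k) differentiable (at x)"
  using assms by (intro differentiable_vec_lambda differentiable_add differentiable_nth)

text \<open>The first half of the strain gives the Laplacian. For the transposed half the
  derivatives are exchanged, and the gradient of \<open>div_x u\<close> appears; it vanishes since
  \<open>div_x u\<close> is zero on a neighbourhood of \<open>x\<close>.\<close>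

lemma div_tensor_x_strain:
  fixes u :: "real^'d::finite \<Rightarrow> real^'d"
  assumes D: "open D" "x \<in> D" and C2: "C2_on D u" and div: "\<And>y. y \<in> D \<Longrightarrow> div_x u y = 0"
  shows "div_tensor_x (\<lambda>y. \<chi> k l. partial_deriv k u y $ l + partial_deriv l u y $ k) x = laplacian_x u x"
proof -
  have u: "partial_deriv k u differentiable (at x)" for k
    using C2 D by (simp add: C2_on_def)
  have "(\<Sum>k\<in>UNIV. partial_deriv k (partial_deriv l u) x $ k) = 0" for l
  proof -
    have "(\<Sum>k\<in>UNIV. partial_deriv k (partial_deriv l u) x $ k)
        = (\<Sum>k\<in>UNIV. partial_deriv l (\<lambda>y. partial_deriv k u y $ k) x)"
      by (intro sum.cong refl) (simp add: partial_deriv_nth u partial_deriv_commute[OF D C2])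
    also have "\<dots> = partial_deriv l (\<lambda>y. div_x u y) x"
      unfolding div_x_def by (rule partial_deriv_sum[symmetric]) (intro differentiable_nth u)
    also have "\<dots> = partial_deriv l (\<lambda>y. 0 :: real) x"
      by (intro partial_deriv_cong_open[OF D] div)
    finally show ?thesis by (simp add: partial_deriv_const)
  qed
  then show ?thesis
    by (simp add: Finite_Cartesian_Product.vec_eq_iff div_tensor_x_nth[OF differentiable_strain[OF u]]
        laplacian_x_def partial_deriv_add partial_deriv_nth differentiable_nth u sum.distrib)
qed

lemma differentiable_otimes:
  fixes u w :: "real^'d::finite \<Rightarrow> real^'d"
  assumes "u differentiable (at x)" "w differentiable (at x)"
  shows "(\<lambda>y. otimes (u y) (w y)) differentiable (at x)"
  unfolding otimes_def using assms by (intro differentiable_vec_lambda differentiable_mult differentiable_nth)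

text \<open>The conservative form of convection exceeds the convective form by
  \<open>div_x u x\<close> times \<open>u x\<close>.\<close>

lemma div_tensor_x_otimes:
  fixes u :: "real^'d::finite \<Rightarrow> real^'d"
  assumes u: "u differentiable (at x)" and div: "div_x u x = 0"
  shows "div_tensor_x (\<lambda>y. otimes (u y) (u y)) x = convect_x u u x"
proof -
  have "div_tensor_x (\<lambda>y. otimes (u y) (u y)) x $ l = convect_x u u x $ l + div_x u x * u x $ l" for l
    unfolding div_tensor_x_nth[OF differentiable_otimes[OF u u]]
    by (simp add: otimes_def partial_deriv_mult
        differentiable_nth u partial_deriv_nth sum.distrib convect_x_def div_x_def sum_distrib_right)
  then show ?thesis
    by (simp add: Finite_Cartesian_Product.vec_eq_iff div)
qed

lemma div_tensor_x_scalar: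
  assumes "\<phi> differentiable (at x)"
  shows "div_tensor_x (\<lambda>y. \<phi> y *\<^sub>R Finite_Cartesian_Product.mat 1) x = grad_x \<phi> x"
proof -
  have diff: "(\<lambda>y. \<phi> y *\<^sub>R (Finite_Cartesian_Product.mat 1 :: real^'a^'a)) differentiable (at x)"
    using assms by (rule differentiable_bounded_linear[OF bounded_linear_scaleR_left])
  have "partial_deriv k (\<lambda>y. (\<phi> y *\<^sub>R (Finite_Cartesian_Product.mat 1 :: real^'a^'a)) $ k $ l) x
      = (if k = l then partial_deriv l \<phi> x else 0)" for k l
    by (simp add: Finite_Cartesian_Product.mat_def partial_deriv_const)
  then show ?thesis
    by (simp add: Finite_Cartesian_Product.vec_eq_iff div_tensor_x_nth[OF diff] grad_x_def)
qed

lemma differentiable_norm_sq: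
  fixes u :: "real^'d::finite \<Rightarrow> real^'d"
  assumes "u differentiable (at x)"
  shows "(\<lambda>y. (norm (u y))\<^sup>2) differentiable (at x)"
  unfolding power2_norm_eq_inner using assms by (intro differentiable_inner)

section \<open>Expansion of the local Maxwellian\<close>

text \<open>The remainder quotient is filled in at 0 by its limit. Convergence along
  \<open>nhds 0\<close> is needed because it is composed with quantities such as
  \<open>\<epsilon> * r\<close>, which may be 0.\<close>

lemma ln_second_order:
  obtains h :: "real \<Rightarrow> real" where "\<And>x. ln (1 + x) = x + h x * x\<^sup>2" "(h \<longlongrightarrow> - 1 / 2) (nhds 0)"
proof
  let ?h = "\<lambda>x. if x = 0 then - 1 / 2 else (ln (1 + x) - x) / x\<^sup>2 :: real"
  show "ln (1 + x) = x + ?h x * x\<^sup>2" for x :: real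
    by simp
  have "((\<lambda>x. (ln (1 + x) - x) / x\<^sup>2) \<longlongrightarrow> - 1 / 2) (at (0::real))"
    by real_asymp
  then have "(?h \<longlongrightarrow> - 1 / 2) (at 0)"
    by (rule Lim_transform_eventually) (simp add: eventually_at_filter)
  then show "(?h \<longlongrightarrow> - 1 / 2) (nhds 0)"
    by (simp add: tendsto_nhds_iff)
qed

lemma exp_second_order:
  obtains h :: "real \<Rightarrow> real" where "\<And>x. exp x = 1 + x + h x * x\<^sup>2" "(h \<longlongrightarrow> 1 / 2) (nhds 0)"
proof
  let ?h = "\<lambda>x. if x = 0 then 1 / 2 else (exp x - 1 - x) / x\<^sup>2 :: real"
  show "exp x = 1 + x + ?h x * x\<^sup>2" for x :: real
    by simp
  have "((\<lambda>x. (exp x - 1 - x) / x\<^sup>2) \<longlongrightarrow> 1 / 2) (at (0::real))"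
    by real_asymp
  then have "(?h \<longlongrightarrow> 1 / 2) (at 0)"
    by (rule Lim_transform_eventually) (simp add: eventually_at_filter)
  then show "(?h \<longlongrightarrow> 1 / 2) (nhds 0)"
    by (simp add: tendsto_nhds_iff)
qed

text \<open>With density and temperature moved into the exponent by \<open>ln\<close>, the quotient
  is one exponential, to be expanded once.\<close>

lemma MF_over_maxwellian:
  fixes u v :: "real^'d::finite"
  assumes rF: "rF > 0" and TF: "TF > 0"
    and rF_def: "rF = 1 + \<epsilon> * r"
    and TF_def: "TF = 1 + \<epsilon> * (\<theta> / (1 + \<epsilon> * r)) - \<epsilon>\<^sup>2 * ((norm u)\<^sup>2 / (real CARD('d) * (1 + \<epsilon> * r)\<^sup>2))"
  shows "MF \<epsilon> u r \<theta> v / maxwellian v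
    = exp (ln rF - real CARD('d) / 2 * ln TF + ((norm v)\<^sup>2 / 2 - (norm (v - (\<epsilon> / rF) *\<^sub>R u))\<^sup>2 / (2 * TF)))"
proof -
  let ?d = "real CARD('d)"
  have "(2 * pi * TF) powr (?d / 2) = (2 * pi) powr (?d / 2) * exp (?d / 2 * ln TF)"
    using TF by (simp add: powr_mult powr_def[of TF])
  moreover have "(2 * pi) powr (- ?d / 2) = inverse ((2 * pi) powr (?d / 2))"
    by (simp add: powr_minus)
  moreover have "MF \<epsilon> u r \<theta> v = rF / (2 * pi * TF) powr (?d / 2) * exp (- (norm (v - (\<epsilon> / rF) *\<^sub>R u))\<^sup>2 / (2 * TF))"
    by (simp add: MF_def Let_def rF_def TF_def)
  ultimately have "MF \<epsilon> u r \<theta> v / maxwellian v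
    = rF * exp (- (norm (v - (\<epsilon> / rF) *\<^sub>R u))\<^sup>2 / (2 * TF)) / (exp (?d / 2 * ln TF) * exp (- (norm v)\<^sup>2 / 2))"
    by (simp add: maxwellian_def)
  also have "\<dots> = exp (ln rF - ?d / 2 * ln TF + ((norm v)\<^sup>2 / 2 - (norm (v - (\<epsilon> / rF) *\<^sub>R u))\<^sup>2 / (2 * TF)))"
    by (simp only: exp_add exp_diff exp_ln[OF rF] divide_inverse inverse_mult_distrib inverse_inverse_eq
        mult_minus_right mult_minus_left exp_minus mult_ac)
  finally show ?thesis .
qed

text \<open>An exact identity rather than an expansion with error term: \<open>h\<close> and \<open>e\<close> are the second-order
  remainders of \<open>ln\<close> and \<open>exp\<close>, and \<open>a = \<rho>\<^sub>F - 1\<close>, \<open>\<eta> = T\<^sub>F - 1\<close>. The first-order part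
  \<open>\<epsilon> l\<close> cancels for each \<open>\<epsilon>\<close>, so no rate of convergence of \<open>r\<close>, \<open>u\<close>, \<open>\<theta>\<close> is needed.\<close>

lemma Qterm_expansion:
  fixes u v :: "real^'d::finite" and \<epsilon> r \<theta> \<tau> :: real and h e :: "real \<Rightarrow> real"
  defines "d \<equiv> real CARD('d)"
  defines "a \<equiv> \<epsilon> * r"
  defines "X \<equiv> - \<theta> * r / (1 + a) - (norm u)\<^sup>2 / (d * (1 + a)\<^sup>2)"
  defines "y \<equiv> \<theta> + \<epsilon> * X"
  defines "\<eta> \<equiv> \<epsilon> * y"
  defines "l \<equiv> r + v \<bullet> u + ((norm v)\<^sup>2 - d) / 2 * \<theta>"
  defines "R \<equiv> h a * r\<^sup>2 - d / 2 * (X + h \<eta> * y\<^sup>2) + (norm v)\<^sup>2 / 2 * (X - y\<^sup>2 / (1 + \<eta>))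
      - (v \<bullet> u) * ((r + y + r * \<eta>) / ((1 + a) * (1 + \<eta>))) - (norm u)\<^sup>2 / (2 * (1 + a)\<^sup>2 * (1 + \<eta>))"
  assumes h: "\<And>x. ln (1 + x) = x + h x * x\<^sup>2" and e: "\<And>x. exp x = 1 + x + e x * x\<^sup>2"
    and eps: "\<epsilon> > 0" and a: "1 + a > 0" and \<eta>: "1 + \<eta> > 0"
  shows "Qterm \<tau> \<epsilon> u r \<theta> v = 1 / \<tau> * (R + e (\<epsilon> * (l + \<epsilon> * R)) * (l + \<epsilon> * R)\<^sup>2)"
proof -
  have d: "d > 0" by (simp add: d_def)
  let ?uF = "(\<epsilon> / (1 + a)) *\<^sub>R u"
  \<comment> \<open>\<open>X\<close> is chosen so that \<open>\<eta>\<close>, which is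
    \<open>T\<^sub>F - 1\<close>, splits exactly into \<open>\<epsilon> * \<theta>\<close> and
    \<open>\<epsilon>\<^sup>2 * X\<close>.\<close>
  have TF: "1 + \<eta> = 1 + \<epsilon> * (\<theta> / (1 + \<epsilon> * r)) - \<epsilon>\<^sup>2 * ((norm u)\<^sup>2 / (real CARD('d) * (1 + \<epsilon> * r)\<^sup>2))"
  proof -
    have 1: "\<theta> / (1 + a) = \<theta> - \<epsilon> * (\<theta> * r / (1 + a))"
      using a by (simp add: a_def field_simps)
    show ?thesis
      unfolding \<eta>_def y_def X_def a_def[symmetric] d_def[symmetric] 1
      by (simp add: algebra_simps power2_eq_square)
  qed
  \<comment> \<open>This and the next fact are truncated geometric series with their exact
    remainders.\<close>
  have W1: "\<eta> / (1 + \<eta>) = \<epsilon> * \<theta> + \<epsilon>\<^sup>2 * (X - y\<^sup>2 / (1 + \<eta>))"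
  proof -
    have "\<eta> / (1 + \<eta>) = \<eta> - \<eta>\<^sup>2 / (1 + \<eta>)"
      using \<eta> by (simp add: field_simps power2_eq_square)
    also have "\<dots> = \<epsilon> * (\<theta> + \<epsilon> * X) - (\<epsilon> * y)\<^sup>2 / (1 + \<eta>)"
      by (simp add: \<eta>_def y_def)
    finally show ?thesis
      by (simp add: algebra_simps power2_eq_square)
  qed
  have W2: "1 / ((1 + a) * (1 + \<eta>)) = 1 - \<epsilon> * ((r + y + r * \<eta>) / ((1 + a) * (1 + \<eta>)))"
  proof -
    have "\<epsilon> * (r + y + r * \<eta>) = (1 + a) * (1 + \<eta>) - 1"
      by (simp add: a_def \<eta>_def algebra_simps)
    then have "\<epsilon> * ((r + y + r * \<eta>) / ((1 + a) * (1 + \<eta>))) = ((1 + a) * (1 + \<eta>) - 1) / ((1 + a) * (1 + \<eta>))"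
      by simp
    also have "\<dots> = 1 - 1 / ((1 + a) * (1 + \<eta>))"
      using a \<eta> by (simp add: diff_divide_distrib)
    finally show ?thesis by simp
  qed
  have W: "(norm v)\<^sup>2 / 2 - (norm (v - ?uF))\<^sup>2 / (2 * (1 + \<eta>))
     = (norm v)\<^sup>2 / 2 * (\<eta> / (1 + \<eta>)) + \<epsilon> * (v \<bullet> u) * (1 / ((1 + a) * (1 + \<eta>)))
       - \<epsilon>\<^sup>2 * ((norm u)\<^sup>2 / (2 * (1 + a)\<^sup>2 * (1 + \<eta>)))"
  proof -
    have nrm: "(norm (v - c *\<^sub>R u))\<^sup>2 = (norm v)\<^sup>2 - 2 * c * (v \<bullet> u) + c\<^sup>2 * (norm u)\<^sup>2" for c
      unfolding power2_norm_eq_inner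
      by (simp add: inner_diff_left inner_diff_right inner_commute[of u v] power2_eq_square algebra_simps)
    have 1: "(norm v)\<^sup>2 / 2 - (norm v)\<^sup>2 / (2 * (1 + \<eta>)) = (norm v)\<^sup>2 / 2 * (\<eta> / (1 + \<eta>))"
      using \<eta> by (simp add: field_simps)
    have 2: "2 * (\<epsilon> / A) * w / (2 * B) = \<epsilon> * w * (1 / (A * B))" for A B w :: real
      by simp
    have 3: "(\<epsilon> / A)\<^sup>2 * w / (2 * B) = \<epsilon>\<^sup>2 * (w / (2 * A\<^sup>2 * B))" for A B w :: real
      by (simp add: power_divide mult_ac)
    show ?thesis
      unfolding nrm add_divide_distrib diff_divide_distrib 2 3 1[symmetric] by simp
  qed
  define L where "L = \<epsilon> * (l + \<epsilon> * R)"
  have "ln (1 + a) - d / 2 * ln (1 + \<eta>) + ((norm v)\<^sup>2 / 2 - (norm (v - ?uF))\<^sup>2 / (2 * (1 + \<eta>))) = L"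
  proof -
    \<comment> \<open>Naming the quotients makes the collection of powers of \<epsilon> a polynomial
      identity: the terms with \<open>\<epsilon>\<close> add up to \<open>l\<close>, those with
      \<open>\<epsilon>\<^sup>2\<close> to \<open>R\<close>.\<close>
    define p q s where "p = y\<^sup>2 / (1 + \<eta>)" and "q = (r + y + r * \<eta>) / ((1 + a) * (1 + \<eta>))"
      and "s = (norm u)\<^sup>2 / (2 * (1 + a)\<^sup>2 * (1 + \<eta>))"
    have "ln (1 + a) = \<epsilon> * r + \<epsilon>\<^sup>2 * (h a * r\<^sup>2)"
      by (subst h) (simp add: a_def power_mult_distrib)
    moreover have "ln (1 + \<eta>) = \<epsilon> * \<theta> + \<epsilon>\<^sup>2 * (X + h \<eta> * y\<^sup>2)"
    proof -
      have "ln (1 + \<eta>) = \<epsilon> * (\<theta> + \<epsilon> * X) + h \<eta> * (\<epsilon> * y)\<^sup>2"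
        by (subst h) (simp add: \<eta>_def y_def)
      then show ?thesis by (simp add: algebra_simps power2_eq_square)
    qed
    moreover have "(\<epsilon> * r + \<epsilon>\<^sup>2 * A) - \<delta> * (\<epsilon> * \<theta> + \<epsilon>\<^sup>2 * B) + (\<nu> * (\<epsilon> * \<theta> + \<epsilon>\<^sup>2 * C) + \<epsilon> * w * (1 - \<epsilon> * q) - \<epsilon>\<^sup>2 * s)
        = \<epsilon> * ((r + w + (\<nu> - \<delta>) * \<theta>) + \<epsilon> * (A - \<delta> * B + \<nu> * C - w * q - s))" for A B C w \<delta> \<nu>
      by (simp add: algebra_simps power2_eq_square)
    ultimately show ?thesis
      unfolding W W1 W2 L_def l_def R_def p_def[symmetric] q_def[symmetric] s_def[symmetric] diff_divide_distrib
      by (simp only:)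
  qed
  then have MF: "MF \<epsilon> u r \<theta> v / maxwellian v = exp L"
    using MF_over_maxwellian[OF a \<eta> _ TF, of v] by (simp add: a_def d_def)
  have "Qterm \<tau> \<epsilon> u r \<theta> v = 1 / (\<epsilon>\<^sup>2 * \<tau>) * (exp L - 1 - \<epsilon> * l)"
    by (simp add: Qterm_def MF l_def d_def)
  also have "exp L - 1 - \<epsilon> * l = \<epsilon>\<^sup>2 * (R + e L * (l + \<epsilon> * R)\<^sup>2)"
  proof -
    have "exp L - 1 - \<epsilon> * l = \<epsilon> * (l + \<epsilon> * R) + e L * (\<epsilon> * (l + \<epsilon> * R))\<^sup>2 - \<epsilon> * l"
      unfolding e[of L] by (simp only: L_def)
    also have "\<dots> = \<epsilon>\<^sup>2 * (R + e L * (l + \<epsilon> * R)\<^sup>2)"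
      unfolding power_mult_distrib power2_eq_square[of \<epsilon>] by (simp only: algebra_simps)
    finally show ?thesis .
  qed
  also have "1 / (\<epsilon>\<^sup>2 * \<tau>) * (\<epsilon>\<^sup>2 * z) = 1 / \<tau> * z" for z
    using eps by simp
  finally show ?thesis
    unfolding L_def .
qed

text \<open>The limit is \<open>R0 + 1 / 2 * l0\<^sup>2\<close> over \<tau>: the second-order
  coefficient of the exponent plus half the square of the first-order one.\<close>

lemma Qterm_tendsto:
  fixes u :: "real \<Rightarrow> real^'d::finite" and v :: "real^'d"
  assumes u: "(u \<longlongrightarrow> u0) (at_right 0)" and r: "(r \<longlongrightarrow> r0) (at_right 0)"
    and \<theta>: "(\<theta> \<longlongrightarrow> \<theta>0) (at_right 0)" and press: "r0 + \<theta>0 = 0"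
  shows "((\<lambda>\<epsilon>. Qterm \<tau> \<epsilon> (u \<epsilon>) (r \<epsilon>) (\<theta> \<epsilon>) v) \<longlongrightarrow>
     1 / \<tau> * (1 / 2 * ((v \<bullet> u0)\<^sup>2 - (norm v)\<^sup>2 * (norm u0)\<^sup>2 / real CARD('d))
       + 1 / 2 * ((v \<bullet> u0) * ((norm v)\<^sup>2 - (real CARD('d) + 2)) * \<theta>0)
       + \<theta>0\<^sup>2 * (((norm v)\<^sup>2 - (real CARD('d) + 2))\<^sup>2 / 8 - 1 / 2 - real CARD('d) / 4))) (at_right 0)"
proof -
  define d where "d = real CARD('d)"
  have d: "d > 0" by (simp add: d_def)
  obtain h :: "real \<Rightarrow> real" where h: "\<And>x. ln (1 + x) = x + h x * x\<^sup>2" "(h \<longlongrightarrow> - 1 / 2) (nhds 0)"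
    by (rule ln_second_order) blast
  obtain e :: "real \<Rightarrow> real" where e: "\<And>x. exp x = 1 + x + e x * x\<^sup>2" "(e \<longlongrightarrow> 1 / 2) (nhds 0)"
    by (rule exp_second_order) blast
  have eps: "((\<lambda>\<epsilon>. \<epsilon>) \<longlongrightarrow> (0 :: real)) (at_right 0)"
    by (rule tendsto_ident_at)
  define a where "a \<epsilon> = \<epsilon> * r \<epsilon>" for \<epsilon>
  define X where "X \<epsilon> = - \<theta> \<epsilon> * r \<epsilon> / (1 + a \<epsilon>) - (norm (u \<epsilon>))\<^sup>2 / (d * (1 + a \<epsilon>)\<^sup>2)" for \<epsilon>
  define y where "y \<epsilon> = \<theta> \<epsilon> + \<epsilon> * X \<epsilon>" for \<epsilon>
  define \<eta> where "\<eta> \<epsilon> = \<epsilon> * y \<epsilon>" for \<epsilon>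
  define l where "l \<epsilon> = r \<epsilon> + v \<bullet> u \<epsilon> + ((norm v)\<^sup>2 - d) / 2 * \<theta> \<epsilon>" for \<epsilon>
  define R where "R \<epsilon> = h (a \<epsilon>) * (r \<epsilon>)\<^sup>2 - d / 2 * (X \<epsilon> + h (\<eta> \<epsilon>) * (y \<epsilon>)\<^sup>2)
      + (norm v)\<^sup>2 / 2 * (X \<epsilon> - (y \<epsilon>)\<^sup>2 / (1 + \<eta> \<epsilon>))
      - (v \<bullet> u \<epsilon>) * ((r \<epsilon> + y \<epsilon> + r \<epsilon> * \<eta> \<epsilon>) / ((1 + a \<epsilon>) * (1 + \<eta> \<epsilon>)))
      - (norm (u \<epsilon>))\<^sup>2 / (2 * (1 + a \<epsilon>)\<^sup>2 * (1 + \<eta> \<epsilon>))" for \<epsilon>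
  \<comment> \<open>The unreduced \<open>1 + 0\<close>, here and in \<open>R0\<close>, has the form
    in which \<open>tendsto_intros\<close> delivers the limit.\<close>
  define X0 where "X0 = - \<theta>0 * r0 / (1 + 0) - (norm u0)\<^sup>2 / (d * (1 + 0)\<^sup>2)"
  have a: "(a \<longlongrightarrow> 0) (at_right 0)"
    using tendsto_mult[OF eps r] by (simp add: a_def[abs_def])
  have X: "(X \<longlongrightarrow> X0) (at_right 0)"
    unfolding X_def[abs_def] X0_def using d by (intro tendsto_intros \<theta> r a u) auto
  have y: "(y \<longlongrightarrow> \<theta>0) (at_right 0)"
    using tendsto_add[OF \<theta> tendsto_mult[OF eps X]] by (simp add: y_def[abs_def])
  have \<eta>: "(\<eta> \<longlongrightarrow> 0) (at_right 0)"
    using tendsto_mult[OF eps y] by (simp add: \<eta>_def[abs_def])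
  have ha: "((\<lambda>\<epsilon>. h (a \<epsilon>)) \<longlongrightarrow> - 1 / 2) (at_right 0)" and h\<eta>: "((\<lambda>\<epsilon>. h (\<eta> \<epsilon>)) \<longlongrightarrow> - 1 / 2) (at_right 0)"
    by (rule filterlim_compose[OF h(2)] a \<eta>)+
  define l0 where "l0 = r0 + v \<bullet> u0 + ((norm v)\<^sup>2 - d) / 2 * \<theta>0"
  have l: "(l \<longlongrightarrow> l0) (at_right 0)"
    unfolding l_def[abs_def] l0_def by (intro tendsto_intros r u \<theta>)
  define R0 where "R0 = - 1 / 2 * r0\<^sup>2 - d / 2 * (X0 + - 1 / 2 * \<theta>0\<^sup>2)
      + (norm v)\<^sup>2 / 2 * (X0 - \<theta>0\<^sup>2 / (1 + 0))
      - (v \<bullet> u0) * ((r0 + \<theta>0 + r0 * 0) / ((1 + 0) * (1 + 0)))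
      - (norm u0)\<^sup>2 / (2 * (1 + 0)\<^sup>2 * (1 + 0))"
  have R: "(R \<longlongrightarrow> R0) (at_right 0)"
    unfolding R_def[abs_def] R0_def by (intro tendsto_intros r u X y a \<eta> ha h\<eta>) auto
  have lR: "((\<lambda>\<epsilon>. l \<epsilon> + \<epsilon> * R \<epsilon>) \<longlongrightarrow> l0) (at_right 0)"
    using tendsto_add[OF l tendsto_mult[OF eps R]] by simp
  have L: "((\<lambda>\<epsilon>. \<epsilon> * (l \<epsilon> + \<epsilon> * R \<epsilon>)) \<longlongrightarrow> 0) (at_right 0)"
    using tendsto_mult[OF eps lR] by simp
  have eL: "((\<lambda>\<epsilon>. e (\<epsilon> * (l \<epsilon> + \<epsilon> * R \<epsilon>))) \<longlongrightarrow> 1 / 2) (at_right 0)"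
    by (rule filterlim_compose[OF e(2) L])
  have "((\<lambda>\<epsilon>. 1 / \<tau> * (R \<epsilon> + e (\<epsilon> * (l \<epsilon> + \<epsilon> * R \<epsilon>)) * (l \<epsilon> + \<epsilon> * R \<epsilon>)\<^sup>2)) \<longlongrightarrow> 1 / \<tau> * (R0 + 1 / 2 * l0\<^sup>2)) (at_right 0)"
    by (intro tendsto_intros R eL lR)
  moreover have "\<forall>\<^sub>F \<epsilon> in at_right 0. 1 / \<tau> * (R \<epsilon> + e (\<epsilon> * (l \<epsilon> + \<epsilon> * R \<epsilon>)) * (l \<epsilon> + \<epsilon> * R \<epsilon>)\<^sup>2)
      = Qterm \<tau> \<epsilon> (u \<epsilon>) (r \<epsilon>) (\<theta> \<epsilon>) v"
  proof -
    have "\<forall>\<^sub>F \<epsilon> in at_right 0. a \<epsilon> > -1"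
      by (rule order_tendstoD(1)[OF a]) simp
    moreover have "\<forall>\<^sub>F \<epsilon> in at_right 0. \<eta> \<epsilon> > -1"
      by (rule order_tendstoD(1)[OF \<eta>]) simp
    moreover have "\<forall>\<^sub>F \<epsilon> in at_right 0. \<epsilon> > (0 :: real)"
      by (rule eventually_at_right_less)
    ultimately show ?thesis
    proof eventually_elim
      case (elim \<epsilon>)
      have a1: "1 + \<epsilon> * r \<epsilon> > 0" using elim(1) by (simp add: a_def)
      have "1 + \<eta> \<epsilon> > 0" using elim(2) by simp
      then have \<eta>1: "1 + \<epsilon> * (\<theta> \<epsilon> + \<epsilon> * (- \<theta> \<epsilon> * r \<epsilon> / (1 + \<epsilon> * r \<epsilon>) - (norm (u \<epsilon>))\<^sup>2 / (real CARD('d) * (1 + \<epsilon> * r \<epsilon>)\<^sup>2))) > 0"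
        unfolding \<eta>_def y_def X_def a_def d_def .
      show ?case
        unfolding R_def l_def \<eta>_def y_def X_def a_def d_def
        by (rule Qterm_expansion[OF h(1) e(1) elim(3) a1 \<eta>1, symmetric])
    qed
  qed
  ultimately have lim: "((\<lambda>\<epsilon>. Qterm \<tau> \<epsilon> (u \<epsilon>) (r \<epsilon>) (\<theta> \<epsilon>) v) \<longlongrightarrow> 1 / \<tau> * (R0 + 1 / 2 * l0\<^sup>2)) (at_right 0)"
    by (rule Lim_transform_eventually)
  \<comment> \<open>Now the coefficient of \<open>v \<bullet> u0\<close> in \<open>R0\<close> is 0
    and \<open>X0\<close> is \<open>\<theta>0\<^sup>2 - (norm u0)\<^sup>2 / d\<close>. So
    \<open>R0\<close> supplies the product of the squared norms and the constants
    \<open>- 1 / 2 - d / 4\<close>; all other terms stem from the square of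
    \<open>l0\<close>.\<close>
  have r0: "r0 = - \<theta>0" using press by simp
  have "R0 + 1 / 2 * l0\<^sup>2 = 1 / 2 * ((v \<bullet> u0)\<^sup>2 - (norm v)\<^sup>2 * (norm u0)\<^sup>2 / d)
       + 1 / 2 * ((v \<bullet> u0) * ((norm v)\<^sup>2 - (d + 2)) * \<theta>0)
       + \<theta>0\<^sup>2 * (((norm v)\<^sup>2 - (d + 2))\<^sup>2 / 8 - 1 / 2 - d / 4)"
    unfolding R0_def X0_def l0_def r0 using d
    by (simp add: field_simps power2_eq_square)
  with lim show ?thesis
    unfolding d_def by (simp only:)
qed

section \<open>Tableaux of type CK\<close>

text \<open>\<open>Matrix.mat\<close> counts from 0, the tableau block from 2. Both one-sided
  inverses are recorded: the left one yields uniqueness, the right one existence of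
  solutions.\<close>

lemma invertible_mat_shifted_inverse:
  fixes A :: "nat \<Rightarrow> nat \<Rightarrow> real"
  assumes "invertible_mat (Matrix.mat n n (\<lambda>(i, j). A (i + 2) (j + 2)))"
  obtains B where
    "\<And>i k. i \<in> {2..<n + 2} \<Longrightarrow> k \<in> {2..<n + 2} \<Longrightarrow> (\<Sum>j\<in>{2..<n + 2}. A i j * B j k) = of_bool (i = k)"
    "\<And>i k. i \<in> {2..<n + 2} \<Longrightarrow> k \<in> {2..<n + 2} \<Longrightarrow> (\<Sum>j\<in>{2..<n + 2}. B i j * A j k) = of_bool (i = k)"
proof -
  let ?M = "Matrix.mat n n (\<lambda>(i, j). A (i + 2) (j + 2))"
  obtain B where MB: "?M * B = 1\<^sub>m n" and BM: "B * ?M = 1\<^sub>m (dim_row B)"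
    using assms by (auto simp: invertible_mat_def inverts_mat_def)
  \<comment> \<open>\<open>invertible_mat\<close> leaves the size of the inverse open; it is read
    off from the identity matrices.\<close>
  have col: "dim_col B = n"
    using arg_cong[OF MB, of dim_col] by simp
  have row: "dim_row B = n"
    using arg_cong[OF BM, of dim_col] by simp
  define B' where "B' j k = B $$ (j - 2, k - 2)" for j k
  have shift: "(\<Sum>j\<in>{2..<n + 2}. f j) = (\<Sum>j\<in>{0..<n}. f (j + 2))" for f :: "nat \<Rightarrow> real"
    by (rule sum.reindex_bij_witness[of _ "\<lambda>j. j + 2" "\<lambda>j. j - 2"]) (auto intro!: arg_cong[of _ _ f])
  show thesis
  proof
    fix i k :: nat assume ik: "i \<in> {2..<n + 2}" "k \<in> {2..<n + 2}"
    define i' k' where "i' = i - 2" and "k' = k - 2"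
    have i: "i = i' + 2" "k = k' + 2" "i' < n" "k' < n"
      using ik by (auto simp: i'_def k'_def)
    have "(\<Sum>j\<in>{2..<n + 2}. A i j * B' j k) = (?M * B) $$ (i', k')"
      unfolding shift using i row col by (simp add: Matrix.scalar_prod_def B'_def)
    also have "\<dots> = of_bool (i = k)"
      unfolding MB using i by simp
    finally show "(\<Sum>j\<in>{2..<n + 2}. A i j * B' j k) = of_bool (i = k)" .
    have "(\<Sum>j\<in>{2..<n + 2}. B' i j * A j k) = (B * ?M) $$ (i', k')"
      unfolding shift using i row col by (simp add: Matrix.scalar_prod_def B'_def)
    also have "\<dots> = of_bool (i = k)"
      unfolding BM row using i by simp
    finally show "(\<Sum>j\<in>{2..<n + 2}. B' i j * A j k) = of_bool (i = k)" .
  qed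
qed

lemma type_CK_inverse:
  assumes "type_CK s A" "s \<ge> 1"
  obtains B where
    "\<And>i k. i \<in> {2..s} \<Longrightarrow> k \<in> {2..s} \<Longrightarrow> (\<Sum>j\<in>{2..s}. A i j * B j k) = of_bool (i = k)"
    "\<And>i k. i \<in> {2..s} \<Longrightarrow> k \<in> {2..s} \<Longrightarrow> (\<Sum>j\<in>{2..s}. B i j * A j k) = of_bool (i = k)"
proof -
  \<comment> \<open>The subtraction is truncated, so the range ends at \<open>s\<close> only because
    \<open>s \<ge> 1\<close>. For \<open>s = 1\<close> the block is empty.\<close>
  have eq: "{2..<s - 1 + 2} = {2..s}"
    using assms(2) by auto
  have "invertible_mat (Matrix.mat (s - 1) (s - 1) (\<lambda>(i, j). A (i + 2) (j + 2)))"
    using assms(1) by (simp only: type_CK_def)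
  from invertible_mat_shifted_inverse[OF this, unfolded eq] show thesis
    using that by blast
qed

lemma sum_atLeastAtMost_split_first:
  fixes f :: "nat \<Rightarrow> 'a::comm_monoid_add"
  assumes "s \<ge> 1"
  shows "(\<Sum>j\<in>{1..s}. f j) = f 1 + (\<Sum>j\<in>{2..s}. f j)"
proof -
  have "{1..s} = insert 1 {2..s}"
    using assms by auto
  then show ?thesis by simp
qed

text \<open>The zero first row says nothing about \<open>x 1\<close>, so its vanishing has to be
  supplied; then the first column drops out and the left inverse of the block applies. In the
  application \<open>x j\<close> is the divergence of stage \<open>j\<close> at a point.\<close>

lemma type_CK_kernel:
  assumes CK: "type_CK s A" and s: "s \<ge> 1" and "x 1 = 0"
    and zero: "\<And>i. i \<in> {1..s} \<Longrightarrow> (\<Sum>j\<in>{1..s}. A i j * x j) = 0"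
    and k: "k \<in> {1..s}"
  shows "x k = 0"
proof (cases "k = 1")
  case False
  then have k: "k \<in> {2..s}" using k by auto
  obtain B where "\<And>i k. i \<in> {2..s} \<Longrightarrow> k \<in> {2..s} \<Longrightarrow> (\<Sum>j\<in>{2..s}. A i j * B j k) = of_bool (i = k)"
    and B: "\<And>i k. i \<in> {2..s} \<Longrightarrow> k \<in> {2..s} \<Longrightarrow> (\<Sum>j\<in>{2..s}. B i j * A j k) = of_bool (i = k)"
    by (rule type_CK_inverse[OF CK s]) blast
  have zero': "(\<Sum>j\<in>{2..s}. A i j * x j) = 0" if "i \<in> {2..s}" for i
    using zero[of i] that sum_atLeastAtMost_split_first[OF s, of "\<lambda>j. A i j * x j"] \<open>x 1 = 0\<close> by auto
  have "x k = (\<Sum>j\<in>{2..s}. of_bool (k = j) * x j)"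
    using k by (subst sum.remove[of _ k]) auto
  also have "\<dots> = (\<Sum>j\<in>{2..s}. (\<Sum>i\<in>{2..s}. B k i * A i j) * x j)"
    by (intro sum.cong refl) (simp only: B[OF k])
  also have "\<dots> = (\<Sum>j\<in>{2..s}. \<Sum>i\<in>{2..s}. B k i * (A i j * x j))"
    by (simp add: sum_distrib_right mult.assoc)
  also have "\<dots> = (\<Sum>i\<in>{2..s}. \<Sum>j\<in>{2..s}. B k i * (A i j * x j))"
    by (rule sum.swap)
  also have "\<dots> = (\<Sum>i\<in>{2..s}. B k i * (\<Sum>j\<in>{2..s}. A i j * x j))"
    by (simp add: sum_distrib_left)
  also have "\<dots> = 0"
    by (rule sum.neutral) (simp add: zero')
  finally show ?thesis .
qed (use assms(3) in simp)

text \<open>The zero first row of \<open>A\<close> forces the condition on \<open>R 1\<close>. With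
  \<open>c 1 k = 0\<close> the first column is inactive, and the right inverse of the block solves
  the remaining rows. It will serve to express explicit weights through implicit ones.\<close>

lemma type_CK_solve:
  assumes CK: "type_CK s A" and s: "s \<ge> 1" and R1: "\<And>k. k \<in> {1..s} \<Longrightarrow> R 1 k = 0"
  obtains c :: "nat \<Rightarrow> nat \<Rightarrow> real" where
    "\<And>i k. i \<in> {1..s} \<Longrightarrow> k \<in> {1..s} \<Longrightarrow> (\<Sum>j\<in>{1..s}. A i j * c j k) = R i k"
proof -
  obtain B where B: "\<And>i k. i \<in> {2..s} \<Longrightarrow> k \<in> {2..s} \<Longrightarrow> (\<Sum>j\<in>{2..s}. A i j * B j k) = of_bool (i = k)"
    and "\<And>i k. i \<in> {2..s} \<Longrightarrow> k \<in> {2..s} \<Longrightarrow> (\<Sum>j\<in>{2..s}. B i j * A j k) = of_bool (i = k)"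
    by (rule type_CK_inverse[OF CK s]) blast
  define c where "c j k = (if j = 1 then 0 else \<Sum>m\<in>{2..s}. B j m * R m k)" for j k
  show thesis
  proof
    fix i k assume i: "i \<in> {1..s}" and k: "k \<in> {1..s}"
    show "(\<Sum>j\<in>{1..s}. A i j * c j k) = R i k"
    proof (cases "i = 1")
      case True
      then show ?thesis
        using CK R1[OF k] by (simp add: type_CK_def)
    next
      case False
      then have i: "i \<in> {2..s}" using i by auto
      have "(\<Sum>j\<in>{1..s}. A i j * c j k) = (\<Sum>j\<in>{2..s}. A i j * c j k)"
        unfolding sum_atLeastAtMost_split_first[OF s] by (simp add: c_def)
      also have "\<dots> = (\<Sum>j\<in>{2..s}. \<Sum>m\<in>{2..s}. A i j * B j m * R m k)"
        by (intro sum.cong refl) (auto simp: c_def sum_distrib_left mult.assoc)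
      also have "\<dots> = (\<Sum>m\<in>{2..s}. \<Sum>j\<in>{2..s}. A i j * B j m * R m k)"
        by (rule sum.swap)
      also have "\<dots> = (\<Sum>m\<in>{2..s}. of_bool (i = m) * R m k)"
        by (intro sum.cong refl) (simp only: B[OF i] flip: sum_distrib_right)
      also have "\<dots> = R i k"
        using i by (subst sum.remove[of _ i]) auto
      finally show ?thesis .
    qed
  qed
qed

section \<open>The limit of one update\<close>

text \<open>Gives access to rows and components of a moment. The linear map passes through the
  bracket by integrability, which \<open>moment_limit\<close> supplies for small \<epsilon> and for
  the limit.\<close>

lemma moment_limit_bounded_linear:
  fixes h :: "'b::{banach, second_countable_topology} \<Rightarrow> 'c::{banach, second_countable_topology}"
  assumes "open D" and lim: "moment_limit D \<phi> Y Y0" and h: "bounded_linear h"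
  shows "formal_limit D (\<lambda>\<epsilon> x. vbracket (\<lambda>v. micro (Y \<epsilon>) x v *\<^sub>R h (\<phi> v)))
    (\<lambda>x. vbracket (\<lambda>v. micro Y0 x v *\<^sub>R h (\<phi> v)))"
proof (rule formal_limit_cong[OF \<open>open D\<close>])
  have eq: "h (vbracket (\<lambda>v. g v *\<^sub>R \<phi> v)) = vbracket (\<lambda>v. g v *\<^sub>R h (\<phi> v))"
    if "integrable lborel (\<lambda>v. maxwellian v *\<^sub>R (g v *\<^sub>R \<phi> v))" for g
    using vbracket_bounded_linear[OF h that] linear_scale[OF bounded_linear.linear[OF h]] by simp
  show "formal_limit D (\<lambda>\<epsilon> x. h (vbracket (\<lambda>v. micro (Y \<epsilon>) x v *\<^sub>R \<phi> v)))
    (\<lambda>x. h (vbracket (\<lambda>v. micro Y0 x v *\<^sub>R \<phi> v)))"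
    using lim by (intro formal_limit_bounded_linear[OF h]) (simp add: moment_limit_def)
  have "\<forall>\<^sub>F \<epsilon> in at_right 0. \<forall>x\<in>D.
      integrable lborel (\<lambda>v. maxwellian v *\<^sub>R (micro (Y \<epsilon>) x v *\<^sub>R \<phi> v))"
    using lim by (simp only: moment_limit_def)
  then show "\<forall>\<^sub>F \<epsilon> in at_right 0. \<forall>x\<in>D. h (vbracket (\<lambda>v. micro (Y \<epsilon>) x v *\<^sub>R \<phi> v))
      = vbracket (\<lambda>v. micro (Y \<epsilon>) x v *\<^sub>R h (\<phi> v))"
    by eventually_elim (blast intro: eq)
  show "h (vbracket (\<lambda>v. micro Y0 x v *\<^sub>R \<phi> v)) = vbracket (\<lambda>v. micro Y0 x v *\<^sub>R h (\<phi> v))"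
    if "x \<in> D" for x
    using lim that by (intro eq) (simp only: moment_limit_def)
qed

section \<open>Limits of the single equations of the scheme\<close>

lemma fields_limitD:
  fixes Y :: "real \<Rightarrow> 'd::finite fields"
  assumes "fields_limit D Y Y0 pt"
  shows "formal_limit D (\<lambda>\<epsilon>. rho (Y \<epsilon>)) (rho Y0)"
    and "formal_limit D (\<lambda>\<epsilon>. vel (Y \<epsilon>)) (vel Y0)"
    and "C2_on D (vel Y0)"
    and "formal_limit D (\<lambda>\<epsilon>. temp (Y \<epsilon>)) (temp Y0)"
    and "formal_limit D (\<lambda>\<epsilon> x. press (Y \<epsilon>) x / \<epsilon>) pt"
    and "\<And>v. formal_limit D (\<lambda>\<epsilon> x. micro (Y \<epsilon>) x v) (\<lambda>x. micro Y0 x v)"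
    and "moment_limit D calA Y Y0"
    and "moment_limit D (\<lambda>v. v) Y Y0"
    and "moment_limit D (\<lambda>v. otimes v v) Y Y0"
    and "moment_limit D (\<lambda>v. (((norm v)\<^sup>2 - real CARD('d)) / real CARD('d)) *\<^sub>R v) Y Y0"
  using assms unfolding fields_limit_def by blast+

lemma tendsto_eps: "((\<lambda>\<epsilon>. \<epsilon>) \<longlongrightarrow> (0 :: real)) (at_right 0)"
  by (rule tendsto_ident_at)

lemma eventually_eps_pos: "\<forall>\<^sub>F \<epsilon> in at_right 0. \<epsilon> > (0 :: real)"
  by (rule eventually_at_right_less)

text \<open>The rescaled pressure converges, so the pressure itself is of order \<epsilon>. This
  relation eliminates the density from the limit of \<open>Qterm\<close>.\<close>

lemma press_limit_zero:
  assumes "fields_limit D Y Y0 pt" "x \<in> D"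
  shows "rho Y0 x + temp Y0 x = 0"
proof -
  note FL = fields_limitD[OF assms(1)]
  have "((\<lambda>\<epsilon>. \<epsilon> * (press (Y \<epsilon>) x / \<epsilon>)) \<longlongrightarrow> 0 * pt x) (at_right 0)"
    by (intro tendsto_mult tendsto_eps formal_limitD(3)[OF FL(5) assms(2)])
  moreover have "\<forall>\<^sub>F \<epsilon> in at_right 0. \<epsilon> * (press (Y \<epsilon>) x / \<epsilon>) = rho (Y \<epsilon>) x + temp (Y \<epsilon>) x"
    using eventually_eps_pos by eventually_elim (simp add: press_def)
  ultimately have "((\<lambda>\<epsilon>. rho (Y \<epsilon>) x + temp (Y \<epsilon>) x) \<longlongrightarrow> 0 * pt x) (at_right 0)"
    by (rule Lim_transform_eventually)
  moreover have "((\<lambda>\<epsilon>. rho (Y \<epsilon>) x + temp (Y \<epsilon>) x) \<longlongrightarrow> rho Y0 x + temp Y0 x) (at_right 0)"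
    by (intro tendsto_add formal_limitD(3)[OF FL(1) assms(2)] formal_limitD(3)[OF FL(4) assms(2)])
  ultimately show ?thesis
    using tendsto_unique[of "at_right (0::real)"] by fastforce
qed

text \<open>After multiplication of the density equation by \<open>\<epsilon> / dt\<close> its time
  difference tends to 0 and only the weighted divergences remain.\<close>

lemma imex_update_limit_div:
  assumes upd: "\<forall>\<^sub>F \<epsilon> in at_right 0. imex_update D \<tau> dt \<epsilon> Je bt Ji b (Yn \<epsilon>) (Y \<epsilon>) (Z \<epsilon>)"
    and "dt \<noteq> 0" and x: "x \<in> D"
    and n: "formal_limit D (\<lambda>\<epsilon>. rho (Yn \<epsilon>)) r" and z: "formal_limit D (\<lambda>\<epsilon>. rho (Z \<epsilon>)) r'"
    and j: "\<And>j. j \<in> Ji \<Longrightarrow> formal_limit D (\<lambda>\<epsilon>. vel (Y \<epsilon> j)) (u j)"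
  shows "(\<Sum>j\<in>Ji. b j * div_x (u j) x) = 0"
proof -
  have "((\<lambda>\<epsilon>. \<Sum>j\<in>Ji. b j * div_x (vel (Y \<epsilon> j)) x) \<longlongrightarrow> (\<Sum>j\<in>Ji. b j * div_x (u j) x)) (at_right 0)"
    by (intro tendsto_sum tendsto_mult tendsto_const formal_limit_div_x[OF j x])
  moreover have "((\<lambda>\<epsilon>. \<epsilon> / dt * (rho (Yn \<epsilon>) x - rho (Z \<epsilon>) x)) \<longlongrightarrow> 0 / dt * (r x - r' x)) (at_right 0)"
    by (intro tendsto_mult tendsto_diff tendsto_divide tendsto_eps tendsto_const formal_limitD(3)[OF n x]
        formal_limitD(3)[OF z x]) (rule assms(2))
  moreover have "\<forall>\<^sub>F \<epsilon> in at_right 0. \<epsilon> / dt * (rho (Yn \<epsilon>) x - rho (Z \<epsilon>) x)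
      = (\<Sum>j\<in>Ji. b j * div_x (vel (Y \<epsilon> j)) x)"
    using upd eventually_eps_pos
  proof eventually_elim
    case (elim \<epsilon>)
    then have "rho (Z \<epsilon>) x = rho (Yn \<epsilon>) x - dt / \<epsilon> * (\<Sum>j\<in>Ji. b j * div_x (vel (Y \<epsilon> j)) x)"
      using x unfolding imex_update_def by blast
    then have "rho (Yn \<epsilon>) x - rho (Z \<epsilon>) x = dt / \<epsilon> * (\<Sum>j\<in>Ji. b j * div_x (vel (Y \<epsilon> j)) x)"
      by linarith
    then show ?case
      using elim(2) assms(2) by simp
  qed
  ultimately have "((\<lambda>\<epsilon>. \<Sum>j\<in>Ji. b j * div_x (vel (Y \<epsilon> j)) x) \<longlongrightarrow> 0 / dt * (r x - r' x)) (at_right 0)"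
    and "((\<lambda>\<epsilon>. \<Sum>j\<in>Ji. b j * div_x (vel (Y \<epsilon> j)) x) \<longlongrightarrow> (\<Sum>j\<in>Ji. b j * div_x (u j) x)) (at_right 0)"
    by (auto intro: Lim_transform_eventually)
  from tendsto_unique[OF _ this] show ?thesis by simp
qed

lemma grad_x_press_limit:
  assumes FL: "fields_limit D Y Y0 pt" and x: "x \<in> D"
  shows "((\<lambda>\<epsilon>. (1 / \<epsilon>) *\<^sub>R grad_x (\<lambda>y. temp (Y \<epsilon>) y + rho (Y \<epsilon>) y) x) \<longlongrightarrow> grad_x pt x) (at_right 0)"
proof -
  note FL = fields_limitD[OF FL]
  have "\<forall>\<^sub>F \<epsilon> in at_right 0. grad_x (\<lambda>y. press (Y \<epsilon>) y / \<epsilon>) x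
      = (1 / \<epsilon>) *\<^sub>R grad_x (\<lambda>y. temp (Y \<epsilon>) y + rho (Y \<epsilon>) y) x"
    using formal_limitD(1)[OF FL(1)] formal_limitD(1)[OF FL(4)]
  proof eventually_elim
    case (elim \<epsilon>)
    then have "(\<lambda>y. temp (Y \<epsilon>) y + rho (Y \<epsilon>) y) differentiable (at x)"
      using x by (intro differentiable_add) auto
    from grad_x_scale[OF this, of "1 / \<epsilon>"] show ?case
      by (simp add: press_def add.commute)
  qed
  with formal_limit_grad_x[OF FL(5) x] show ?thesis
    by (rule Lim_transform_eventually)
qed

lemma imex_update_limit_vel:
  fixes D :: "(real^'d::finite) set"
  assumes upd: "\<forall>\<^sub>F \<epsilon> in at_right 0. imex_update D \<tau> dt \<epsilon> Je bt Ji b (Yn \<epsilon>) (Y \<epsilon>) (Z \<epsilon>)"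
    and x: "x \<in> D"
    and n: "formal_limit D (\<lambda>\<epsilon>. vel (Yn \<epsilon>)) un" and z: "formal_limit D (\<lambda>\<epsilon>. vel (Z \<epsilon>)) u'"
    and j: "\<And>j. j \<in> Ji \<Longrightarrow> fields_limit D (\<lambda>\<epsilon>. Y \<epsilon> j) (Y0 j) (pt j)"
  shows "u' x = un x - dt *\<^sub>R (\<Sum>j\<in>Ji.
      b j *\<^sub>R div_tensor_x (\<lambda>y. vbracket (\<lambda>v. micro (Y0 j) y v *\<^sub>R calA v)) x + b j *\<^sub>R grad_x (pt j) x)"
    (is "_ = ?R")
proof -
  have "((\<lambda>\<epsilon>. vel (Yn \<epsilon>) x - dt *\<^sub>R (\<Sum>j\<in>Ji.
      b j *\<^sub>R div_tensor_x (\<lambda>y. vbracket (\<lambda>v. micro (Y \<epsilon> j) y v *\<^sub>R calA v)) x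
      + b j *\<^sub>R ((1 / \<epsilon>) *\<^sub>R grad_x (\<lambda>y. temp (Y \<epsilon> j) y + rho (Y \<epsilon> j) y) x))) \<longlongrightarrow> ?R) (at_right 0)"
  proof (intro tendsto_diff tendsto_scaleR tendsto_const tendsto_sum tendsto_add)
    show "((\<lambda>\<epsilon>. vel (Yn \<epsilon>) x) \<longlongrightarrow> un x) (at_right 0)"
      by (rule formal_limitD(3)[OF n x])
    fix j assume "j \<in> Ji"
    note FL = j[OF this]
    show "((\<lambda>\<epsilon>. div_tensor_x (\<lambda>y. vbracket (\<lambda>v. micro (Y \<epsilon> j) y v *\<^sub>R calA v)) x) \<longlongrightarrow>
        div_tensor_x (\<lambda>y. vbracket (\<lambda>v. micro (Y0 j) y v *\<^sub>R calA v)) x) (at_right 0)"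
      by (rule formal_limit_div_tensor_x[OF _ x]) (use fields_limitD(7)[OF FL] in \<open>simp add: moment_limit_def\<close>)
    show "((\<lambda>\<epsilon>. (1 / \<epsilon>) *\<^sub>R grad_x (\<lambda>y. temp (Y \<epsilon> j) y + rho (Y \<epsilon> j) y) x) \<longlongrightarrow> grad_x (pt j) x) (at_right 0)"
      by (rule grad_x_press_limit[OF FL x])
  qed
  moreover have "\<forall>\<^sub>F \<epsilon> in at_right 0. vel (Yn \<epsilon>) x - dt *\<^sub>R (\<Sum>j\<in>Ji.
      b j *\<^sub>R div_tensor_x (\<lambda>y. vbracket (\<lambda>v. micro (Y \<epsilon> j) y v *\<^sub>R calA v)) x
      + b j *\<^sub>R ((1 / \<epsilon>) *\<^sub>R grad_x (\<lambda>y. temp (Y \<epsilon> j) y + rho (Y \<epsilon> j) y) x)) = vel (Z \<epsilon>) x"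
    using upd
  proof eventually_elim
    case (elim \<epsilon>)
    then have "vel (Z \<epsilon>) x = vel (Yn \<epsilon>) x - dt *\<^sub>R (\<Sum>j\<in>Ji.
         b j *\<^sub>R div_tensor_x (\<lambda>y. vbracket (\<lambda>v. micro (Y \<epsilon> j) y v *\<^sub>R calA v)) x
         + (b j / \<epsilon>) *\<^sub>R grad_x (\<lambda>y. temp (Y \<epsilon> j) y + rho (Y \<epsilon> j) y) x)"
      using x unfolding imex_update_def by blast
    then show ?case by simp
  qed
  ultimately have "((\<lambda>\<epsilon>. vel (Z \<epsilon>) x) \<longlongrightarrow> ?R) (at_right 0)"
    by (rule Lim_transform_eventually)
  from tendsto_unique[OF _ formal_limitD(3)[OF z x] this] show ?thesis by simp
qed

text \<open>Multiplication by \<open>\<epsilon>\<^sup>2\<close> removes the time difference, so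
  relaxation balances the explicit terms. The balance concerns only the sum with the implicit
  weights.\<close>

lemma imex_update_limit_micro:
  assumes upd: "\<forall>\<^sub>F \<epsilon> in at_right 0. imex_update D \<tau> dt \<epsilon> Je bt Ji b (Yn \<epsilon>) (Y \<epsilon>) (Z \<epsilon>)"
    and "dt \<noteq> 0" and "\<tau> \<noteq> 0" and x: "x \<in> D"
    and n: "formal_limit D (\<lambda>\<epsilon> x. micro (Yn \<epsilon>) x v) gn" and z: "formal_limit D (\<lambda>\<epsilon> x. micro (Z \<epsilon>) x v) g'"
    and j: "\<And>j. j \<in> Ji \<Longrightarrow> formal_limit D (\<lambda>\<epsilon> x. micro (Y \<epsilon> j) x v) (g j)"
    and H: "\<And>j. j \<in> Je \<Longrightarrow> ((\<lambda>\<epsilon>. micro_rhs \<tau> \<epsilon> (Y \<epsilon> j) x v) \<longlongrightarrow> H j) (at_right 0)"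
  shows "(\<Sum>j\<in>Ji. b j * g j x) = - (\<Sum>j\<in>Je. bt j * (\<tau> * H j))"
proof -
  have "((\<lambda>\<epsilon>. dt * (\<Sum>j\<in>Je. bt j * micro_rhs \<tau> \<epsilon> (Y \<epsilon> j) x v) + dt / \<tau> * (\<Sum>j\<in>Ji. b j * micro (Y \<epsilon> j) x v))
      \<longlongrightarrow> dt * (\<Sum>j\<in>Je. bt j * H j) + dt / \<tau> * (\<Sum>j\<in>Ji. b j * g j x)) (at_right 0)"
    by (intro tendsto_add tendsto_mult tendsto_sum tendsto_const H formal_limitD(3)[OF j x])
  moreover have "((\<lambda>\<epsilon>. \<epsilon>\<^sup>2 * (micro (Yn \<epsilon>) x v - micro (Z \<epsilon>) x v)) \<longlongrightarrow> 0\<^sup>2 * (gn x - g' x)) (at_right 0)"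
    by (intro tendsto_mult tendsto_diff tendsto_power tendsto_eps formal_limitD(3)[OF n x]
        formal_limitD(3)[OF z x])
  moreover have "\<forall>\<^sub>F \<epsilon> in at_right 0. \<epsilon>\<^sup>2 * (micro (Yn \<epsilon>) x v - micro (Z \<epsilon>) x v)
      = dt * (\<Sum>j\<in>Je. bt j * micro_rhs \<tau> \<epsilon> (Y \<epsilon> j) x v) + dt / \<tau> * (\<Sum>j\<in>Ji. b j * micro (Y \<epsilon> j) x v)"
    using upd eventually_eps_pos
  proof eventually_elim
    case (elim \<epsilon>)
    define P where "P = (\<Sum>j\<in>Je. bt j * micro_rhs \<tau> \<epsilon> (Y \<epsilon> j) x v)"
    define G where "G = (\<Sum>j\<in>Ji. b j * micro (Y \<epsilon> j) x v)"
    have "micro (Z \<epsilon>) x v = micro (Yn \<epsilon>) x v - dt / \<epsilon>\<^sup>2 * P - dt / (\<epsilon>\<^sup>2 * \<tau>) * G"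
      using elim(1) x unfolding imex_update_def P_def G_def by blast
    then have "micro (Yn \<epsilon>) x v - micro (Z \<epsilon>) x v = (dt * P + dt / \<tau> * G) / \<epsilon>\<^sup>2"
      by (simp add: add_divide_distrib mult.commute)
    then show ?case
      using elim(2) by (simp add: P_def G_def)
  qed
  ultimately have "((\<lambda>\<epsilon>. dt * (\<Sum>j\<in>Je. bt j * micro_rhs \<tau> \<epsilon> (Y \<epsilon> j) x v) + dt / \<tau> * (\<Sum>j\<in>Ji. b j * micro (Y \<epsilon> j) x v))
      \<longlongrightarrow> 0\<^sup>2 * (gn x - g' x)) (at_right 0)"
    and "((\<lambda>\<epsilon>. dt * (\<Sum>j\<in>Je. bt j * micro_rhs \<tau> \<epsilon> (Y \<epsilon> j) x v) + dt / \<tau> * (\<Sum>j\<in>Ji. b j * micro (Y \<epsilon> j) x v))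
      \<longlongrightarrow> dt * (\<Sum>j\<in>Je. bt j * H j) + dt / \<tau> * (\<Sum>j\<in>Ji. b j * g j x)) (at_right 0)"
    by (auto intro: Lim_transform_eventually)
  from tendsto_unique[OF _ this] have "dt * (\<Sum>j\<in>Je. bt j * H j) + dt / \<tau> * (\<Sum>j\<in>Ji. b j * g j x) = 0"
    by simp
  then have "dt / \<tau> * (\<tau> * (\<Sum>j\<in>Je. bt j * H j) + (\<Sum>j\<in>Ji. b j * g j x)) = 0"
    using assms(3) by (simp add: distrib_left)
  then have "(\<Sum>j\<in>Ji. b j * g j x) = - (\<tau> * (\<Sum>j\<in>Je. bt j * H j))"
    using assms(2,3) by simp
  then show ?thesis
    by (simp add: sum_distrib_left mult.left_commute)
qed

text \<open>The limit of \<open>\<tau> Q\<close>, simplified with \<open>\<rho> = - T\<close>.\<close>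

definition Q_limit :: "real^'d::finite \<Rightarrow> real \<Rightarrow> real^'d \<Rightarrow> real" where
  "Q_limit u \<theta> v = 1 / 2 * ((v \<bullet> u)\<^sup>2 - (norm v)\<^sup>2 * (norm u)\<^sup>2 / real CARD('d))
       + 1 / 2 * ((v \<bullet> u) * ((norm v)\<^sup>2 - (real CARD('d) + 2)) * \<theta>)
       + \<theta>\<^sup>2 * (((norm v)\<^sup>2 - (real CARD('d) + 2))\<^sup>2 / 8 - 1 / 2 - real CARD('d) / 4)"

definition micro_rhs_limit ::
    "real \<Rightarrow> (real^'d::finite \<Rightarrow> real^'d) \<Rightarrow> (real^'d \<Rightarrow> real) \<Rightarrow> real^'d \<Rightarrow> real^'d \<Rightarrow> real" where
  "micro_rhs_limit \<tau> u \<theta> x v =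
     div_x (\<lambda>y. calA v *v u y + \<theta> y *\<^sub>R ((1 / 2) *\<^sub>R calB v)) x - 1 / \<tau> * Q_limit (u x) (\<theta> x) v"

lemma formal_limit_proj_P:
  fixes Y :: "real \<Rightarrow> 'd::finite fields"
  assumes D: "open D" and FL: "fields_limit D Y Y0 pt"
  shows "formal_limit D (\<lambda>\<epsilon> y. proj_P (\<lambda>w. w $ k * micro (Y \<epsilon>) y w) v) (\<lambda>y. proj_P (\<lambda>w. w $ k * micro Y0 y w) v)"
proof -
  note FL = fields_limitD[OF FL]
  \<comment> \<open>Applied to \<open>w $ k * g w\<close>, the projection needs moments of one more
    degree in \<open>w\<close>. They are components or rows of vector and tensor moments whose
    limits \<open>fields_limit\<close> provides.\<close>
  have eq: "proj_P (\<lambda>w. w $ k * g w) v = vbracket (\<lambda>w. g w *\<^sub>R w $ k)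
     + v \<bullet> vbracket (\<lambda>w. g w *\<^sub>R otimes w w $ k)
     + ((norm v)\<^sup>2 - real CARD('d)) / 2 * vbracket (\<lambda>w. g w *\<^sub>R ((((norm w)\<^sup>2 - real CARD('d)) / real CARD('d)) *\<^sub>R w) $ k)"
    for g :: "real^'d \<Rightarrow> real"
  proof -
    have "otimes w w $ k = w $ k *\<^sub>R w" for w :: "real^'d"
      by (simp add: otimes_def Finite_Cartesian_Product.vec_eq_iff)
    then show ?thesis
      by (simp add: proj_P_def mult_ac)
  qed
  show ?thesis
    unfolding eq
    by (intro formal_limit_add formal_limit_bounded_linear[OF bounded_linear_inner_right]
        formal_limit_bounded_linear[OF bounded_linear_mult_right]
        moment_limit_bounded_linear[OF D _ bounded_linear_vec_nth] FL)
qed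

lemma micro_rhs_tendsto:
  fixes Y :: "real \<Rightarrow> 'd::finite fields"
  assumes D: "open D" and FL: "fields_limit D Y Y0 pt" and x: "x \<in> D"
  shows "((\<lambda>\<epsilon>. micro_rhs \<tau> \<epsilon> (Y \<epsilon>) x v) \<longlongrightarrow> micro_rhs_limit \<tau> (vel Y0) (temp Y0) x v) (at_right 0)"
proof -
  note FL' = fields_limitD[OF FL]
  have "formal_limit D (\<lambda>\<epsilon> y. v $ k * micro (Y \<epsilon>) y v + - proj_P (\<lambda>w. w $ k * micro (Y \<epsilon>) y w) v)
      (\<lambda>y. v $ k * micro Y0 y v + - proj_P (\<lambda>w. w $ k * micro Y0 y w) v)" for k
    by (intro formal_limit_add formal_limit_bounded_linear[OF bounded_linear_mult_right] FL'(6)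
        formal_limit_bounded_linear[OF bounded_linear_minus[OF bounded_linear_ident]] formal_limit_proj_P[OF D FL])
  then have "formal_limit D (\<lambda>\<epsilon> y. \<chi> k. v $ k * micro (Y \<epsilon>) y v - proj_P (\<lambda>w. w $ k * micro (Y \<epsilon>) y w) v)
      (\<lambda>y. \<chi> k. v $ k * micro Y0 y v - proj_P (\<lambda>w. w $ k * micro Y0 y w) v)"
    by (intro formal_limit_vec_lambda) simp
  from formal_limit_eps_scaleR[OF this]
  have "formal_limit D (\<lambda>\<epsilon> y. calA v *v vel (Y \<epsilon>) y + temp (Y \<epsilon>) y *\<^sub>R ((1 / 2) *\<^sub>R calB v)
        + \<epsilon> *\<^sub>R (\<chi> k. v $ k * micro (Y \<epsilon>) y v - proj_P (\<lambda>w. w $ k * micro (Y \<epsilon>) y w) v))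
      (\<lambda>y. calA v *v vel Y0 y + temp Y0 y *\<^sub>R ((1 / 2) *\<^sub>R calB v) + 0)"
    by (intro formal_limit_add formal_limit_bounded_linear[OF matrix_vector_mul_bounded_linear]
        formal_limit_bounded_linear[OF bounded_linear_scaleR_left] FL')
  note rhs = formal_limit_div_x[OF this x]
  have "((\<lambda>\<epsilon>. Qterm \<tau> \<epsilon> (vel (Y \<epsilon>) x) (rho (Y \<epsilon>) x) (temp (Y \<epsilon>) x) v) \<longlongrightarrow>
      1 / \<tau> * Q_limit (vel Y0 x) (temp Y0 x) v) (at_right 0)"
    unfolding Q_limit_def
    by (rule Qterm_tendsto[OF formal_limitD(3)[OF FL'(2) x] formal_limitD(3)[OF FL'(1) x]
          formal_limitD(3)[OF FL'(4) x] press_limit_zero[OF FL x]])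
  from tendsto_diff[OF rhs this] show ?thesis
    by (simp only: micro_rhs_def micro_rhs_limit_def add_0_right)
qed

text \<open>The trace part of \<open>calA v\<close> contracts the velocity gradient to its
  divergence, which vanishes; the dyadic part yields the quadratic form of the gradient.\<close>

lemma div_x_calA_calB:
  fixes u :: "real^'d::finite \<Rightarrow> real^'d"
  assumes u: "u differentiable (at x)" and \<theta>: "\<theta> differentiable (at x)" and div: "div_x u x = 0"
  shows "div_x (\<lambda>y. calA v *v u y + \<theta> y *\<^sub>R ((1 / 2) *\<^sub>R calB v)) x
    = v \<bullet> ((\<chi> k l. partial_deriv k u x $ l) *v v) + ((1 / 2) *\<^sub>R grad_x \<theta> x) \<bullet> calB v"
proof -
  have "partial_deriv k (\<lambda>y. calA v *v u y + \<theta> y *\<^sub>R ((1 / 2) *\<^sub>R calB v)) x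
      = calA v *v partial_deriv k u x + partial_deriv k \<theta> x *\<^sub>R ((1 / 2) *\<^sub>R calB v)" for k
    by (simp only: partial_deriv_add[OF differentiable_bounded_linear[OF matrix_vector_mul_bounded_linear u]
          differentiable_bounded_linear[OF bounded_linear_scaleR_left \<theta>]]
        partial_deriv_bounded_linear[OF matrix_vector_mul_bounded_linear u]
        partial_deriv_bounded_linear[OF bounded_linear_scaleR_left \<theta>])
  then have "div_x (\<lambda>y. calA v *v u y + \<theta> y *\<^sub>R ((1 / 2) *\<^sub>R calB v)) x
      = (\<Sum>k\<in>UNIV. (calA v *v partial_deriv k u x) $ k) + (\<Sum>k\<in>UNIV. partial_deriv k \<theta> x * (1 / 2 * calB v $ k))"
    by (simp add: div_x_def sum.distrib)
  also have "(\<Sum>k\<in>UNIV. partial_deriv k \<theta> x * (1 / 2 * calB v $ k)) = ((1 / 2) *\<^sub>R grad_x \<theta> x) \<bullet> calB v"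
    by (simp add: inner_vec_def grad_x_def sum_distrib_left sum_divide_distrib)
  also have "(\<Sum>k\<in>UNIV. (calA v *v partial_deriv k u x) $ k)
      = (\<Sum>k\<in>UNIV. \<Sum>l\<in>UNIV. v $ k * v $ l * partial_deriv k u x $ l
          - (if k = l then (norm v)\<^sup>2 / real CARD('d) * partial_deriv k u x $ l else 0))"
    by (intro sum.cong refl) (simp add: matrix_vector_mult_def calA_nth left_diff_distrib if_distrib[of "\<lambda>z. z * _"] cong: if_cong)
  also have "\<dots> = v \<bullet> ((\<chi> k l. partial_deriv k u x $ l) *v v) - (norm v)\<^sup>2 / real CARD('d) * div_x u x"
    by (simp add: sum_subtractf inner_matrix_vector div_x_def sum_distrib_left sum_divide_distrib mult_ac)
  finally show ?thesis
    by (simp add: div)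
qed

text \<open>The matrix of the quadratic part of \<open>\<tau>\<close> times the limit of the stiff term, once \<open>\<nabla> \<cdot> u = 0\<close> and
  the radial part are split off.\<close>

definition flux_gradient :: "real \<Rightarrow> (real^'d::finite \<Rightarrow> real^'d) \<Rightarrow> real^'d \<Rightarrow> real^'d^'d" where
  "flux_gradient \<tau> u x = (\<chi> k l. \<tau> * partial_deriv k u x $ l - 1 / 2 * (u x $ k * u x $ l))"

lemma micro_rhs_limit_split:
  fixes u :: "real^'d::finite \<Rightarrow> real^'d"
  assumes u: "u differentiable (at x)" and \<theta>: "\<theta> differentiable (at x)" and div: "div_x u x = 0" and "\<tau> \<noteq> 0"
  obtains b r0 r1 r2 where
    "\<And>v. \<tau> * micro_rhs_limit \<tau> u \<theta> x v
      = v \<bullet> (flux_gradient \<tau> u x *v v) + b \<bullet> calB v + (r0 + r1 * (norm v)\<^sup>2 + r2 * ((norm v)\<^sup>2)\<^sup>2)"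
proof
  fix v :: "real^'d"
  let ?d = "real CARD('d)" and ?T = "\<theta> x" and ?u = "u x"
  define S where "S = v \<bullet> ((\<chi> k l. partial_deriv k u x $ l) *v v)"
  define V U w c where "V = (norm v)\<^sup>2" and "U = (norm ?u)\<^sup>2" and "w = v \<bullet> ?u" and "c = grad_x \<theta> x \<bullet> calB v"
  have flux: "v \<bullet> (flux_gradient \<tau> u x *v v) = \<tau> * S - 1 / 2 * w\<^sup>2"
  proof -
    have "w\<^sup>2 = (\<Sum>m\<in>UNIV. \<Sum>n\<in>UNIV. (v $ m * ?u $ m) * (v $ n * ?u $ n))"
      by (simp add: w_def inner_vec_def power2_eq_square sum_product)
    then show ?thesis
      unfolding inner_matrix_vector S_def flux_gradient_def
      by (simp add: left_diff_distrib right_diff_distrib sum_subtractf sum_distrib_left sum_divide_distrib mult_ac)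
  qed
  have B: "((\<tau> / 2) *\<^sub>R grad_x \<theta> x - (?T / 2) *\<^sub>R ?u) \<bullet> calB v = \<tau> / 2 * c - ?T / 2 * ((V - (?d + 2)) * w)"
  proof -
    have calB: "z \<bullet> calB v = (V - (?d + 2)) * (v \<bullet> z)" for z
      by (simp add: calB_def V_def inner_commute)
    have "K * (\<tau> / 2 * g - ?T / 2 * z) = \<tau> / 2 * (K * g) - ?T / 2 * (K * z)" for K g z
      by (simp add: algebra_simps)
    then show ?thesis
      by (simp only: c_def w_def calB inner_diff_right inner_scaleR_right)
  qed
  have "\<tau> * micro_rhs_limit \<tau> u \<theta> x v = \<tau> * (S + 1 / 2 * c) - Q_limit ?u ?T v"
    unfolding micro_rhs_limit_def div_x_calA_calB[OF u \<theta> div] S_def c_def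
    using \<open>\<tau> \<noteq> 0\<close> by (simp add: right_diff_distrib)
  moreover have "Q_limit ?u ?T v = 1 / 2 * (w\<^sup>2 - V * U / ?d) + 1 / 2 * (w * (V - (?d + 2)) * ?T)
      + ?T\<^sup>2 * ((V - (?d + 2))\<^sup>2 / 8 - 1 / 2 - ?d / 4)"
    by (simp add: Q_limit_def V_def U_def w_def)
  moreover have "\<tau> * (S + 1 / 2 * c) - (1 / 2 * (w\<^sup>2 - V * U / ?d) + 1 / 2 * (w * (V - (?d + 2)) * ?T)
      + ?T\<^sup>2 * ((V - (?d + 2))\<^sup>2 / 8 - 1 / 2 - ?d / 4))
    = (\<tau> * S - 1 / 2 * w\<^sup>2) + (\<tau> / 2 * c - ?T / 2 * ((V - (?d + 2)) * w))
      + (- ?T\<^sup>2 * ((?d + 2)\<^sup>2 / 8 - 1 / 2 - ?d / 4) + (U / (2 * ?d) + ?T\<^sup>2 * (?d + 2) / 4) * V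
         + (- ?T\<^sup>2 / 8) * V\<^sup>2)"
  proof -
    \<comment> \<open>\<open>z\<close> stands for \<open>U / ?d\<close> and \<open>e\<close> for the
      dimension, so that the identity has no division by a variable.\<close>
    have *: "\<tau> * (S + 1 / 2 * c) - (1 / 2 * (w\<^sup>2 - V * z) + 1 / 2 * (w * (V - (e + 2)) * t)
        + t\<^sup>2 * ((V - (e + 2))\<^sup>2 / 8 - 1 / 2 - e / 4))
      = (\<tau> * S - 1 / 2 * w\<^sup>2) + (\<tau> / 2 * c - t / 2 * ((V - (e + 2)) * w))
        + (- t\<^sup>2 * ((e + 2)\<^sup>2 / 8 - 1 / 2 - e / 4) + (z / 2 + t\<^sup>2 * (e + 2) / 4) * V + (- t\<^sup>2 / 8) * V\<^sup>2)"
      for z e t :: real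
      by (simp add: field_simps power2_eq_square)
    have "V * U / ?d = V * (U / ?d)" "U / (2 * ?d) = (U / ?d) / 2"
      by simp_all
    then show ?thesis
      by (simp only: *)
  qed
  \<comment> \<open>The witnesses are fixed here. \<open>b\<close> joins the temperature gradient
    from transport to a multiple of \<open>u x\<close> from the mixed term of
    \<open>Q_limit\<close>; the radial coefficients collect the term with
    \<open>(norm (u x))\<^sup>2\<close> and the expanded square of
    \<open>(norm v)\<^sup>2 - (?d + 2)\<close>.\<close>
  ultimately show "\<tau> * micro_rhs_limit \<tau> u \<theta> x v
      = v \<bullet> (flux_gradient \<tau> u x *v v) + ((\<tau> / 2) *\<^sub>R grad_x \<theta> x - (?T / 2) *\<^sub>R ?u) \<bullet> calB v
        + (- ?T\<^sup>2 * ((?d + 2)\<^sup>2 / 8 - 1 / 2 - ?d / 4)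
           + ((norm ?u)\<^sup>2 / (2 * ?d) + ?T\<^sup>2 * (?d + 2) / 4) * (norm v)\<^sup>2 + (- ?T\<^sup>2 / 8) * ((norm v)\<^sup>2)\<^sup>2)"
    by (simp only: flux B V_def[symmetric] U_def[symmetric])
qed

lemma integrable_maxwellian_calA_split:
  fixes G :: "real^'d::finite^'d"
  shows "integrable lborel (\<lambda>v. maxwellian v *\<^sub>R
    ((v \<bullet> (G *v v) + b \<bullet> calB v + (r0 + r1 * (norm v)\<^sup>2 + r2 * ((norm v)\<^sup>2)\<^sup>2)) *\<^sub>R calA v))"
  unfolding inner_matrix_vector
  by (intro integrable_maxwellian_polynomial polynomial_function_scaleR_calA real_polynomial_function.intros(2-4)
      real_polynomial_function_sum real_polynomial_function_nth finite real_polynomial_function_inner_calB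
      real_polynomial_function_norm_sq real_polynomial_function_power)

text \<open>Viscous stress minus \<open>calA (u x)\<close>, the traceless part of
  \<open>otimes (u x) (u x)\<close>. The factor \<open>- 1\<close> in place of a subtraction suits
  the rules for sums and multiples of tensor fields.\<close>

definition momentum_flux :: "real \<Rightarrow> (real^'d::finite \<Rightarrow> real^'d) \<Rightarrow> real^'d \<Rightarrow> real^'d^'d" where
  "momentum_flux \<tau> u x = \<tau> *\<^sub>R (\<chi> k l. partial_deriv k u x $ l + partial_deriv l u x $ k)
     + (- 1) *\<^sub>R otimes (u x) (u x) + ((norm (u x))\<^sup>2 / real CARD('d)) *\<^sub>R Finite_Cartesian_Product.mat 1"

lemma vbracket_micro_rhs_limit_calA:
  fixes u :: "real^'d::finite \<Rightarrow> real^'d"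
  assumes "u differentiable (at x)" "\<theta> differentiable (at x)" and div: "div_x u x = 0" and "\<tau> \<noteq> 0"
  shows "integrable lborel (\<lambda>v. maxwellian v *\<^sub>R ((\<tau> * micro_rhs_limit \<tau> u \<theta> x v) *\<^sub>R calA v))"
    and "vbracket (\<lambda>v. (\<tau> * micro_rhs_limit \<tau> u \<theta> x v) *\<^sub>R calA v) = momentum_flux \<tau> u x"
proof -
  obtain b r0 r1 r2 where eq: "\<And>v. \<tau> * micro_rhs_limit \<tau> u \<theta> x v
      = v \<bullet> (flux_gradient \<tau> u x *v v) + b \<bullet> calB v + (r0 + r1 * (norm v)\<^sup>2 + r2 * ((norm v)\<^sup>2)\<^sup>2)"
    by (rule micro_rhs_limit_split[OF assms]) blast
  show "integrable lborel (\<lambda>v. maxwellian v *\<^sub>R ((\<tau> * micro_rhs_limit \<tau> u \<theta> x v) *\<^sub>R calA v))"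
    unfolding eq by (rule integrable_maxwellian_calA_split)
  \<comment> \<open>Incompressibility removes the viscous part of the trace. The factor
    \<open>- 2 / d\<close> of the moment formula then makes the diagonal term
    \<open>(norm (u x))\<^sup>2 / d\<close>.\<close>
  have tr: "(\<Sum>i\<in>UNIV. flux_gradient \<tau> u x $ i $ i) = - ((norm (u x))\<^sup>2 / 2)"
  proof -
    have "(\<Sum>i\<in>UNIV. flux_gradient \<tau> u x $ i $ i) = \<tau> * div_x u x - (norm (u x))\<^sup>2 / 2"
    proof -
      have norm: "(norm (u x))\<^sup>2 / 2 = (\<Sum>i\<in>UNIV. u x $ i * u x $ i / 2)"
        unfolding norm_vec_power2 by (simp add: sum_divide_distrib power2_eq_square)
      show ?thesis
        unfolding norm by (simp add: flux_gradient_def sum_subtractf div_x_def sum_distrib_left)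
    qed
    then show ?thesis by (simp add: div)
  qed
  show "vbracket (\<lambda>v. (\<tau> * micro_rhs_limit \<tau> u \<theta> x v) *\<^sub>R calA v) = momentum_flux \<tau> u x"
    unfolding eq vbracket_calA_split tr
    by (simp add: Finite_Cartesian_Product.vec_eq_iff momentum_flux_def flux_gradient_def otimes_def
        Finite_Cartesian_Product.transpose_def Finite_Cartesian_Product.mat_def distrib_left mult.commute)
qed

lemma div_tensor_x_momentum_flux:
  fixes u :: "real^'d::finite \<Rightarrow> real^'d"
  assumes D: "open D" "x \<in> D" and C2: "C2_on D u" and div: "\<And>y. y \<in> D \<Longrightarrow> div_x u y = 0"
  shows "momentum_flux \<tau> u differentiable (at x)"
    and "div_tensor_x (momentum_flux \<tau> u) x
      = \<tau> *\<^sub>R laplacian_x u x - convect_x u u x + grad_x (\<lambda>y. (norm (u y))\<^sup>2 / real CARD('d)) x"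
proof -
  have u: "u differentiable (at x)" and pu: "\<And>k. partial_deriv k u differentiable (at x)"
    using C2 D by (auto simp: C2_on_def)
  have \<phi>: "(\<lambda>y. (norm (u y))\<^sup>2 / real CARD('d)) differentiable (at x)"
    using differentiable_bounded_linear[OF bounded_linear_divide differentiable_norm_sq[OF u]] .
  note strain = differentiable_strain[OF pu] and tensor = differentiable_otimes[OF u u]
  have d1: "(\<lambda>y. \<tau> *\<^sub>R (\<chi> k l. partial_deriv k u y $ l + partial_deriv l u y $ k)) differentiable (at x)"
    by (rule differentiable_bounded_linear[OF bounded_linear_scaleR_right strain])
  have d2: "(\<lambda>y. (- 1) *\<^sub>R otimes (u y) (u y)) differentiable (at x)"
    by (rule differentiable_bounded_linear[OF bounded_linear_scaleR_right tensor])
  have d3: "(\<lambda>y. ((norm (u y))\<^sup>2 / real CARD('d)) *\<^sub>R (Finite_Cartesian_Product.mat 1 :: real^'d^'d)) differentiable (at x)"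
    by (rule differentiable_bounded_linear[OF bounded_linear_scaleR_left \<phi>])
  show "momentum_flux \<tau> u differentiable (at x)"
    unfolding momentum_flux_def[abs_def] by (intro differentiable_add d1 d2 d3)
  have "div_tensor_x (\<lambda>y. \<chi> k l. partial_deriv k u y $ l + partial_deriv l u y $ k) x = laplacian_x u x"
    by (rule div_tensor_x_strain[OF D C2]) (rule div)
  then show "div_tensor_x (momentum_flux \<tau> u) x
      = \<tau> *\<^sub>R laplacian_x u x - convect_x u u x + grad_x (\<lambda>y. (norm (u y))\<^sup>2 / real CARD('d)) x"
    unfolding momentum_flux_def[abs_def]
      div_tensor_x_add[OF differentiable_add[OF d1 d2] d3] div_tensor_x_add[OF d1 d2]
      div_tensor_x_scaleR[OF strain] div_tensor_x_scaleR[OF tensor]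
      div_tensor_x_otimes[OF u div[OF D(2)]] div_tensor_x_scalar[OF \<phi>]
    by simp
qed

section \<open>Stress and momentum balance in the limit\<close>

lemma vbracket_sum:
  assumes "\<And>j. j \<in> J \<Longrightarrow> integrable lborel (\<lambda>v. maxwellian v *\<^sub>R f j v)"
  shows "vbracket (\<lambda>v. \<Sum>j\<in>J. c j *\<^sub>R f j v) = (\<Sum>j\<in>J. c j *\<^sub>R vbracket (f j))"
proof -
  have eq: "maxwellian v *\<^sub>R (\<Sum>j\<in>J. c j *\<^sub>R f j v) = (\<Sum>j\<in>J. c j *\<^sub>R (maxwellian v *\<^sub>R f j v))" for v
    by (simp add: scaleR_sum_right mult.commute)
  show ?thesis
    unfolding vbracket_def eq
    by (subst Bochner_Integration.integral_sum) (simp_all add: assms integrable_scaleR_right del: scaleR_scaleR)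
qed

text \<open>The balance for the weighted \<open>g\<close> holds for every \<open>v\<close> and can
  be integrated against \<open>calA\<close>. Splitting the integrals needs integrable summands: on
  the implicit side by \<open>moment_limit\<close>, on the explicit side because they are
  polynomials in \<open>v\<close>.\<close>

lemma imex_update_limit_stress:
  fixes D :: "(real^'d::finite) set"
  assumes D: "open D" and "dt \<noteq> 0" and "\<tau> \<noteq> 0"
    and upd: "\<forall>\<^sub>F \<epsilon> in at_right 0. imex_update D \<tau> dt \<epsilon> Je bt Ji b (Yn \<epsilon>) (Y \<epsilon>) (Z \<epsilon>)"
    and n: "fields_limit D Yn Yn0 ptn" and z: "fields_limit D Z Z0 ptz"
    and j: "\<And>j. j \<in> Je \<union> Ji \<Longrightarrow> fields_limit D (\<lambda>\<epsilon>. Y \<epsilon> j) (Y0 j) (pt j)"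
    and div: "\<And>j y. j \<in> Je \<Longrightarrow> y \<in> D \<Longrightarrow> div_x (vel (Y0 j)) y = 0"
    and x: "x \<in> D"
  shows "(\<Sum>j\<in>Ji. b j *\<^sub>R vbracket (\<lambda>v. micro (Y0 j) x v *\<^sub>R calA v))
    = (\<Sum>j\<in>Je. (- bt j) *\<^sub>R momentum_flux \<tau> (vel (Y0 j)) x)"
proof -
  have u: "vel (Y0 j) differentiable (at x)" and \<theta>: "temp (Y0 j) differentiable (at x)" if "j \<in> Je" for j
    using that by (auto intro!: formal_limitD(2)[OF _ x] fields_limitD(2,4)[OF j])
  note H = vbracket_micro_rhs_limit_calA[OF u \<theta> div[OF _ x] \<open>\<tau> \<noteq> 0\<close>]
  have int: "integrable lborel (\<lambda>v. maxwellian v *\<^sub>R (micro (Y0 j) x v *\<^sub>R calA v))" if "j \<in> Ji" for j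
    using fields_limitD(7)[OF j, of j] that x unfolding moment_limit_def by blast
  have eq: "(\<Sum>j\<in>Ji. b j *\<^sub>R (micro (Y0 j) x v *\<^sub>R calA v))
      = (\<Sum>j\<in>Je. (- bt j) *\<^sub>R ((\<tau> * micro_rhs_limit \<tau> (vel (Y0 j)) (temp (Y0 j)) x v) *\<^sub>R calA v))" for v
  proof -
    have "(\<Sum>j\<in>Ji. b j * micro (Y0 j) x v)
        = - (\<Sum>j\<in>Je. bt j * (\<tau> * micro_rhs_limit \<tau> (vel (Y0 j)) (temp (Y0 j)) x v))"
      by (rule imex_update_limit_micro[OF upd \<open>dt \<noteq> 0\<close> \<open>\<tau> \<noteq> 0\<close> x fields_limitD(6)[OF n] fields_limitD(6)[OF z]])
        (auto intro!: fields_limitD(6)[OF j] micro_rhs_tendsto[OF D j x])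
    then show ?thesis
      by (simp only: scaleR_scaleR scaleR_sum_left[symmetric] sum_negf mult_minus_left)
  qed
  have "(\<Sum>j\<in>Ji. b j *\<^sub>R vbracket (\<lambda>v. micro (Y0 j) x v *\<^sub>R calA v))
      = vbracket (\<lambda>v. \<Sum>j\<in>Ji. b j *\<^sub>R (micro (Y0 j) x v *\<^sub>R calA v))"
    by (rule vbracket_sum[symmetric]) (rule int)
  also have "\<dots> = (\<Sum>j\<in>Je. (- bt j) *\<^sub>R
      vbracket (\<lambda>v. (\<tau> * micro_rhs_limit \<tau> (vel (Y0 j)) (temp (Y0 j)) x v) *\<^sub>R calA v))"
    unfolding eq by (rule vbracket_sum) (rule H(1))
  also have "\<dots> = (\<Sum>j\<in>Je. (- bt j) *\<^sub>R momentum_flux \<tau> (vel (Y0 j)) x)"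
    by (intro sum.cong refl) (simp only: H(2))
  finally show ?thesis .
qed

lemma imex_update_limit_momentum:
  fixes D :: "(real^'d::finite) set"
  assumes D: "open D" and "dt \<noteq> 0" and "\<tau> \<noteq> 0"
    and upd: "\<forall>\<^sub>F \<epsilon> in at_right 0. imex_update D \<tau> dt \<epsilon> Je bt Ji b (Yn \<epsilon>) (Y \<epsilon>) (Z \<epsilon>)"
    and n: "fields_limit D Yn Yn0 ptn" and z: "fields_limit D Z Z0 ptz"
    and j: "\<And>j. j \<in> Je \<union> Ji \<Longrightarrow> fields_limit D (\<lambda>\<epsilon>. Y \<epsilon> j) (Y0 j) (pt j)"
    and div: "\<And>j y. j \<in> Je \<Longrightarrow> y \<in> D \<Longrightarrow> div_x (vel (Y0 j)) y = 0"
    and x: "x \<in> D"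
  shows "vel Z0 x = vel Yn0 x
    + dt *\<^sub>R (\<Sum>j\<in>Je. bt j *\<^sub>R (\<tau> *\<^sub>R laplacian_x (vel (Y0 j)) x - convect_x (vel (Y0 j)) (vel (Y0 j)) x))
    - dt *\<^sub>R ((\<Sum>j\<in>Ji. b j *\<^sub>R grad_x (pt j) x)
        - (\<Sum>j\<in>Je. bt j *\<^sub>R grad_x (\<lambda>y. (norm (vel (Y0 j) y))\<^sup>2 / real CARD('d)) x))"
proof -
  let ?S = "\<lambda>j y. vbracket (\<lambda>v. micro (Y0 j) y v *\<^sub>R calA v)"
  have S: "?S j differentiable (at x)" if "j \<in> Ji" for j
  proof -
    have "formal_limit D (\<lambda>\<epsilon> y. vbracket (\<lambda>v. micro (Y \<epsilon> j) y v *\<^sub>R calA v)) (?S j)"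
      using fields_limitD(7)[OF j, of j] that unfolding moment_limit_def by blast
    then show ?thesis using x by (rule formal_limitD(2))
  qed
  have flux: "momentum_flux \<tau> (vel (Y0 j)) differentiable (at x)"
    "div_tensor_x (momentum_flux \<tau> (vel (Y0 j))) x = \<tau> *\<^sub>R laplacian_x (vel (Y0 j)) x
      - convect_x (vel (Y0 j)) (vel (Y0 j)) x + grad_x (\<lambda>y. (norm (vel (Y0 j) y))\<^sup>2 / real CARD('d)) x"
    if "j \<in> Je" for j
    using that by (auto intro!: div_tensor_x_momentum_flux[OF D x] fields_limitD(3)[OF j] div)
  have "(\<Sum>j\<in>Ji. b j *\<^sub>R div_tensor_x (?S j) x) = div_tensor_x (\<lambda>y. \<Sum>j\<in>Ji. b j *\<^sub>R ?S j y) x"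
    using S by (subst div_tensor_x_sum)
      (auto simp: div_tensor_x_scaleR intro!: sum.cong differentiable_bounded_linear[OF bounded_linear_scaleR_right])
  \<comment> \<open>The stress identity holds at every point of the open set \<open>D\<close>, so it
    may be differentiated.\<close>
  also have "\<dots> = div_tensor_x (\<lambda>y. \<Sum>j\<in>Je. (- bt j) *\<^sub>R momentum_flux \<tau> (vel (Y0 j)) y) x"
    by (rule div_tensor_x_cong_open[OF D x])
      (rule imex_update_limit_stress[OF D \<open>dt \<noteq> 0\<close> \<open>\<tau> \<noteq> 0\<close> upd n z j div])
  also have "\<dots> = (\<Sum>j\<in>Je. (- bt j) *\<^sub>R div_tensor_x (momentum_flux \<tau> (vel (Y0 j))) x)"
    using flux(1) by (subst div_tensor_x_sum)
      (auto simp: div_tensor_x_scaleR simp del: scaleR_minus_left intro!: sum.cong differentiable_bounded_linear[OF bounded_linear_scaleR_right])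
  also have "\<dots> = - (\<Sum>j\<in>Je. bt j *\<^sub>R (\<tau> *\<^sub>R laplacian_x (vel (Y0 j)) x - convect_x (vel (Y0 j)) (vel (Y0 j)) x))
      - (\<Sum>j\<in>Je. bt j *\<^sub>R grad_x (\<lambda>y. (norm (vel (Y0 j) y))\<^sup>2 / real CARD('d)) x)"
    by (simp add: flux(2) scaleR_add_right sum.distrib sum_negf sum_subtractf)
  finally have stress: "(\<Sum>j\<in>Ji. b j *\<^sub>R div_tensor_x (?S j) x) = \<dots>" .
  have "vel Z0 x = vel Yn0 x - dt *\<^sub>R (\<Sum>j\<in>Ji. b j *\<^sub>R div_tensor_x (?S j) x + b j *\<^sub>R grad_x (pt j) x)"
    by (rule imex_update_limit_vel[OF upd x fields_limitD(2)[OF n] fields_limitD(2)[OF z]]) (rule j, simp)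
  then show ?thesis
    unfolding sum.distrib stress by (simp add: algebra_simps)
qed

section \<open>Identification of the new value with the last stage\<close>

definition same_fields_on :: "(real^'d::finite) set \<Rightarrow> 'd fields \<Rightarrow> 'd fields \<Rightarrow> bool" where
  "same_fields_on D Y Z \<longleftrightarrow>
     (\<forall>x\<in>D. rho Y x = rho Z x \<and> vel Y x = vel Z x \<and> temp Y x = temp Z x \<and> micro Y x = micro Z x)"

text \<open>With the stages \<open>Y\<close> held fixed, each line of \<open>imex_update\<close> is
  a formula for \<open>Z\<close> on \<open>D\<close>. The last stage also occurs among the
  \<open>Y\<close>, but both candidates are compared with the same \<open>Y\<close>, so no implicit
  equation has to be solved.\<close>

lemma imex_update_unique:
  assumes "imex_update D \<tau> dt \<epsilon> Je bt Ji b Yn Y Z" "imex_update D \<tau> dt \<epsilon> Je bt Ji b Yn Y Z'"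
  shows "same_fields_on D Z Z'"
  using assms unfolding imex_update_def same_fields_on_def fun_eq_iff by simp

lemma moment_limit_cong:
  assumes D: "open D" and lim: "moment_limit D \<phi> Y Y0"
    and same: "\<forall>\<^sub>F \<epsilon> in at_right 0. same_fields_on D (Y \<epsilon>) (Z \<epsilon>)"
  shows "moment_limit D \<phi> Z Y0"
  unfolding moment_limit_def
proof (intro conjI)
  have "\<forall>\<^sub>F \<epsilon> in at_right 0. \<forall>x\<in>D. integrable lborel (\<lambda>v. maxwellian v *\<^sub>R (micro (Y \<epsilon>) x v *\<^sub>R \<phi> v))"
    using lim by (simp only: moment_limit_def)
  with same show "\<forall>\<^sub>F \<epsilon> in at_right 0. \<forall>x\<in>D. integrable lborel (\<lambda>v. maxwellian v *\<^sub>R (micro (Z \<epsilon>) x v *\<^sub>R \<phi> v))"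
    by eventually_elim (simp add: same_fields_on_def)
  show "\<forall>x\<in>D. integrable lborel (\<lambda>v. maxwellian v *\<^sub>R (micro Y0 x v *\<^sub>R \<phi> v))"
    using lim unfolding moment_limit_def by blast
  have "formal_limit D (\<lambda>\<epsilon> x. vbracket (\<lambda>v. micro (Y \<epsilon>) x v *\<^sub>R \<phi> v)) (\<lambda>x. vbracket (\<lambda>v. micro Y0 x v *\<^sub>R \<phi> v))"
    using lim by (simp only: moment_limit_def)
  then show "formal_limit D (\<lambda>\<epsilon> x. vbracket (\<lambda>v. micro (Z \<epsilon>) x v *\<^sub>R \<phi> v)) (\<lambda>x. vbracket (\<lambda>v. micro Y0 x v *\<^sub>R \<phi> v))"
    by (rule formal_limit_cong[OF D])
      (use same in \<open>eventually_elim, simp add: same_fields_on_def\<close>, rule refl)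
qed

lemma fields_limit_cong:
  assumes D: "open D" and FL: "fields_limit D Y Y0 pt"
    and same: "\<forall>\<^sub>F \<epsilon> in at_right 0. same_fields_on D (Y \<epsilon>) (Z \<epsilon>)"
  shows "fields_limit D Z Y0 pt"
proof -
  have ev: "\<forall>\<^sub>F \<epsilon> in at_right 0. \<forall>x\<in>D. rho (Y \<epsilon>) x = rho (Z \<epsilon>) x"
    "\<forall>\<^sub>F \<epsilon> in at_right 0. \<forall>x\<in>D. vel (Y \<epsilon>) x = vel (Z \<epsilon>) x"
    "\<forall>\<^sub>F \<epsilon> in at_right 0. \<forall>x\<in>D. temp (Y \<epsilon>) x = temp (Z \<epsilon>) x"
    "\<forall>\<^sub>F \<epsilon> in at_right 0. \<forall>x\<in>D. press (Y \<epsilon>) x / \<epsilon> = press (Z \<epsilon>) x / \<epsilon>"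
    "\<And>v. \<forall>\<^sub>F \<epsilon> in at_right 0. \<forall>x\<in>D. micro (Y \<epsilon>) x v = micro (Z \<epsilon>) x v"
    using same by (eventually_elim, simp add: same_fields_on_def press_def)+
  note cong = formal_limit_cong[OF D _ _ refl]
  show ?thesis
    using FL unfolding fields_limit_def
    by (intro conjI allI) (blast intro: cong[OF _ ev(1)] cong[OF _ ev(2)] cong[OF _ ev(3)] cong[OF _ ev(4)]
        cong[OF _ ev(5)] moment_limit_cong[OF D _ same])+
qed

text \<open>Bridges the two ranges of the explicit sum: up to \<open>s\<close> in the final update,
  up to \<open>s - 1\<close> in the last stage. The extra coefficient is
  \<open>wt s = 0\<close>.\<close>

lemma imex_update_coefficients_cong:
  assumes "finite Je" "Je' \<subseteq> Je" and bt: "\<And>j. j \<in> Je' \<Longrightarrow> bt j = bt' j" "\<And>j. j \<in> Je - Je' \<Longrightarrow> bt j = 0"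
    and b: "\<And>j. j \<in> Ji \<Longrightarrow> b j = b' j"
  shows "imex_update D \<tau> dt \<epsilon> Je bt Ji b Yn Y Z \<longleftrightarrow> imex_update D \<tau> dt \<epsilon> Je' bt' Ji b' Yn Y Z"
proof -
  have "(\<Sum>j\<in>Je. bt j * f j) = (\<Sum>j\<in>Je'. bt' j * f j)" for f :: "nat \<Rightarrow> real"
  proof -
    have "(\<Sum>j\<in>Je. bt j * f j) = (\<Sum>j\<in>Je'. bt j * f j)"
      using assms(1,2) bt(2) by (intro sum.mono_neutral_right) auto
    also have "\<dots> = (\<Sum>j\<in>Je'. bt' j * f j)"
      by (intro sum.cong refl) (simp add: bt(1))
    finally show ?thesis .
  qed
  then show ?thesis
    unfolding imex_update_def by (simp only: b cong: sum.cong)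
qed

section \<open>Assembly of the limit scheme\<close>

theorem theorem4p5:
  fixes D :: "(real^'d::finite) set"
    and \<tau> dt :: real and s :: nat
    and At A :: "nat \<Rightarrow> nat \<Rightarrow> real" and wt w :: "nat \<Rightarrow> real"
    and Yn Yn1 :: "real \<Rightarrow> 'd fields" and Y :: "real \<Rightarrow> nat \<Rightarrow> 'd fields"
    and Yn0 :: "'d fields" and Y0 :: "nat \<Rightarrow> 'd fields"
    and ptn :: "real^'d \<Rightarrow> real" and pt :: "nat \<Rightarrow> real^'d \<Rightarrow> real"
  assumes "CARD('d) \<in> {1, 2, 3}" and "open D" and "\<tau> > 0" and "dt > 0" and "s \<ge> 1"
    and "imex_tableaux s At A" and "type_CK s A" and "GSA s At wt A w"
    and "\<forall>\<^sub>F \<epsilon> in at_right 0. bgk_imex_step D \<tau> dt s At wt A w \<epsilon> (Yn \<epsilon>) (Y \<epsilon>) (Yn1 \<epsilon>)"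
    and "\<forall>\<^sub>F \<epsilon> in at_right 0. \<forall>x\<in>D. div_x (vel (Yn \<epsilon>)) x = 0"
    and "fields_limit D Yn Yn0 ptn"
    and "\<And>i. i \<in> {1..s} \<Longrightarrow> fields_limit D (\<lambda>\<epsilon>. Y \<epsilon> i) (Y0 i) (pt i)"
  shows "(\<exists>q c.
           (\<forall>j\<in>{1..s}. \<forall>x\<in>D. q j x = pt j x
              + (\<Sum>k\<in>{1..s}. c j k * ((norm (vel (Y0 k) x))\<^sup>2 / real CARD('d)))) \<and>
           ns_imex_stages D \<tau> dt s At A (vel Yn0) (\<lambda>i. vel (Y0 i)) q)
         \<and> fields_limit D Yn1 (Y0 s) (pt s)"
proof -
  note D = \<open>open D\<close> and s = \<open>s \<ge> 1\<close> and CK = \<open>type_CK s A\<close>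
    and step = assms(9) and div_n = assms(10) and FLn = assms(11) and FL = assms(12)
  have nz: "dt \<noteq> 0" "\<tau> \<noteq> 0"
    using \<open>dt > 0\<close> \<open>\<tau> > 0\<close> by auto
  have triA: "A i j = 0" if "i \<in> {1..s}" "j \<in> {1..s}" "i < j" for i j
    using assms(6) that unfolding imex_tableaux_def by blast
  have triAt: "At i j = 0" if "i \<in> {1..s}" "j \<in> {1..s}" "i \<le> j" for i j
    using assms(6) that unfolding imex_tableaux_def by blast
  have A1: "A 1 j = 0" if "j \<in> {1..s}" for j
    using CK that unfolding type_CK_def by blast
  have upd: "\<forall>\<^sub>F \<epsilon> in at_right 0. imex_update D \<tau> dt \<epsilon> {1..<i} (At i) {1..i} (A i) (Yn \<epsilon>) (Y \<epsilon>) (Y \<epsilon> i)"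
    if "i \<in> {1..s}" for i
    using step by eventually_elim (use that in \<open>simp add: bgk_imex_step_def\<close>)
  have FLi: "fields_limit D (\<lambda>\<epsilon>. Y \<epsilon> j) (Y0 j) (pt j)" if "i \<in> {1..s}" "j \<in> {1..<i} \<union> {1..i}" for i j
    using that by (intro FL) auto
  have div: "div_x (vel (Y0 j)) y = 0" if "j \<in> {1..s}" "y \<in> D" for j y
  proof (rule type_CK_kernel[OF CK s _ _ \<open>j \<in> {1..s}\<close>])
    have 1: "1 \<in> {1..s}" using s by simp
    have "\<forall>\<^sub>F \<epsilon> in at_right 0. div_x (vel (Y \<epsilon> 1)) y = 0"
      using upd[OF 1] div_n
    proof eventually_elim
      case (elim \<epsilon>)
      \<comment> \<open>The explicit sum of stage 1 is empty and its implicit row is zero, so its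
        velocity is the initial one for each such \<epsilon>, before any limit.\<close>
      have "vel (Y \<epsilon> 1) x = vel (Yn \<epsilon>) x" if "x \<in> D" for x
        using elim(1) that A1[OF 1] by (simp add: imex_update_def)
      then have "div_x (vel (Y \<epsilon> 1)) y = div_x (vel (Yn \<epsilon>)) y"
        using partial_deriv_cong_open[OF D \<open>y \<in> D\<close>, of "vel (Y \<epsilon> 1)" "vel (Yn \<epsilon>)"] by (simp add: div_x_def)
      then show ?case using elim(2) \<open>y \<in> D\<close> by simp
    qed
    then have "((\<lambda>\<epsilon>. div_x (vel (Y \<epsilon> 1)) y) \<longlongrightarrow> 0) (at_right 0)"
      by (rule tendsto_eventually)
    then show "div_x (vel (Y0 1)) y = 0"
      using tendsto_unique[OF _ formal_limit_div_x[OF fields_limitD(2)[OF FL[OF 1]] \<open>y \<in> D\<close>]] by simp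
    fix i assume i: "i \<in> {1..s}"
    have "(\<Sum>j\<in>{1..s}. A i j * div_x (vel (Y0 j)) y) = (\<Sum>j\<in>{1..i}. A i j * div_x (vel (Y0 j)) y)"
      using i triA[OF i] by (intro sum.mono_neutral_right) auto
    also have "\<dots> = 0"
      by (rule imex_update_limit_div[OF upd[OF i] nz(1) \<open>y \<in> D\<close> fields_limitD(1)[OF FLn]
            fields_limitD(1)[OF FL[OF i]]])
        (rule fields_limitD(2)[OF FLi[OF i]], simp)
    finally show "(\<Sum>j\<in>{1..s}. A i j * div_x (vel (Y0 j)) y) = 0" .
  qed
  \<comment> \<open>Row 1 is consistent because \<open>At\<close> is strictly lower
    triangular.\<close>
  obtain c where c: "\<And>i k. i \<in> {1..s} \<Longrightarrow> k \<in> {1..s} \<Longrightarrow> (\<Sum>j\<in>{1..s}. A i j * c j k) = - At i k"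
    using type_CK_solve[OF CK s, of "\<lambda>i k. - At i k"] triAt[of 1] s by auto
  define \<phi> where "\<phi> k x = (norm (vel (Y0 k) x))\<^sup>2 / real CARD('d)" for k x
  \<comment> \<open>By the choice of \<open>c\<close>, implicit weights on the correction amount to
    weights \<open>- At i k\<close> on the gradients of \<open>\<phi> k\<close>, which is what the
    momentum limit contains beside the gradients of \<open>pt\<close>.\<close>
  define q where "q j x = pt j x + (\<Sum>k\<in>{1..s}. c j k * \<phi> k x)" for j x
  have \<phi>_diff: "\<phi> k differentiable (at x)" if "k \<in> {1..s}" "x \<in> D" for k x
    unfolding \<phi>_def[abs_def]
    by (rule differentiable_bounded_linear[OF bounded_linear_divide differentiable_norm_sq])
      (rule formal_limitD(2)[OF fields_limitD(2)[OF FL] \<open>x \<in> D\<close>], rule that)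
  have pt_diff: "pt j differentiable (at x)" if "j \<in> {1..s}" "x \<in> D" for j x
    by (rule formal_limitD(2)[OF fields_limitD(5)[OF FL]]) (rule that)+
  have corr_diff: "(\<lambda>y. c j k * \<phi> k y) differentiable (at x)" if "k \<in> {1..s}" "x \<in> D" for j k x
    by (rule differentiable_bounded_linear[OF bounded_linear_mult_right \<phi>_diff[OF that]])
  have sum_diff: "(\<lambda>y. \<Sum>k\<in>{1..s}. c j k * \<phi> k y) differentiable (at x)" if "x \<in> D" for j x
    using corr_diff that by (intro differentiable_sum) auto
  have q_diff: "q j differentiable (at x)" if "j \<in> {1..s}" "x \<in> D" for j x
    unfolding q_def[abs_def] by (intro differentiable_add pt_diff[OF that] sum_diff[OF that(2)])
  have q_grad: "grad_x (q j) x = grad_x (pt j) x + (\<Sum>k\<in>{1..s}. c j k *\<^sub>R grad_x (\<phi> k) x)"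
    if "j \<in> {1..s}" "x \<in> D" for j x
  proof -
    have "grad_x (q j) x = grad_x (pt j) x + grad_x (\<lambda>y. \<Sum>k\<in>{1..s}. c j k * \<phi> k y) x"
      unfolding q_def[abs_def] by (rule grad_x_add[OF pt_diff[OF that] sum_diff[OF that(2)]])
    also have "grad_x (\<lambda>y. \<Sum>k\<in>{1..s}. c j k * \<phi> k y) x = (\<Sum>k\<in>{1..s}. grad_x (\<lambda>y. c j k * \<phi> k y) x)"
      by (rule grad_x_sum) (rule corr_diff[OF _ that(2)])
    also have "\<dots> = (\<Sum>k\<in>{1..s}. c j k *\<^sub>R grad_x (\<phi> k) x)"
      by (intro sum.cong refl grad_x_scale \<phi>_diff that(2))
    finally show ?thesis .
  qed
  have corr: "(\<Sum>j\<in>{1..i}. A i j *\<^sub>R grad_x (q j) x)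
      = (\<Sum>j\<in>{1..i}. A i j *\<^sub>R grad_x (pt j) x) - (\<Sum>j\<in>{1..<i}. At i j *\<^sub>R grad_x (\<phi> j) x)"
    if i: "i \<in> {1..s}" and x: "x \<in> D" for i x
  proof -
    have "(\<Sum>j\<in>{1..i}. A i j *\<^sub>R grad_x (q j) x)
        = (\<Sum>j\<in>{1..i}. A i j *\<^sub>R grad_x (pt j) x + A i j *\<^sub>R (\<Sum>k\<in>{1..s}. c j k *\<^sub>R grad_x (\<phi> k) x))"
      using i by (intro sum.cong refl) (simp add: q_grad[OF _ x] scaleR_add_right)
    also have "\<dots> = (\<Sum>j\<in>{1..i}. A i j *\<^sub>R grad_x (pt j) x)
        + (\<Sum>j\<in>{1..i}. A i j *\<^sub>R (\<Sum>k\<in>{1..s}. c j k *\<^sub>R grad_x (\<phi> k) x))"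
      by (rule sum.distrib)
    \<comment> \<open>The system for \<open>c\<close> is stated with full rows, so the sum is first
      extended by zeros of \<open>A\<close>; zeros of \<open>At\<close> later cut the sum over
      \<open>k\<close> down to \<open>k < i\<close>.\<close>
    also have "(\<Sum>j\<in>{1..i}. A i j *\<^sub>R (\<Sum>k\<in>{1..s}. c j k *\<^sub>R grad_x (\<phi> k) x))
        = (\<Sum>j\<in>{1..s}. A i j *\<^sub>R (\<Sum>k\<in>{1..s}. c j k *\<^sub>R grad_x (\<phi> k) x))"
      using i triA[OF i] by (intro sum.mono_neutral_left) auto
    also have "\<dots> = (\<Sum>j\<in>{1..s}. \<Sum>k\<in>{1..s}. (A i j * c j k) *\<^sub>R grad_x (\<phi> k) x)"
      by (simp only: scaleR_sum_right scaleR_scaleR)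
    also have "\<dots> = (\<Sum>k\<in>{1..s}. \<Sum>j\<in>{1..s}. (A i j * c j k) *\<^sub>R grad_x (\<phi> k) x)"
      by (rule sum.swap)
    also have "\<dots> = (\<Sum>k\<in>{1..s}. (- At i k) *\<^sub>R grad_x (\<phi> k) x)"
      by (intro sum.cong refl) (simp only: c[OF i] flip: scaleR_sum_left)
    also have "\<dots> = (\<Sum>k\<in>{1..<i}. (- At i k) *\<^sub>R grad_x (\<phi> k) x)"
      using i triAt[OF i] by (intro sum.mono_neutral_right) auto
    finally show ?thesis
      by (simp add: sum_negf)
  qed
  have "ns_imex_stages D \<tau> dt s At A (vel Yn0) (\<lambda>i. vel (Y0 i)) q"
    unfolding ns_imex_stages_def
  proof (intro ballI conjI)
    fix i x assume i: "i \<in> {1..s}" and x: "x \<in> D"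
    show "q i differentiable (at x)" by (rule q_diff[OF i x])
    show "div_x (vel (Y0 i)) x = 0" by (rule div[OF i x])
    have "div_x (vel (Y0 j)) y = 0" if "j \<in> {1..<i}" "y \<in> D" for j y
      using i that by (intro div) auto
    from imex_update_limit_momentum[OF D nz upd[OF i] FLn FL[OF i] FLi[OF i] this x]
    show "vel (Y0 i) x = vel Yn0 x
          + dt *\<^sub>R (\<Sum>j\<in>{1..<i}. At i j *\<^sub>R (\<tau> *\<^sub>R laplacian_x (vel (Y0 j)) x - convect_x (vel (Y0 j)) (vel (Y0 j)) x))
          - dt *\<^sub>R (\<Sum>j\<in>{1..i}. A i j *\<^sub>R grad_x (q j) x)"
      unfolding corr[OF i x] \<phi>_def[abs_def] .
  qed
  moreover have "\<forall>j\<in>{1..s}. \<forall>x\<in>D. q j x = pt j x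
      + (\<Sum>k\<in>{1..s}. c j k * ((norm (vel (Y0 k) x))\<^sup>2 / real CARD('d)))"
    by (simp add: q_def \<phi>_def)
  \<comment> \<open>The new value agrees with the last stage on \<open>D\<close> for all small
    \<epsilon>, so it inherits every limit, that of the rescaled pressure and those of the moments
    included.\<close>
  moreover have "fields_limit D Yn1 (Y0 s) (pt s)"
  proof (rule fields_limit_cong[OF D FL])
    show s_mem: "s \<in> {1..s}" using s by simp
    have gsa: "A s j = w j" if "j \<in> {1..s}" for j
      using assms(8) that unfolding GSA_def implicitly_stiffly_accurate_def by blast
    have gsat: "At s j = wt j" if "j \<in> {1..s - 1}" for j
      using assms(8) that unfolding GSA_def by blast
    have wts: "wt s = 0"
      using assms(8) unfolding GSA_def by blast
    have final: "imex_update D \<tau> dt \<epsilon> {1..s} wt {1..s} w Yn' Y' Z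
        \<longleftrightarrow> imex_update D \<tau> dt \<epsilon> {1..<s} (At s) {1..s} (A s) Yn' Y' Z" for \<epsilon> Yn' Y' and Z :: "'d fields"
    proof (rule imex_update_coefficients_cong)
      show "wt j = At s j" if "j \<in> {1..<s}" for j
        using that by (intro gsat[symmetric]) auto
      show "wt j = 0" if "j \<in> {1..s} - {1..<s}" for j
      proof -
        have "j = s" using that by auto
        then show ?thesis using wts by simp
      qed
      show "w j = A s j" if "j \<in> {1..s}" for j
        using gsa[OF that] by simp
    qed auto
    have "\<forall>\<^sub>F \<epsilon> in at_right 0. imex_update D \<tau> dt \<epsilon> {1..<s} (At s) {1..s} (A s) (Yn \<epsilon>) (Y \<epsilon>) (Yn1 \<epsilon>)"
      using step by eventually_elim (simp only: bgk_imex_step_def final)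
    with upd[OF s_mem] show "\<forall>\<^sub>F \<epsilon> in at_right 0. same_fields_on D (Y \<epsilon> s) (Yn1 \<epsilon>)"
      by eventually_elim (rule imex_update_unique)
  qed
  ultimately show ?thesis by blast
qed

end
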